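(* Let $\tau\ge 0$ and let $u$ be a function defined on $\Gamma$ such that $|u(y)|\le\tau$ for any $y\in\Gamma$. Let $r>0$, let $n\ge 1$ and $m\ge 2$ be integers, and set $N:=2n-1$. Assume that either $\theta_1=\theta_2=-1/2$ (Chebyshev polynomials of the first kind), in which case set $s:=\ln 3/\ln 2$, or $\theta_1,\theta_2\in\mathbb{N}_0$, in which case set $s:=2\max\{\theta_1,\theta_2\}+2$. Let $\zeta:=(1-\ln 2)/2$. (1) In any finite dimension $d$, if at least one of the following three conditions holds: $$\frac{m}{\ln m}\ \ge\ \frac{1+r}{\zeta}\,\bigl(\#(\mathcal{H}_{N}^{d})\bigr)^{s},$$ $$\frac{m}{\ln m}\ \ge\ \Bigl(1+r+\frac{N d\ln 2}{\ln m}\Bigr)\frac{N^{s}}{\zeta},$$ $$\frac{m}{\ln m}\ \ge\ \Bigl(1+r+\frac{N\ln(dN)}{\ln m}\Bigr)\frac{N^{s}}{\zeta},$$ then $$\mathbb{E}\bigl(\|u-T_\tau(w_n)\|^2\bigr)\ \le\ (9+4\sqrt2)\,\|u-u_n\|^2+8\tau^2m^{-r}.$$ (2) In any finite or infinite dimension $d$, if at least one of the following three conditions holds: $$\frac{m}{\ln m}\ \ge\ \frac{1+r}{\zeta}\,\bigl(\#(\mathcal{H}_{N}^{N-1})\bigr)^{s},$$ $$\frac{m}{\ln m}\ \ge\ \Bigl(1+r+\frac{N^2\ln 2}{\ln m}\Bigr)\frac{N^{s}}{\zeta},$$ $$\frac{m}{\ln m}\ \ge\ \Bigl(1+r+\frac{2N\ln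 N}{\ln m}\Bigr)\frac{N^{s}}{\zeta},$$ then $$\mathbb{E}\bigl(\|u-T_\tau(\tilde w_n)\|^2\bigr)\ \le\ (9+4\sqrt2)\,\|u-\tilde u_n\|^2+8\tau^2m^{-r}.$$
   Context: Domain and measure. For $d\in\mathbb{N}$ let $\Gamma=[-1,1]^d$; for $d=\infty$ let $\Gamma=[-1,1]^{\mathbb{N}}$. Given real $\theta_1,\theta_2>-1$, let $d\beta(t)=c(1-t)^{\theta_1}(1+t)^{\theta_2}dt$ be the Jacobi probability measure on $[-1,1]$ ($c$ is the normalizing constant), and let $d\rho=\otimes_{j}d\beta$ be the product probability measure on $\Gamma$ (infinite product if $d=\infty$). $\|\cdot\|$ denotes the norm of $L^2(\Gamma,d\rho)$. The function $u:\Gamma\to\mathbb{R}$ is measurable. The truncation operator is $T_\tau(t)=\mathrm{sign}(t)\min\{\tau,|t|\}$ for $t\in\mathbb{R}$, applied pointwise to functions. Multi-indices. $\mathbb{N}_0=\{0,1,2,\dots\}$. $\mathcal{F}=\mathbb{N}_0^d$ if $d<\infty$; if $d=\infty$, $\mathcal{F}$ is the set of finitely supported sequences of elements of $\mathbb{N}_0$. A set $\Lambda\subset\mathcal{F}$ is downward closed if $\nu\in\Lambda$ and $\mu\le\nu$ (componentwise) imply $\mu\in\Lambda$. It is anchored if it is downward closed and, in addition, $e_j\in\Lambda$ and $j'\le j$ imply $e_{j'}\in\Lambda$, where $e_j$ is the Kronecker sequence with $1$ at position $j$. $\mathcal{M}_n^d$ is the family of all downward closed sets $\Lambda\subset\mathcal{F}$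 with $\#(\Lambda)=n$ and $\mathcal{A}_n$ is the family of all anchored sets $\Lambda\subset\mathcal{F}$ with $\#(\Lambda)=n$. For finite $\Lambda$, $\mathbb{P}_\Lambda=\mathrm{span}\{y\mapsto y^\nu:\nu\in\Lambda\}$. For an integer $q\ge 1$ the hyperbolic cross is $\mathcal{H}_n^q=\{\mu\in\mathbb{N}_0^q:\prod_{j=1}^q(\mu_j+1)\le n\}$; by convention $\#(\mathcal{H}_1^0)=1$. Best approximations (deterministic). $$\Lambda^{opt}=\operatorname{argmin}_{\Lambda\in\mathcal{M}_n^d}\min_{v\in\mathbb{P}_\Lambda}\|u-v\|,\quad u_n=\operatorname{argmin}_{v\in\mathbb{P}_{\Lambda^{opt}}}\|u-v\|,$$ $$\tilde\Lambda^{opt}=\operatorname{argmin}_{\Lambda\in\mathcal{A}_n}\min_{v\in\mathbb{P}_\Lambda}\|u-v\|,\quad \tilde u_n=\operatorname{argmin}_{v\in\mathbb{P}_{\tilde\Lambda^{opt}}}\|u-v\|.$$ Samples and estimators. $y^1,\dots,y^m$ are i.i.d. random points in $\Gamma$ distributed according to $d\rho$, and $\|v\|_m=\bigl(\frac1m\sum_{i=1}^m v(y^i)^2\bigr)^{1/2}$. The (random) optimized index sets and estimators are $$\Lambda_m^{opt}=\operatorname{argmin}_{\Lambda\in\mathcal{M}_n^d}\min_{v\in\mathbb{P}_\Lambda}\|u-v\|_m,\qquad w_n=\operatorname{argmin}_{v\in\mathbb{P}_{\Lambda_m^{opt}}}\|u-v\|_m,$$ $$\tilde\Lambda_m^{opt}=\operatorname{argmin}_{\Lambda\in\mathcal{A}_n}\min_{v\in\mathbb{P}_\Lambda}\|u-v\|_m,\qquad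 \tilde w_n=\operatorname{argmin}_{v\in\mathbb{P}_{\tilde\Lambda_m^{opt}}}\|u-v\|_m.$$ All ties are broken in some arbitrary but fixed (measurable) way. *)

theory Defs
  imports "HOL-Probability.Probability" "HOL-Library.Extended_Nat"
begin

text \<open>The dimension is an extended natural number, and coordinates are numbered from 0: they
  are the \<^term>\<open>j\<close> with \<^term>\<open>enat j < d\<close>. Points and multi-indices are functions on
  \<^typ>\<open>nat\<close>; a multi-index vanishes outside the coordinates.\<close>

definition coords :: "enat \<Rightarrow> nat set" where
  "coords d = {j. enat j < d}"

definition jacobi_weight :: "real \<Rightarrow> real \<Rightarrow> real \<Rightarrow> real" where
  "jacobi_weight \<theta>1 \<theta>2 t = (1 - t) powr \<theta>1 * (1 + t) powr \<theta>2"

definition jacobi_measure :: "real \<Rightarrow> real \<Rightarrow> real measure" where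
  "jacobi_measure \<theta>1 \<theta>2 = density (restrict_space lborel {-1..1})
     (\<lambda>t. ennreal (jacobi_weight \<theta>1 \<theta>2 t / (LINT x:{-1..1}|lborel. jacobi_weight \<theta>1 \<theta>2 x)))"

text \<open>The space of this measure is the cube $[-1,1]^d$, in the form of extensional functions.\<close>

definition jacobi_prod :: "enat \<Rightarrow> real \<Rightarrow> real \<Rightarrow> (nat \<Rightarrow> real) measure" where
  "jacobi_prod d \<theta>1 \<theta>2 = PiM (coords d) (\<lambda>_. jacobi_measure \<theta>1 \<theta>2)"

definition l2norm :: "'a measure \<Rightarrow> ('a \<Rightarrow> real) \<Rightarrow> real" where
  "l2norm M v = sqrt (LINT y|M. (v y)\<^sup>2)"

definition sample_norm :: "nat \<Rightarrow> (nat \<Rightarrow> 'a) \<Rightarrow> ('a \<Rightarrow> real) \<Rightarrow> real" where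
  "sample_norm m y v = sqrt (1 / real m * (\<Sum>i=1..m. (v (y i))\<^sup>2))"

definition truncation :: "real \<Rightarrow> real \<Rightarrow> real" where
  "truncation \<tau> t = sgn t * min \<tau> \<bar>t\<bar>"

definition multi_indices :: "enat \<Rightarrow> (nat \<Rightarrow> nat) set" where
  "multi_indices d = {\<nu>. finite {j. \<nu> j \<noteq> 0} \<and> {j. \<nu> j \<noteq> 0} \<subseteq> coords d}"

definition downward_closed :: "(nat \<Rightarrow> nat) set \<Rightarrow> bool" where
  "downward_closed \<Lambda> \<longleftrightarrow> (\<forall>\<nu>\<in>\<Lambda>. \<forall>\<mu>. \<mu> \<le> \<nu> \<longrightarrow> \<mu> \<in> \<Lambda>)"

definition kronecker_seq :: "nat \<Rightarrow> nat \<Rightarrow> nat" where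
  "kronecker_seq j = (\<lambda>i. if i = j then 1 else 0)"

definition anchored :: "(nat \<Rightarrow> nat) set \<Rightarrow> bool" where
  "anchored \<Lambda> \<longleftrightarrow> downward_closed \<Lambda> \<and>
     (\<forall>j j'. kronecker_seq j \<in> \<Lambda> \<longrightarrow> j' \<le> j \<longrightarrow> kronecker_seq j' \<in> \<Lambda>)"

definition downward_family :: "enat \<Rightarrow> nat \<Rightarrow> (nat \<Rightarrow> nat) set set" where
  "downward_family d n =
     {\<Lambda>. \<Lambda> \<subseteq> multi_indices d \<and> finite \<Lambda> \<and> card \<Lambda> = n \<and> downward_closed \<Lambda>}"

definition anchored_family :: "enat \<Rightarrow> nat \<Rightarrow> (nat \<Rightarrow> nat) set set" where
  "anchored_family d n =
     {\<Lambda>. \<Lambda> \<subseteq> multi_indices d \<and> finite \<Lambda> \<and> card \<Lambda> = n \<and> anchored \<Lambda>}"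

text \<open>For $q = 0$ and $n \ge 1$ this is the singleton of the zero multi-index.\<close>

definition hyperbolic_cross :: "nat \<Rightarrow> nat \<Rightarrow> (nat \<Rightarrow> nat) set" where
  "hyperbolic_cross q n = {\<mu> \<in> multi_indices (enat q). (\<Prod>j<q. \<mu> j + 1) \<le> n}"

definition monomial :: "(nat \<Rightarrow> nat) \<Rightarrow> (nat \<Rightarrow> real) \<Rightarrow> real" where
  "monomial \<nu> y = (\<Prod>j | \<nu> j \<noteq> 0. y j ^ \<nu> j)"

text \<open>The span of the monomials; only meant for finite \<^term>\<open>\<Lambda>\<close>.\<close>

definition poly_space :: "(nat \<Rightarrow> nat) set \<Rightarrow> ((nat \<Rightarrow> real) \<Rightarrow> real) set" where
  "poly_space \<Lambda> = {v. \<exists>c :: (nat \<Rightarrow> nat) \<Rightarrow> real. v = (\<lambda>y. \<Sum>\<nu>\<in>\<Lambda>. c \<nu> * monomial \<nu> y)}"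

text \<open>\<^term>\<open>\<Lambda>\<close> is one of the minimizing index sets in the family and \<^term>\<open>v\<close> one of the
  minimizers over \<^term>\<open>\<Lambda>\<close>, for a seminorm \<^term>\<open>nrm\<close>. The infimum is a minimum for finite
  \<^term>\<open>\<Lambda>\<close>.\<close>

definition best_approximation ::
  "(((nat \<Rightarrow> real) \<Rightarrow> real) \<Rightarrow> real) \<Rightarrow> ((nat \<Rightarrow> real) \<Rightarrow> real) \<Rightarrow>
   (nat \<Rightarrow> nat) set set \<Rightarrow> (nat \<Rightarrow> nat) set \<Rightarrow> ((nat \<Rightarrow> real) \<Rightarrow> real) \<Rightarrow> bool" where
  "best_approximation nrm u \<F> \<Lambda> v \<longleftrightarrow>
     is_arg_min (\<lambda>L. INF p\<in>poly_space L. nrm (\<lambda>y. u y - p y)) (\<lambda>L. L \<in> \<F>) \<Lambda> \<and>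
     is_arg_min (\<lambda>p. nrm (\<lambda>y. u y - p y)) (\<lambda>p. p \<in> poly_space \<Lambda>) v"

text \<open>The same for the empirical norms of the random sample \<^term>\<open>Y\<close>, with an arbitrary
  selection among the minimizers. The measurability conditions make the expected squared error
  of the estimator meaningful.\<close>

definition sample_estimator ::
  "'w measure \<Rightarrow> (nat \<Rightarrow> real) measure \<Rightarrow> nat \<Rightarrow> (nat \<Rightarrow> 'w \<Rightarrow> nat \<Rightarrow> real) \<Rightarrow>
   ((nat \<Rightarrow> real) \<Rightarrow> real) \<Rightarrow> (nat \<Rightarrow> nat) set set \<Rightarrow>
   ('w \<Rightarrow> (nat \<Rightarrow> nat) set) \<Rightarrow> ('w \<Rightarrow> (nat \<Rightarrow> real) \<Rightarrow> real) \<Rightarrow> bool" where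
  "sample_estimator P \<rho> m Y u \<F> \<Lambda> w \<longleftrightarrow>
     (\<forall>\<omega>\<in>space P. best_approximation (sample_norm m (\<lambda>i. Y i \<omega>)) u \<F> (\<Lambda> \<omega>) (w \<omega>)) \<and>
     \<Lambda> \<in> measurable P (count_space \<F>) \<and>
     (\<lambda>(\<omega>, y). w \<omega> y) \<in> borel_measurable (P \<Otimes>\<^sub>M \<rho>)"

end

theory Submission
  imports Defs "HOL-Computational_Algebra.Polynomial"
begin

text \<open>Expanding in tensorised orthonormal polynomials $L_\nu$, the squares
  $\sum_{\nu \in \Lambda} L_\nu(y)^2$ are at most $\#(\Lambda)^s$ on a downward closed set
  $\Lambda$: slicing along one coordinate reduces this to the univariate bound
  $\sum_{k<n} L_k(t)^2 \le n^s$. A matrix Chernoff bound for the lower tail then gives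
  $\|v\|^2 \le 2\|v\|_m^2$ for all $v$ in the polynomial space, outside an event of probability at
  most $2\#(\Lambda)\exp(-\zeta m/\#(\Lambda)^s)$. Either one applies this once, to the hyperbolic
  cross, which contains all the index sets in question, or one takes a union bound over the sets
  $\Lambda \cup \Lambda^{opt}$, whose number is controlled by counting downward closed sets. Where
  the norms are comparable,
  $\|u-w_n\| \le \|u-u_n\| + \sqrt2\,\|u_n-w_n\|_m \le \|u-u_n\| + 2\sqrt2\,\|u-u_n\|_m$;
  on the exceptional event the truncation bounds the squared error by $4\tau^2$.\<close>

section \<open>Powers of symmetric matrices over a finite index set\<close>

text \<open>Origins of the constants. The Chernoff exponent for losing a fraction \<delta> of the
  smallest eigenvalue is \<delta> + (1 - \<delta>) ln (1 - \<delta>); at \<delta> = 1/2 it equals (1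
  - ln 2)/2, and the same \<delta> puts the factor 2 in front of the empirical norm. The 1 in 1 + r
  pays for the cardinality in the Chernoff prefactor, because the conditions force this cardinality
  to be at most m; a probability 2 m^(-r) remains, and 4 \<tau>^2 times it is the last summand. The
  factor 9 + 4 sqrt 2 comes from the mean of (a + 2 sqrt 2 b)^2, where a is the true and b the
  empirical error of u_n: the mean of b^2 is a^2, and 2ab is estimated by a^2 + b^2. Two nonempty
  downward closed sets share the zero index, hence N = 2n - 1. The matrix part avoids eigenvalues:
  it works only with the numbers <v, A^k v> and with the trace of an even power of A, whose exponent
  is taken large at the end.\<close>

definition dot :: "'i set \<Rightarrow> ('i \<Rightarrow> real) \<Rightarrow> ('i \<Rightarrow> real) \<Rightarrow> real" where
  "dot I v w = (\<Sum>i\<in>I. v i * w i)"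

text \<open>Vectors and matrices are functions on the whole index type, but only their values on
  \<open>I\<close> carry meaning. Hence symmetry is required on \<open>I\<close> alone, and
  \<open>dot I v v = 0\<close> makes \<open>v\<close> vanish only there.\<close>

definition mat_vec :: "'i set \<Rightarrow> ('i \<Rightarrow> 'i \<Rightarrow> real) \<Rightarrow> ('i \<Rightarrow> real) \<Rightarrow> 'i \<Rightarrow> real" where
  "mat_vec I M v = (\<lambda>i. \<Sum>k\<in>I. M i k * v k)"

lemma dot_commute: "dot I v w = dot I w v"
  by (simp add: dot_def mult.commute)

lemma dot_self_nonneg [simp]: "dot I v v \<ge> 0"
  by (simp add: dot_def sum_nonneg)

lemma dot_self_eq_0: "finite I \<Longrightarrow> dot I v v = 0 \<Longrightarrow> i \<in> I \<Longrightarrow> v i = 0"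
  by (auto simp: dot_def sum_nonneg_eq_0_iff)

lemma Cauchy_Schwarz_dot: "(dot I v w)\<^sup>2 \<le> dot I v v * dot I w w"
  using Cauchy_Schwarz_ineq_sum[of v w I] by (simp add: dot_def power2_eq_square)

lemma dot_diff_left: "dot I (\<lambda>i. v i - c * w i) x = dot I v x - c * dot I w x"
  by (simp add: dot_def left_diff_distrib sum_subtractf sum_distrib_left mult.assoc)

lemma dot_diff_right: "dot I x (\<lambda>i. v i - c * w i) = dot I x v - c * dot I x w"
  by (metis dot_commute dot_diff_left)

lemma mat_vec_diff: "mat_vec I M (\<lambda>i. v i - c * w i) = (\<lambda>i. mat_vec I M v i - c * mat_vec I M w i)"
  by (auto simp: mat_vec_def right_diff_distrib sum_subtractf sum_distrib_left algebra_simps)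

lemma mat_vec_sum: "mat_vec I M (\<lambda>i. \<Sum>a\<in>A. v a i * c a) i = (\<Sum>a\<in>A. mat_vec I M (v a) i * c a)"
  unfolding mat_vec_def sum_distrib_left sum_distrib_right
  by (subst sum.swap) (simp add: mult.assoc)

lemma dot_cong: "(\<And>i. i \<in> I \<Longrightarrow> v i = v' i) \<Longrightarrow> (\<And>i. i \<in> I \<Longrightarrow> w i = w' i) \<Longrightarrow> dot I v w = dot I v' w'"
  by (simp add: dot_def)

locale sym_mat =
  fixes I :: "'i set" and M :: "'i \<Rightarrow> 'i \<Rightarrow> real"
  assumes fin: "finite I"
    and sym: "i \<in> I \<Longrightarrow> k \<in> I \<Longrightarrow> M i k = M k i"
begin

abbreviation "A \<equiv> mat_vec I M"

lemma dot_mat_vec_sym: "dot I (A v) w = dot I v (A w)"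
proof -
  have "dot I (A v) w = (\<Sum>i\<in>I. \<Sum>k\<in>I. M k i * v k * w i)"
    unfolding dot_def mat_vec_def sum_distrib_right using sym by (intro sum.cong) auto
  also have "\<dots> = dot I v (A w)"
    unfolding dot_def mat_vec_def sum_distrib_left by (subst sum.swap) (intro sum.cong; simp)
  finally show ?thesis .
qed

lemma dot_pow_sym: "dot I ((A ^^ k) v) w = dot I v ((A ^^ k) w)"
proof (induction k arbitrary: v w)
  case (Suc k)
  have "dot I ((A ^^ Suc k) v) w = dot I ((A ^^ k) v) (A w)"
    by (simp add: dot_mat_vec_sym)
  also have "\<dots> = dot I v ((A ^^ Suc k) w)"
    using Suc by (simp add: funpow_swap1)
  finally show ?case .
qed auto

lemma dot_pow_add: "dot I ((A ^^ a) v) ((A ^^ b) w) = dot I v ((A ^^ (a + b)) w)"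
  by (simp add: dot_pow_sym funpow_add)

end

section \<open>Moment inequalities for a symmetric matrix with spectrum in [\<gamma>, 1]\<close>

locale posdef_mat = sym_mat I M for I :: "'i set" and M +
  fixes \<gamma> :: real
  assumes \<gamma>: "0 < \<gamma>"
    and lower: "\<gamma> * dot I v v \<le> dot I v (mat_vec I M v)"
    and upper: "dot I v (mat_vec I M v) \<le> dot I v v"
begin

text \<open>The k-th moment of the spectral measure of \<open>v\<close>. What follows are the
  inequalities of a moment sequence on [\<gamma>, 1], derived from the quadratic form without that
  measure.\<close>

definition moment :: "('i \<Rightarrow> real) \<Rightarrow> nat \<Rightarrow> real" where "moment v k = dot I v ((A ^^ k) v)"

lemma form_nonneg: "dot I v (A v) \<ge> 0"
  using lower[of v] \<gamma> by (meson dot_self_nonneg less_imp_le mult_nonneg_nonneg order_trans)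

text \<open>Discriminant argument for the form of \<open>A\<close>. It stands in for the
  Cauchy-Schwarz inequality applied to square-root images of the vectors; definiteness settles the
  degenerate case.\<close>

lemma Cauchy_Schwarz_form: "(dot I v (A w))\<^sup>2 \<le> dot I v (A v) * dot I w (A w)"
proof (cases "dot I w (A w) = 0")
  case True
  then have "dot I w w = 0"
    using lower[of w] \<gamma> dot_self_nonneg[of I w] by (simp add: mult_le_0_iff)
  have "w i = 0" if "i \<in> I" for i by (rule dot_self_eq_0[OF fin \<open>dot I w w = 0\<close> that])
  then have "dot I v (A w) = 0"
    by (simp add: dot_mat_vec_sym[symmetric]) (simp add: dot_def)
  then show ?thesis using True by simp
next
  case False
  define x where "x = dot I w (A w)"
  define c where "c = dot I v (A w) / x"
  have x: "x > 0" using False form_nonneg[of w] by (simp add: x_def)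
  have e: "dot I w (A v) = dot I v (A w)" by (metis dot_mat_vec_sym dot_commute)
  have "0 \<le> dot I (\<lambda>i. v i - c * w i) (A (\<lambda>i. v i - c * w i))"
    by (rule form_nonneg)
  also have "\<dots> = dot I v (A v) - 2 * c * dot I v (A w) + c\<^sup>2 * x"
    by (simp add: mat_vec_diff dot_diff_left dot_diff_right e x_def algebra_simps power2_eq_square)
  also have "\<dots> = dot I v (A v) - (dot I v (A w))\<^sup>2 / x"
    using x by (simp add: c_def field_simps power2_eq_square)
  finally show ?thesis using x by (simp add: x_def field_simps)
qed

text \<open>Cauchy-Schwarz for the vectors A^c v and A^(c+1) v. For even k = 2c the plain inner
  product gives the three exponents; for odd k = 2c + 1 the missing power is supplied by the inner
  product of \<open>A\<close>.\<close>

lemma moment_logconvex: "(moment v (Suc k))\<^sup>2 \<le> moment v k * moment v (Suc (Suc k))"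
proof (cases "even k")
  case True
  then obtain c where "k = 2 * c" by (rule evenE)
  then have c: "k = c + c" by simp
  have 1: "moment v (Suc k) = dot I ((A ^^ c) v) ((A ^^ Suc c) v)"
    unfolding dot_pow_add by (simp add: moment_def c)
  have 2: "moment v k = dot I ((A ^^ c) v) ((A ^^ c) v)"
    unfolding dot_pow_add by (simp add: moment_def c)
  have 3: "moment v (Suc (Suc k)) = dot I ((A ^^ Suc c) v) ((A ^^ Suc c) v)"
    unfolding dot_pow_add by (simp add: moment_def c)
  show ?thesis unfolding 1 2 3 by (rule Cauchy_Schwarz_dot)
next
  case False
  then obtain c where "k = 2 * c + 1" by (rule oddE)
  then have c: "k = c + Suc c" by simp
  have 1: "moment v (Suc k) = dot I ((A ^^ c) v) (A ((A ^^ Suc c) v))"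
    using dot_pow_add[of c v "Suc (Suc c)" v] by (simp add: moment_def c)
  have 2: "moment v k = dot I ((A ^^ c) v) (A ((A ^^ c) v))"
    using dot_pow_add[of c v "Suc c" v] by (simp add: moment_def c)
  have 3: "moment v (Suc (Suc k)) = dot I ((A ^^ Suc c) v) (A ((A ^^ Suc c) v))"
    using dot_pow_add[of "Suc c" v "Suc (Suc c)" v] by (simp add: moment_def c)
  show ?thesis unfolding 1 2 3 by (rule Cauchy_Schwarz_form)
qed

lemma moment_pos:
  assumes "dot I v v > 0" shows "moment v k > 0"
proof (induction k rule: less_induct)
  case (less k)
  consider "k = 0" | "k = 1" | c where "k = Suc (Suc c)"
    by (cases k; cases "k - 1") auto
  then show ?case
  proof cases
    case 1 then show ?thesis using assms by (simp add: moment_def)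
  next
    case 2
    have "0 < \<gamma> * dot I v v" using assms \<gamma> by simp
    then show ?thesis using 2 lower[of v] by (simp add: moment_def)
  next
    case 3
    have "moment v c > 0" "moment v (Suc c) > 0" using less 3 by auto
    then have "0 < moment v c * moment v (Suc (Suc c))"
      using moment_logconvex[of v c] by (meson less_le_trans zero_less_power)
    then show ?thesis unfolding 3 using \<open>moment v c > 0\<close> by (rule zero_less_mult_pos)
  qed
qed

lemma moment_zero:
  assumes "dot I v v = 0" shows "moment v k = 0"
proof -
  have "v i = 0" if "i \<in> I" for i by (rule dot_self_eq_0[OF fin assms that])
  then show ?thesis unfolding moment_def dot_def by simp
qed

lemma moment_cases:
  assumes "(\<And>k. moment v k > 0) \<Longrightarrow> Q" "(\<And>k. moment v k = 0) \<Longrightarrow> Q" shows Q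
  using assms moment_pos[of v] moment_zero[of v] dot_self_nonneg[of I v] by (cases "dot I v v = 0") auto

lemma moment_nonneg: "moment v k \<ge> 0"
  by (rule moment_cases[of v]) (auto simp: less_imp_le)

text \<open>By log-convexity the quotients of consecutive moments increase. The product form also
  holds for a null vector, all of whose moments vanish.\<close>

lemma moment_ratio_mono:
  assumes "i \<le> j" shows "moment v (Suc i) * moment v j \<le> moment v i * moment v (Suc j)"
proof (rule moment_cases[of v])
  assume p: "\<And>k. moment v k > 0"
  have "moment v (Suc i) / moment v i \<le> moment v (Suc j) / moment v j" using assms
  proof (induction j rule: dec_induct)
    case (step j)
    have "moment v (Suc j) / moment v j \<le> moment v (Suc (Suc j)) / moment v (Suc j)"
      using moment_logconvex[of v j] p by (simp add: field_simps power2_eq_square)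
    then show ?case using step by linarith
  qed auto
  then show ?thesis using p[of i] p[of j] by (simp add: field_simps)
qed simp

text \<open>Chebyshev's association inequality: two powers of the spectral variable are both
  increasing, hence positively correlated. Here it follows from the monotone quotients, one power at
  a time.\<close>

lemma moment_mult_le: "moment v i * moment v j \<le> moment v 0 * moment v (i + j)"
proof (rule moment_cases[of v])
  assume p: "\<And>k. moment v k > 0"
  show ?thesis
  proof (induction i)
    case (Suc i)
    have "moment v (Suc i) * moment v j * (moment v i * moment v (i + j)) = (moment v i * moment v j) * (moment v (Suc i) * moment v (i + j))"
      by simp
    also have "\<dots> \<le> (moment v 0 * moment v (i + j)) * (moment v i * moment v (Suc (i + j)))"
      using Suc moment_ratio_mono[of i "i + j" v] by (rule mult_mono) (auto simp: less_imp_le p)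
    also have "\<dots> = (moment v 0 * moment v (Suc i + j)) * (moment v i * moment v (i + j))" by simp
    finally show ?case using p[of i] p[of "i+j"] by simp
  qed simp
qed simp

lemma moment_Suc_ge: "\<gamma> * moment v k \<le> moment v (Suc k)"
proof (rule moment_cases[of v])
  assume p: "\<And>k. moment v k > 0"
  have "\<gamma> * moment v 0 * moment v k \<le> moment v 1 * moment v k"
    using lower[of v] p[of k] by (intro mult_right_mono) (auto simp: moment_def)
  also have "\<dots> \<le> moment v 0 * moment v (Suc k)" using moment_ratio_mono[of 0 k v] by simp
  finally have "moment v 0 * (\<gamma> * moment v k) \<le> moment v 0 * moment v (Suc k)" by (simp add: mult_ac)
  then show ?thesis using p[of 0] by simp
qed simp

text \<open>The upper bound of the form, applied to A^k v, compares the moments 2k + 1 and 2k. As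
  the quotients increase, the earlier quotient at k is at most 1 as well.\<close>

lemma moment_Suc_le: "moment v (Suc k) \<le> moment v k"
proof (rule moment_cases[of v])
  assume p: "\<And>k. moment v k > 0"
  have e: "moment v (Suc (k + k)) \<le> moment v (k + k)"
    using upper[of "(A ^^ k) v"] dot_pow_add[of k v k v] dot_pow_add[of k v "Suc k" v] by (simp add: moment_def)
  have "moment v (Suc k) * moment v (k + k) \<le> moment v k * moment v (Suc (k + k))"
    using moment_ratio_mono[of k "k + k" v] by simp
  also have "\<dots> \<le> moment v k * moment v (k + k)" using e p[of k] by simp
  finally show ?thesis using p[of "k + k"] by simp
qed simp

text \<open>Jensen's inequality for the k-th power under the spectral measure of a unit
  vector.\<close>

lemma moment_ge_power:
  assumes "dot I v v = 1" shows "(moment v 1) ^ k \<le> moment v k"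
proof (induction k)
  case 0 then show ?case using assms by (simp add: moment_def)
next
  case (Suc k)
  have "moment v 1 * moment v 1 ^ k \<le> moment v 1 * moment v k" using Suc moment_nonneg[of v 1] by (rule mult_left_mono)
  also have "\<dots> \<le> moment v (Suc k)" using moment_ratio_mono[of 0 k v] assms by (simp add: moment_def)
  finally show ?case by simp
qed

end

section \<open>Traces of matrix powers and their change under rank-one updates\<close>

definition unit_vec :: "'i \<Rightarrow> 'i \<Rightarrow> real" where "unit_vec i = (\<lambda>k. if k = i then 1 else 0)"

definition trace_pow :: "'i set \<Rightarrow> ('i \<Rightarrow> 'i \<Rightarrow> real) \<Rightarrow> nat \<Rightarrow> real" where
  "trace_pow I M L = (\<Sum>i\<in>I. (mat_vec I M ^^ L) (unit_vec i) i)"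

lemma dot_unit_vec: "finite I \<Longrightarrow> i \<in> I \<Longrightarrow> dot I v (unit_vec i) = v i"
  by (simp add: dot_def unit_vec_def if_distrib sum.delta cong: if_cong)

context sym_mat begin

text \<open>Evenness splits A^L into two equal halves: each entry of A^l v is an inner product of
  the unit vector \<open>v\<close> with A^l e_i, and the squared length of A^l e_i is a diagonal
  entry of A^L.\<close>

lemma trace_ge_form:
  assumes "even L" "dot I v v = 1"
  shows "dot I v ((A ^^ L) v) \<le> trace_pow I M L"
proof -
  obtain l where l: "L = l + l" using assms by (metis evenE mult_2)
  have c: "((A ^^ l) v i)\<^sup>2 \<le> (A ^^ L) (unit_vec i) i" if i: "i \<in> I" for i
  proof -
    have "(A ^^ l) v i = dot I v ((A ^^ l) (unit_vec i))"
      using dot_unit_vec[OF fin i, of "(A ^^ l) v"] by (simp add: dot_pow_sym)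
    then have "((A ^^ l) v i)\<^sup>2 \<le> dot I ((A ^^ l) (unit_vec i)) ((A ^^ l) (unit_vec i))"
      using Cauchy_Schwarz_dot[of I v "(A ^^ l) (unit_vec i)"] assms by simp
    also have "\<dots> = (A ^^ L) (unit_vec i) i"
      by (metis dot_pow_add l dot_commute dot_unit_vec fin i)
    finally show ?thesis .
  qed
  have "dot I v ((A ^^ L) v) = dot I ((A ^^ l) v) ((A ^^ l) v)" by (simp add: dot_pow_add l)
  also have "\<dots> = (\<Sum>i\<in>I. ((A ^^ l) v i)\<^sup>2)" by (simp add: dot_def power2_eq_square)
  also have "\<dots> \<le> trace_pow I M L" unfolding trace_pow_def by (intro sum_mono c)
  finally show ?thesis .
qed

lemma trace_pow_nonneg: "even L \<Longrightarrow> trace_pow I M L \<ge> 0"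
  unfolding trace_pow_def
proof (intro sum_nonneg)
  fix i assume "even L" and i: "i \<in> I"
  then obtain l where l: "L = l + l" by (metis evenE mult_2)
  have "(A ^^ L) (unit_vec i) i = dot I ((A ^^ l) (unit_vec i)) ((A ^^ l) (unit_vec i))"
    by (metis dot_pow_add l dot_commute dot_unit_vec fin i)
  then show "0 \<le> (A ^^ L) (unit_vec i) i" by simp
qed

end

definition downdate :: "('i \<Rightarrow> 'i \<Rightarrow> real) \<Rightarrow> real \<Rightarrow> ('i \<Rightarrow> real) \<Rightarrow> 'i \<Rightarrow> 'i \<Rightarrow> real" where
  "downdate M c \<phi> = (\<lambda>i k. M i k - c * \<phi> i * \<phi> k)"

lemma mat_vec_downdate: "mat_vec I (downdate M c \<phi>) v i = mat_vec I M v i - c * \<phi> i * dot I \<phi> v"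
  by (simp add: mat_vec_def downdate_def dot_def left_diff_distrib sum_subtractf sum_distrib_left mult.assoc)

lemma dot_mat_vec_downdate: "dot I v (mat_vec I (downdate M c \<phi>) v) = dot I v (mat_vec I M v) - c * (dot I \<phi> v)\<^sup>2"
proof -
  have "dot I v (mat_vec I (downdate M c \<phi>) v) = (\<Sum>i\<in>I. v i * mat_vec I M v i - c * dot I \<phi> v * (\<phi> i * v i))"
    unfolding dot_def[of I v] mat_vec_downdate by (intro sum.cong) (auto simp: algebra_simps)
  also have "\<dots> = dot I v (mat_vec I M v) - c * dot I \<phi> v * dot I \<phi> v"
    by (simp add: sum_subtractf sum_distrib_left dot_def)
  finally show ?thesis by (simp add: power2_eq_square)
qed

text \<open>Leibniz rule for a power of a matrix that does not commute with its derivative: the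
  derivative - b \<phi>\<phi>^T is inserted at each of the k positions in turn.\<close>

lemma has_derivative_pow_downdate:
  fixes I :: "'i set" and M b \<phi>
  defines "B \<equiv> \<lambda>t. mat_vec I (downdate M (t * b) \<phi>)"
  shows "((\<lambda>t. (B t ^^ k) v i) has_real_derivative
     (\<Sum>a<k. (B t ^^ a) \<phi> i * (- b * dot I \<phi> ((B t ^^ (k - 1 - a)) v)))) (at t)"
proof (induction k arbitrary: i)
  case (Suc k)
  define X where "X = (\<lambda>i. \<Sum>a<k. (B t ^^ a) \<phi> i * (- b * dot I \<phi> ((B t ^^ (k - 1 - a)) v)))"
  have X: "((\<lambda>t. (B t ^^ k) v i) has_real_derivative X i) (at t)" for i
    unfolding X_def by (rule Suc)
  have dot': "((\<lambda>t. dot I \<phi> ((B t ^^ k) v)) has_real_derivative dot I \<phi> X) (at t)"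
    unfolding dot_def by (intro DERIV_sum DERIV_cmult X)
  have M': "((\<lambda>t. mat_vec I M ((B t ^^ k) v) i) has_real_derivative mat_vec I M X i) (at t)"
    unfolding mat_vec_def by (intro DERIV_sum DERIV_cmult X)
  have eq: "(B t ^^ Suc k) v i = mat_vec I M ((B t ^^ k) v) i - t * b * \<phi> i * dot I \<phi> ((B t ^^ k) v)" for t
    by (simp add: B_def mat_vec_downdate)
  have "((\<lambda>t. (B t ^^ Suc k) v i) has_real_derivative
      mat_vec I M X i - (b * \<phi> i * dot I \<phi> ((B t ^^ k) v) + dot I \<phi> X * (t * b * \<phi> i))) (at t)"
    unfolding eq
    by (rule DERIV_diff[OF M' DERIV_mult[OF _ dot']]) (auto intro!: derivative_eq_intros)
  also have "mat_vec I M X i - (b * \<phi> i * dot I \<phi> ((B t ^^ k) v) + dot I \<phi> X * (t * b * \<phi> i))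
      = B t X i + \<phi> i * (- b * dot I \<phi> ((B t ^^ k) v))"
    by (simp add: B_def mat_vec_downdate)
  also have "B t X i = (\<Sum>a<k. (B t ^^ Suc a) \<phi> i * (- b * dot I \<phi> ((B t ^^ (k - 1 - a)) v)))"
    unfolding X_def B_def mat_vec_sum by simp
  also have "\<dots> + \<phi> i * (- b * dot I \<phi> ((B t ^^ k) v)) =
      (\<Sum>a<Suc k. (B t ^^ a) \<phi> i * (- b * dot I \<phi> ((B t ^^ (Suc k - 1 - a)) v)))"
    by (subst sum.lessThan_Suc_shift) simp
  finally show ?case .
qed auto

text \<open>For $A = I - cS$, the polynomial $A^L$ takes the place of $\exp(-cLS)$ in the rank-one case
  of the Golden--Thompson inequality, so that no spectral theorem is needed. Along $A - tb\phi\phi^T$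
  the trace has derivative $-bLq(t)$ with $q(t) = \langle\phi, A_t^{L-1}\phi\rangle$, and the
  log-convexity of $k \mapsto \langle\phi, A_t^k\phi\rangle$ bounds the decay of $q$.\<close>

lemma trace_pow_downdate_le:
  fixes I :: "'i set" and \<gamma> K b :: real
  assumes fin: "finite I" and sym: "\<And>i k. i \<in> I \<Longrightarrow> k \<in> I \<Longrightarrow> M i k = M k i"
    and \<gamma>: "0 < \<gamma>" "\<gamma> \<le> 1" and K: "0 < K" "dot I \<phi> \<phi> \<le> K" and L: "L \<ge> 2"
    and lower: "\<And>v. \<gamma> * dot I v v \<le> dot I v (mat_vec I M v) - ln 2 / (K * real L) * (dot I \<phi> v)\<^sup>2"
    and upper: "\<And>v. dot I v (mat_vec I M v) \<le> dot I v v"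
  shows "trace_pow I (downdate M (ln 2 / (K * real L)) \<phi>) L
    \<le> trace_pow I M L - \<gamma> / (2 * K) * dot I \<phi> ((mat_vec I M ^^ L) \<phi>)"
proof -
  \<comment> \<open>This step size makes b L K = ln 2, the optimal Chernoff parameter - ln (1 -
    \<delta>) at \<delta> = 1/2.\<close>
  define b where "b = ln 2 / (K * real L)"
  define \<theta> where "\<theta> = ln 2 / K"
  define \<kappa> where "\<kappa> = ln 2 / \<gamma>"
  have b: "b > 0" using K L by (simp add: b_def)
  have bL: "b * real L = \<theta>" using L by (simp add: b_def \<theta>_def)
  have \<theta>: "\<theta> > 0" using K by (simp add: \<theta>_def)
  have \<kappa>: "\<kappa> > 0" using \<gamma> by (simp add: \<kappa>_def)
  let ?D = "\<lambda>t. downdate M (t * b) \<phi>"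
  define B where "B = (\<lambda>t. mat_vec I (?D t))"
  define p where "p = (\<lambda>t. trace_pow I (?D t) L)"
  define q where "q = (\<lambda>t. dot I \<phi> ((B t ^^ (L - 1)) \<phi>))"
  have loc: "posdef_mat I (?D t) \<gamma>" if t: "0 \<le> t" "t \<le> 1" for t
  proof (unfold_locales; (rule fin \<gamma>)?)
    show "?D t i k = ?D t k i" if "i \<in> I" "k \<in> I" for i k
      using sym[OF that] by (simp add: downdate_def)
    fix v
    have "t * b * (dot I \<phi> v)\<^sup>2 \<le> 1 * b * (dot I \<phi> v)\<^sup>2" using t b by (intro mult_right_mono) auto
    then show "\<gamma> * dot I v v \<le> dot I v (mat_vec I (?D t) v)"
      unfolding dot_mat_vec_downdate using lower[of v] by (simp add: b_def)
    have "0 \<le> t * b * (dot I \<phi> v)\<^sup>2" using t b by simp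
    then show "dot I v (mat_vec I (?D t) v) \<le> dot I v v"
      unfolding dot_mat_vec_downdate using upper[of v] by simp
  qed
  have p': "(p has_real_derivative - \<theta> * q t) (at t)" if t: "0 \<le> t" "t \<le> 1" for t
  proof -
    interpret posdef_mat I "?D t" \<gamma> using loc t .
    have "(p has_real_derivative
      (\<Sum>i\<in>I. \<Sum>a<L. (B t ^^ a) \<phi> i * (- b * dot I \<phi> ((B t ^^ (L - 1 - a)) (unit_vec i))))) (at t)"
      unfolding p_def trace_pow_def B_def by (intro DERIV_sum has_derivative_pow_downdate)
    \<comment> \<open>Cyclicity of the trace in disguise: by symmetry the unit vector is moved away,
      and summing over \<open>i\<close> then gives the same value \<open>q t\<close> at each of the
      L positions of the derivative.\<close>
    also have "(\<Sum>i\<in>I. \<Sum>a<L. (B t ^^ a) \<phi> i * (- b * dot I \<phi> ((B t ^^ (L - 1 - a)) (unit_vec i))))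
      = (\<Sum>i\<in>I. \<Sum>a<L. - b * ((B t ^^ a) \<phi> i * (B t ^^ (L - 1 - a)) \<phi> i))"
    proof (intro sum.cong refl)
      fix i a assume "i \<in> I"
      then have "dot I \<phi> ((B t ^^ (L - 1 - a)) (unit_vec i)) = (B t ^^ (L - 1 - a)) \<phi> i"
        using dot_pow_sym[of "L - 1 - a" \<phi> "unit_vec i"] by (simp add: B_def dot_unit_vec[OF fin])
      then show "(B t ^^ a) \<phi> i * (- b * dot I \<phi> ((B t ^^ (L - 1 - a)) (unit_vec i)))
        = - b * ((B t ^^ a) \<phi> i * (B t ^^ (L - 1 - a)) \<phi> i)" by simp
    qed
    also have "\<dots> = (\<Sum>a<L. - b * dot I ((B t ^^ a) \<phi>) ((B t ^^ (L - 1 - a)) \<phi>))"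
      by (subst sum.swap) (simp add: dot_def sum_distrib_left)
    also have "\<dots> = (\<Sum>a<L. - b * q t)"
      unfolding B_def q_def by (intro sum.cong refl) (simp add: dot_pow_add)
    also have "\<dots> = - \<theta> * q t" using bL by (simp add: mult_ac)
    finally show ?thesis .
  qed
  have q': "\<exists>d. (q has_real_derivative d) (at t) \<and> d \<ge> - \<kappa> * q t" if t: "0 \<le> t" "t \<le> 1" for t
  proof -
    interpret posdef_mat I "?D t" \<gamma> using loc t .
    have hB: "moment v k = dot I v ((B t ^^ k) v)" for v k by (simp add: moment_def B_def)
    define x where "x = (\<lambda>a. dot I \<phi> ((B t ^^ (L - 1 - 1 - a)) \<phi>))"
    have "((\<lambda>t. (B t ^^ (L - 1)) \<phi> i) has_real_derivative (\<Sum>a<L-1. (B t ^^ a) \<phi> i * (- b * x a))) (at t)" for i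
      unfolding x_def B_def by (rule has_derivative_pow_downdate)
    then have "(q has_real_derivative (\<Sum>i\<in>I. \<phi> i * (\<Sum>a<L-1. (B t ^^ a) \<phi> i * (- b * x a)))) (at t)"
      unfolding q_def dot_def by (intro DERIV_sum DERIV_cmult)
    also have "(\<Sum>i\<in>I. \<phi> i * (\<Sum>a<L-1. (B t ^^ a) \<phi> i * (- b * x a)))
      = (\<Sum>a<L-1. - b * (dot I \<phi> ((B t ^^ a) \<phi>) * x a))"
      unfolding sum_distrib_left dot_def sum_distrib_right
      by (subst sum.swap) (simp add: mult_ac)
    also have "\<dots> = (\<Sum>a<L-1. - b * (moment \<phi> a * moment \<phi> (L - 2 - a)))"
      by (simp add: x_def hB numeral_2_eq_2)
    finally have d: "(q has_real_derivative (\<Sum>a<L-1. - b * (moment \<phi> a * moment \<phi> (L - 2 - a)))) (at t)" .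
    \<comment> \<open>Each product is at most m_0 m_(L-2) for the moments m_k of \<phi>; here m_0 is
      at most K and m_(L-2) at most m_(L-1) / \<gamma>. With b L K = ln 2 this is the decay rate
      \<kappa> = ln 2 / \<gamma>.\<close>
    have "(\<Sum>a<L-1. moment \<phi> a * moment \<phi> (L - 2 - a)) \<le> (\<Sum>a<L-1. moment \<phi> 0 * moment \<phi> (L - 2))"
    proof (rule sum_mono)
      fix a assume "a \<in> {..<L-1}"
      then have "a + (L - 2 - a) = L - 2" by auto
      then show "moment \<phi> a * moment \<phi> (L - 2 - a) \<le> moment \<phi> 0 * moment \<phi> (L - 2)"
        using moment_mult_le[of \<phi> a "L - 2 - a"] by simp
    qed
    also have "\<dots> = real (L - 1) * (moment \<phi> 0 * moment \<phi> (L - 2))" by simp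
    also have "\<dots> \<le> real L * (K * moment \<phi> (L - 2))"
      using K(2) moment_nonneg[of \<phi>] by (intro mult_mono mult_right_mono) (auto simp: moment_def)
    also have "\<dots> \<le> real L * (K * (moment \<phi> (L - 1) / \<gamma>))"
      using moment_Suc_ge[of \<phi> "L - 2"] \<gamma> L K
      by (intro mult_left_mono) (auto simp: field_simps Suc_diff_Suc numeral_2_eq_2)
    finally have "b * (\<Sum>a<L-1. moment \<phi> a * moment \<phi> (L - 2 - a)) \<le> b * (real L * (K * (moment \<phi> (L - 1) / \<gamma>)))"
      using b by (intro mult_left_mono) auto
    also have "\<dots> = (b * real L) * K / \<gamma> * q t" by (simp add: q_def hB)
    also have "\<dots> = \<kappa> * q t" unfolding bL using K by (simp add: \<theta>_def \<kappa>_def)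
    finally have "(\<Sum>a<L-1. - b * (moment \<phi> a * moment \<phi> (L - 2 - a))) \<ge> - \<kappa> * q t"
      by (simp add: sum_distrib_left sum_negf)
    then show ?thesis using d by blast
  qed
  \<comment> \<open>Gronwall argument: multiplied by exp (\<kappa> t), \<open>q\<close> does not
    decrease.\<close>
  have q_ge: "q 0 * exp (- \<kappa> * t) \<le> q t" if t: "0 \<le> t" "t \<le> 1" for t
  proof -
    have "q 0 * exp (\<kappa> * 0) \<le> q t * exp (\<kappa> * t)"
    proof (rule DERIV_nonneg_imp_nondecreasing[OF t(1)])
      fix x assume "0 \<le> x" "x \<le> t"
      then obtain d where d: "(q has_real_derivative d) (at x)" "d \<ge> - \<kappa> * q x"
        using q'[of x] t by auto
      have "((\<lambda>x. q x * exp (\<kappa> * x)) has_real_derivative (d + \<kappa> * q x) * exp (\<kappa> * x)) (at x)"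
        by (auto intro!: derivative_eq_intros d simp: algebra_simps)
      moreover have "(d + \<kappa> * q x) * exp (\<kappa> * x) \<ge> 0" using d(2) by simp
      ultimately show "\<exists>y. ((\<lambda>x. q x * exp (\<kappa> * x)) has_real_derivative y) (at x) \<and> 0 \<le> y" by blast
    qed
    then show ?thesis by (simp add: exp_minus field_simps)
  qed
  \<comment> \<open>Integrated form of p' = - \<theta> q \<le> - \<theta> q(0) exp (- \<kappa> t):
    the sum of \<open>p\<close> and the explicit primitive of the bound is nonincreasing.\<close>
  have "p 1 - \<theta> * q 0 * exp (- \<kappa> * 1) / \<kappa> \<le> p 0 - \<theta> * q 0 * exp (- \<kappa> * 0) / \<kappa>"
  proof (rule DERIV_nonpos_imp_nonincreasing[of 0 1])
    fix x :: real assume x: "0 \<le> x" "x \<le> 1"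
    have "((\<lambda>x. p x - \<theta> * q 0 * exp (- \<kappa> * x) / \<kappa>) has_real_derivative
      - \<theta> * q x + \<theta> * q 0 * exp (- \<kappa> * x)) (at x)"
      using \<kappa> by (auto intro!: derivative_eq_intros p'[OF x])
    moreover have "- \<theta> * q x + \<theta> * q 0 * exp (- \<kappa> * x) \<le> 0"
      using q_ge[OF x] \<theta> by (simp add: mult.assoc)
    ultimately show "\<exists>y. ((\<lambda>x. p x - \<theta> * q 0 * exp (- \<kappa> * x) / \<kappa>) has_real_derivative y) (at x) \<and> y \<le> 0"
      by blast
  qed simp
  then have p1: "p 1 \<le> p 0 - (\<theta> / \<kappa>) * (1 - exp (- \<kappa>)) * q 0"
    by (simp add: field_simps diff_divide_distrib)
  interpret P: posdef_mat I M \<gamma>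
    using loc[of 0] by (simp add: downdate_def)
  \<comment> \<open>Raising the exponent from L - 1 to L is free because \<open>A\<close> is at most
    the identity. The loss is then expressed by the very power whose trace is being tracked, so that
    the estimate can be iterated.\<close>
  have "P.moment \<phi> L \<le> P.moment \<phi> (L - 1)" using P.moment_Suc_le[of \<phi> "L - 1"] L by simp
  also have "\<dots> = q 0" by (simp add: q_def P.moment_def B_def downdate_def)
  finally have q0: "P.moment \<phi> L \<le> q 0" .
  have "ln 2 \<le> \<kappa>" using \<gamma> by (simp add: \<kappa>_def pos_le_divide_eq mult_left_le)
  then have "exp (- \<kappa>) \<le> exp (- ln (2::real))" by simp
  also have "\<dots> = 1 / 2" by (simp add: exp_minus)
  finally have "1 / 2 \<le> 1 - exp (- \<kappa>)" by simp
  moreover have "\<theta> / \<kappa> = \<gamma> / K" using \<gamma> K by (simp add: \<theta>_def \<kappa>_def)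
  ultimately have c: "\<gamma> / K * (1 / 2) \<le> (\<theta> / \<kappa>) * (1 - exp (- \<kappa>))"
    using \<gamma> K by (intro mult_mono) auto
  have "\<gamma> / K * (1 / 2) * P.moment \<phi> L \<le> (\<theta> / \<kappa>) * (1 - exp (- \<kappa>)) * q 0"
  proof (rule mult_mono)
    have "0 \<le> \<gamma> / K * (1 / 2)" using \<gamma> K by simp
    also note c
    finally show "0 \<le> (\<theta> / \<kappa>) * (1 - exp (- \<kappa>))" .
  qed (rule q0 c P.moment_nonneg)+
  with p1 show ?thesis by (simp add: p_def b_def P.moment_def downdate_def)
qed

section \<open>The matrix Chernoff bound\<close>

text \<open>Setting of the Chernoff bound: the random matrices \<phi>(z)\<phi>(z)^T have the
  identity as their mean and norm at most \<open>K\<close>.\<close>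

locale orthonormal_sample = prob_space R for R :: "'y measure" +
  fixes I :: "'i set" and \<phi> :: "'i \<Rightarrow> 'y \<Rightarrow> real" and K :: real
  assumes finite_I: "finite I"
    and meas_\<phi> [measurable]: "\<And>i. i \<in> I \<Longrightarrow> \<phi> i \<in> borel_measurable R"
    and K_ge_1: "K \<ge> 1"
    and bound: "\<And>z. z \<in> space R \<Longrightarrow> (\<Sum>i\<in>I. (\<phi> i z)\<^sup>2) \<le> K"
    and orthonormal: "\<And>i k. i \<in> I \<Longrightarrow> k \<in> I \<Longrightarrow> (LINT z|R. \<phi> i z * \<phi> k z) = (if i = k then 1 else 0)"
begin

abbreviation "\<Phi> z \<equiv> (\<lambda>i. \<phi> i z)"

text \<open>The matrix whose L-th power replaces the exponential of - cL times the sum of the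
  sampled rank-one matrices. The index set \<open>J\<close> is free so that samples can be added one
  by one.\<close>

definition resid :: "real \<Rightarrow> nat set \<Rightarrow> (nat \<Rightarrow> 'y) \<Rightarrow> 'i \<Rightarrow> 'i \<Rightarrow> real" where
  "resid c J y = (\<lambda>i k. (if i = k then 1 else 0) - c * (\<Sum>j\<in>J. \<phi> i (y j) * \<phi> k (y j)))"

lemma resid_cong: "(\<And>j. j \<in> J \<Longrightarrow> y j = y' j) \<Longrightarrow> resid c J y = resid c J y'"
  by (simp add: resid_def)

lemma resid_insert:
  assumes "finite J" "j \<notin> J"
  shows "resid c (insert j J) (y(j := z)) = downdate (resid c J y) c (\<Phi> z)"
proof -
  have "(\<Sum>x\<in>J. \<phi> i ((y(j := z)) x) * \<phi> k ((y(j := z)) x)) = (\<Sum>x\<in>J. \<phi> i (y x) * \<phi> k (y x))" for i k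
    using assms by (intro sum.cong) auto
  then show ?thesis using assms by (auto simp: resid_def downdate_def algebra_simps)
qed

lemma sym_mat_resid: "sym_mat I (resid c J y)"
  by unfold_locales (auto simp: finite_I resid_def mult.commute)

lemma form_resid:
  "dot I v (mat_vec I (resid c J y) v) = dot I v v - c * (\<Sum>j\<in>J. (dot I v (\<Phi> (y j)))\<^sup>2)"
proof -
  have "mat_vec I (resid c J y) v i = v i - c * (\<Sum>j\<in>J. \<phi> i (y j) * dot I v (\<Phi> (y j)))" if "i \<in> I" for i
  proof -
    have "mat_vec I (resid c J y) v i = (\<Sum>k\<in>I. (if i = k then v k else 0)) - c * (\<Sum>k\<in>I. \<Sum>j\<in>J. \<phi> i (y j) * (v k * \<phi> k (y j)))"
      unfolding mat_vec_def resid_def left_diff_distrib sum_subtractf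
      by (simp add: sum_distrib_left sum_distrib_right mult_ac if_distrib[of "\<lambda>x. _ * x"] cong: if_cong)
    also have "(\<Sum>k\<in>I. (if i = k then v k else 0)) = v i" using that finite_I by simp
    also have "(\<Sum>k\<in>I. \<Sum>j\<in>J. \<phi> i (y j) * (v k * \<phi> k (y j))) = (\<Sum>j\<in>J. \<phi> i (y j) * dot I v (\<Phi> (y j)))"
      by (subst sum.swap) (simp add: dot_def sum_distrib_left)
    finally show ?thesis .
  qed
  then have "dot I v (mat_vec I (resid c J y) v) =
      dot I v (\<lambda>i. v i - c * (\<Sum>j\<in>J. \<phi> i (y j) * dot I v (\<Phi> (y j))))"
    by (intro dot_cong) auto
  also have "\<dots> = dot I v v - c * dot I v (\<lambda>i. \<Sum>j\<in>J. \<phi> i (y j) * dot I v (\<Phi> (y j)))"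
    by (rule dot_diff_right)
  also have "dot I v (\<lambda>i. \<Sum>j\<in>J. \<phi> i (y j) * dot I v (\<Phi> (y j)))
      = (\<Sum>j\<in>J. dot I v (\<Phi> (y j)) * dot I v (\<Phi> (y j)))"
    unfolding dot_def[of I v "\<lambda>i. \<Sum>j\<in>J. \<phi> i (y j) * dot I v (\<Phi> (y j))"] sum_distrib_left
    by (subst sum.swap) (simp add: dot_def[of I v "\<Phi> (y _)"] sum_distrib_left sum_distrib_right mult_ac)
  finally show ?thesis by (simp add: power2_eq_square)
qed

lemma dot_\<phi>_le: "z \<in> space R \<Longrightarrow> dot I (\<Phi> z) (\<Phi> z) \<le> K"
  using bound[of z] by (simp add: dot_def power2_eq_square)

lemma form_resid_lower:
  assumes "c \<ge> 0" "\<And>j. j \<in> J \<Longrightarrow> y j \<in> space R"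
  shows "dot I v (mat_vec I (resid c J y) v) \<ge> (1 - c * real (card J) * K) * dot I v v"
proof -
  have "(\<Sum>j\<in>J. (dot I v (\<Phi> (y j)))\<^sup>2) \<le> (\<Sum>j\<in>J. dot I v v * K)"
  proof (rule sum_mono)
    fix j assume "j \<in> J"
    have "(dot I v (\<Phi> (y j)))\<^sup>2 \<le> dot I v v * dot I (\<Phi> (y j)) (\<Phi> (y j))"
      by (rule Cauchy_Schwarz_dot)
    also have "\<dots> \<le> dot I v v * K" using dot_\<phi>_le assms(2) \<open>j \<in> J\<close> by (intro mult_left_mono) auto
    finally show "(dot I v (\<Phi> (y j)))\<^sup>2 \<le> dot I v v * K" .
  qed
  then have "c * (\<Sum>j\<in>J. (dot I v (\<Phi> (y j)))\<^sup>2) \<le> c * (\<Sum>j\<in>J. dot I v v * K)"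
    using assms by (intro mult_left_mono) auto
  then show ?thesis unfolding form_resid by (simp add: algebra_simps)
qed

lemma form_resid_upper: "c \<ge> 0 \<Longrightarrow> dot I v (mat_vec I (resid c J y) v) \<le> dot I v v"
  unfolding form_resid by (simp add: sum_nonneg)

lemma posdef_resid:
  assumes "c \<ge> 0" "\<And>j. j \<in> J \<Longrightarrow> y j \<in> space R" "0 < \<gamma>" "\<gamma> \<le> 1 - c * real (card J) * K"
  shows "posdef_mat I (resid c J y) \<gamma>"
proof (intro posdef_mat.intro posdef_mat_axioms.intro sym_mat_resid assms form_resid_upper)
  fix v
  have "\<gamma> * dot I v v \<le> (1 - c * real (card J) * K) * dot I v v"
    using assms by (intro mult_right_mono) auto
  also have "\<dots> \<le> dot I v (mat_vec I (resid c J y) v)" by (intro form_resid_lower assms)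
  finally show "\<gamma> * dot I v v \<le> dot I v (mat_vec I (resid c J y) v)" .
qed

lemma pow_resid_measurable:
  assumes "k \<in> I"
  shows "(\<lambda>y. (mat_vec I (resid c J y) ^^ L) v k) \<in> borel_measurable (PiM J (\<lambda>_. R))"
  using assms
proof (induction L arbitrary: k)
  case (Suc L)
  have [measurable]: "(\<lambda>y. \<phi> i (y j)) \<in> borel_measurable (PiM J (\<lambda>_. R))" if "i \<in> I" "j \<in> J" for i j
    using meas_\<phi>[OF that(1)] measurable_component_singleton[OF that(2), of "\<lambda>_. R"] by (rule measurable_compose[rotated])
  have "(\<lambda>y. resid c J y k l) \<in> borel_measurable (PiM J (\<lambda>_. R))" if "l \<in> I" for l
    unfolding resid_def using Suc that
    by (intro borel_measurable_sum borel_measurable_times borel_measurable_diff borel_measurable_const) auto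
  then have "(\<lambda>y. \<Sum>l\<in>I. resid c J y k l * (mat_vec I (resid c J y) ^^ L) v l) \<in> borel_measurable (PiM J (\<lambda>_. R))"
    using Suc by (intro borel_measurable_sum borel_measurable_times) auto
  then show ?case by (simp add: mat_vec_def[of _ _ "(_ ^^ _) _"])
qed auto

lemma trace_resid_measurable: "(\<lambda>y. trace_pow I (resid c J y) L) \<in> borel_measurable (PiM J (\<lambda>_. R))"
  unfolding trace_pow_def by (intro borel_measurable_sum pow_resid_measurable)

lemma trace_resid_le_card:
  assumes "c \<ge> 0" "\<And>j. j \<in> J \<Longrightarrow> y j \<in> space R" "c * real (card J) * K < 1"
  shows "trace_pow I (resid c J y) L \<le> real (card I)"
proof -
  interpret posdef_mat I "resid c J y" "1 - c * real (card J) * K"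
    using assms by (intro posdef_resid) auto
  have "(A ^^ L) (unit_vec i) i \<le> 1" if "i \<in> I" for i
  proof -
    have "moment (unit_vec i) L \<le> moment (unit_vec i) 0" by (rule lift_Suc_antimono_le[of "moment (unit_vec i)", OF moment_Suc_le]) simp
    then show ?thesis using dot_unit_vec[OF fin that] that by (simp add: moment_def dot_commute[of I "unit_vec i"]) (simp add: unit_vec_def)
  qed
  then have "trace_pow I (resid c J y) L \<le> (\<Sum>i\<in>I. 1)" unfolding trace_pow_def by (intro sum_mono) auto
  then show ?thesis by simp
qed

lemma trace_resid_empty: "trace_pow I (resid c {} y) L = real (card I)"
proof -
  have "(mat_vec I (resid c {} y) ^^ L) v k = v k" if "k \<in> I" for v k
    using that
  proof (induction L arbitrary: k)
    case (Suc L)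
    have "(mat_vec I (resid c {} y) ^^ Suc L) v k = (\<Sum>l\<in>I. resid c {} y k l * v l)"
      using Suc.IH by (auto simp: mat_vec_def[of _ _ "(_ ^^ _) _"] intro!: sum.cong)
    also have "\<dots> = (\<Sum>l\<in>I. if k = l then v l else 0)" by (auto simp: resid_def intro!: sum.cong)
    finally show ?case using Suc finite_I by simp
  qed simp
  then show ?thesis by (simp add: trace_pow_def unit_vec_def)
qed

lemma integrable_trace_resid:
  assumes "even L" "c \<ge> 0" "finite J" "c * real (card J) * K < 1"
  shows "integrable (PiM J (\<lambda>_. R)) (\<lambda>y. trace_pow I (resid c J y) L)"
proof -
  interpret P: prob_space "PiM J (\<lambda>_. R)" by (intro prob_space_PiM prob_space_axioms)
  show ?thesis
  proof (rule P.integrable_const_bound[where B = "real (card I)"])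
    show "AE y in PiM J (\<lambda>_. R). norm (trace_pow I (resid c J y) L) \<le> real (card I)"
    proof (rule AE_I2)
      fix y assume "y \<in> space (PiM J (\<lambda>_. R))"
      then have "trace_pow I (resid c J y) L \<le> real (card I)"
        using assms by (intro trace_resid_le_card) (auto simp: space_PiM)
      moreover have "trace_pow I (resid c J y) L \<ge> 0"
        using sym_mat.trace_pow_nonneg[OF sym_mat_resid] assms by blast
      ultimately show "norm (trace_pow I (resid c J y) L) \<le> real (card I)" by simp
    qed
  qed (rule trace_resid_measurable)
qed

lemma integrable_\<phi>_mult:
  assumes "i \<in> I" "k \<in> I" shows "integrable R (\<lambda>z. \<phi> i z * \<phi> k z)"
proof (rule integrable_const_bound[where B = K])
  have "\<bar>\<phi> i z * \<phi> k z\<bar> \<le> K" if "z \<in> space R" for z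
  proof -
    have "(\<phi> i z)\<^sup>2 \<le> K" "(\<phi> k z)\<^sup>2 \<le> K"
      using bound[OF that] member_le_sum[of i I "\<lambda>i. (\<phi> i z)\<^sup>2"] member_le_sum[of k I "\<lambda>i. (\<phi> i z)\<^sup>2"] assms finite_I
      by auto
    moreover have "2 * \<bar>\<phi> i z * \<phi> k z\<bar> \<le> (\<phi> i z)\<^sup>2 + (\<phi> k z)\<^sup>2"
      using sum_squares_bound[of "\<bar>\<phi> i z\<bar>" "\<bar>\<phi> k z\<bar>"] by (simp add: abs_mult)
    ultimately show ?thesis by simp
  qed
  then show "AE z in R. norm (\<phi> i z * \<phi> k z) \<le> K" by (intro AE_I2) auto
qed (use assms in measurable)

text \<open>Each new sample point contracts the expected trace by the factor 1 - \<gamma>/(2K): the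
  rank-one step subtracts \<gamma>/(2K) times <\<phi>, A^L \<phi>>, and the mean of this over the
  new point is the trace of A^L.\<close>

lemma integral_trace_resid_le:
  assumes L: "even L" "L \<ge> 2" and c: "c = ln 2 / (K * real L)"
    and g: "\<gamma> = 1 - c * real m * K" "0 < \<gamma>"
    and J: "finite J" "card J \<le> m"
  shows "(LINT y|PiM J (\<lambda>_. R). trace_pow I (resid c J y) L) \<le> real (card I) * (1 - \<gamma> / (2 * K)) ^ card J"
  using J
proof (induction J rule: finite_induct)
  case empty
  interpret P: prob_space "PiM {} (\<lambda>_. R)" by (intro prob_space_PiM prob_space_axioms)
  show ?case by (simp add: trace_resid_empty P.prob_space)
next
  case (insert j J)
  interpret product_sigma_finite "\<lambda>_. R" by unfold_locales
  interpret P: prob_space "PiM J (\<lambda>_. R)" by (intro prob_space_PiM prob_space_axioms)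
  have K: "K > 0" using K_ge_1 by simp
  have c0: "c \<ge> 0" using K by (simp add: c)
  have \<gamma>1: "\<gamma> \<le> 1" using c0 K g by simp
  \<comment> \<open>\<gamma> is defined with the full sample size \<open>m\<close>, so that one
    lower bound of the form serves every partial sample; this compares it with the present
    cardinality.\<close>
  have le: "c * real (card J) * K + c * K \<le> c * real m * K"
  proof -
    have "c * K * real (Suc (card J)) \<le> c * K * real m"
      using c0 K insert by (intro mult_left_mono) auto
    then show ?thesis by (simp add: algebra_simps)
  qed
  have lt: "c * real (card J) * K < 1" using le g c0 K mult_nonneg_nonneg[of c K] by linarith
  have lt': "c * real (card (insert j J)) * K < 1" using le g insert by (simp add: algebra_simps)
  let ?T = "\<lambda>y. trace_pow I (resid c J y) L"
  have step: "(LINT z|R. trace_pow I (resid c (insert j J) (y(j := z))) L) \<le> (1 - \<gamma> / (2 * K)) * ?T y"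
    if y: "y \<in> space (PiM J (\<lambda>_. R))" for y
  proof -
    have yR: "y i \<in> space R" if "i \<in> J" for i using y that by (auto simp: space_PiM)
    interpret posdef_mat I "resid c J y" \<gamma>
      using c0 yR g lt le K by (intro posdef_resid) (auto intro: order_trans[OF _ le] mult_nonneg_nonneg)
    \<comment> \<open>With the earlier points frozen, \<open>W\<close> is a constant matrix, the one
      of A^L, and integration over \<open>z\<close> affects only the products of two basis
      functions.\<close>
    define W where "W = (\<lambda>i k. (A ^^ L) (unit_vec i) k)"
    have upd: "trace_pow I (resid c (insert j J) (y(j := z))) L
        \<le> ?T y - \<gamma> / (2 * K) * (\<Sum>i\<in>I. \<Sum>k\<in>I. \<phi> i z * \<phi> k z * W i k)" if z: "z \<in> space R" for z
    proof -
      have "dot I (\<Phi> z) ((A ^^ L) (\<Phi> z)) = (\<Sum>i\<in>I. \<Sum>k\<in>I. \<phi> i z * \<phi> k z * W i k)"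
        unfolding dot_def[of I "\<Phi> z" "(A ^^ L) _"]
      proof (rule sum.cong[OF refl])
        fix i assume i: "i \<in> I"
        have "(A ^^ L) (\<Phi> z) i = dot I (\<Phi> z) (W i)"
          using dot_unit_vec[OF fin i, of "(A ^^ L) (\<Phi> z)"] unfolding W_def by (simp add: dot_pow_sym)
        then show "\<phi> i z * (A ^^ L) (\<Phi> z) i = (\<Sum>k\<in>I. \<phi> i z * \<phi> k z * W i k)"
          by (simp add: dot_def sum_distrib_left mult.assoc)
      qed
      moreover have "trace_pow I (downdate (resid c J y) c (\<Phi> z)) L
        \<le> trace_pow I (resid c J y) L - \<gamma> / (2 * K) * dot I (\<Phi> z) ((A ^^ L) (\<Phi> z))"
        unfolding c
      proof (rule trace_pow_downdate_le[OF fin _ g(2) \<gamma>1 K dot_\<phi>_le[OF z] L(2)], unfold c[symmetric])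
        fix v
        have "dot I v (mat_vec I (downdate (resid c J y) c (\<Phi> z)) v) \<ge> (1 - c * real (card (insert j J)) * K) * dot I v v"
          unfolding resid_insert[OF insert(1,2), symmetric] using c0 yR z insert(2)
          by (intro form_resid_lower) auto
        moreover have "(1 - c * real (card (insert j J)) * K) * dot I v v \<ge> \<gamma> * dot I v v"
          using le g insert by (intro mult_right_mono) (auto simp: algebra_simps)
        ultimately show "\<gamma> * dot I v v \<le> dot I v (A v) - c * (dot I (\<Phi> z) v)\<^sup>2"
          unfolding dot_mat_vec_downdate by simp
      qed (auto simp: sym upper)
      ultimately show ?thesis unfolding resid_insert[OF insert(1,2)] by simp
    qed
    have int: "integrable R (\<lambda>z. ?T y - \<gamma> / (2 * K) * (\<Sum>i\<in>I. \<Sum>k\<in>I. \<phi> i z * \<phi> k z * W i k))"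
      by (intro Bochner_Integration.integrable_diff integrable_mult_right Bochner_Integration.integrable_sum
          integrable_mult_left integrable_\<phi>_mult) auto
    have "(LINT z|R. trace_pow I (resid c (insert j J) (y(j := z))) L)
        \<le> (LINT z|R. ?T y - \<gamma> / (2 * K) * (\<Sum>i\<in>I. \<Sum>k\<in>I. \<phi> i z * \<phi> k z * W i k))"
      using int
    proof (rule integral_mono')
      fix z assume z: "z \<in> space R"
      show "trace_pow I (resid c (insert j J) (y(j := z))) L
        \<le> ?T y - \<gamma> / (2 * K) * (\<Sum>i\<in>I. \<Sum>k\<in>I. \<phi> i z * \<phi> k z * W i k)" using upd[OF z] .
      then show "0 \<le> ?T y - \<gamma> / (2 * K) * (\<Sum>i\<in>I. \<Sum>k\<in>I. \<phi> i z * \<phi> k z * W i k)"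
        using sym_mat.trace_pow_nonneg[OF sym_mat_resid L(1)] by (meson order_trans)
    qed
    also have "\<dots> = ?T y - \<gamma> / (2 * K) * (\<Sum>i\<in>I. \<Sum>k\<in>I. (LINT z|R. \<phi> i z * \<phi> k z) * W i k)"
      using integrable_\<phi>_mult
      by (subst Bochner_Integration.integral_diff) (auto simp: prob_space)
    \<comment> \<open>Orthonormality enters here: the averaged rank-one matrix is the identity, so
      only the diagonal of \<open>W\<close> survives.\<close>
    also have "(\<Sum>i\<in>I. \<Sum>k\<in>I. (LINT z|R. \<phi> i z * \<phi> k z) * W i k) = (\<Sum>i\<in>I. \<Sum>k\<in>I. if i = k then W i k else 0)"
      by (intro sum.cong refl) (simp add: orthonormal)
    also have "\<dots> = ?T y" using finite_I by (simp add: W_def trace_pow_def)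
    also have "?T y - \<gamma> / (2 * K) * ?T y = (1 - \<gamma> / (2 * K)) * ?T y" by (simp add: left_diff_distrib)
    finally show ?thesis .
  qed
  have a: "1 - \<gamma> / (2 * K) \<ge> 0" using K_ge_1 \<gamma>1 by (simp add: field_simps)
  have "(LINT y|PiM (insert j J) (\<lambda>_. R). trace_pow I (resid c (insert j J) y) L)
      = (LINT y|PiM J (\<lambda>_. R). LINT z|R. trace_pow I (resid c (insert j J) (y(j := z))) L)"
    using insert lt' c0 L by (intro product_integral_insert integrable_trace_resid) auto
  also have "\<dots> \<le> (LINT y|PiM J (\<lambda>_. R). (1 - \<gamma> / (2 * K)) * ?T y)"
  proof (rule integral_mono')
    show "integrable (PiM J (\<lambda>_. R)) (\<lambda>y. (1 - \<gamma> / (2 * K)) * ?T y)"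
      using integrable_trace_resid[OF L(1) c0 insert(1) lt] by simp
  qed (use step a sym_mat.trace_pow_nonneg[OF sym_mat_resid L(1)] in auto)
  also have "\<dots> = (1 - \<gamma> / (2 * K)) * (LINT y|PiM J (\<lambda>_. R). ?T y)" by simp
  also have "\<dots> \<le> (1 - \<gamma> / (2 * K)) * (real (card I) * (1 - \<gamma> / (2 * K)) ^ card J)"
    using insert a by (intro mult_left_mono) auto
  finally show ?case using insert by (simp add: mult_ac)
qed

end

text \<open>The factor 2 absorbs the error made by replacing exponentials with finite powers.\<close>

lemma exists_good_exponent:
  fixes K :: real and m :: nat
  assumes "K \<ge> 1"
  shows "\<exists>L. even L \<and> L \<ge> 2 \<and> real m * ln 2 < real L \<and>
     (1 - (1 - real m * ln 2 / real L) / (2 * K)) ^ m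
       \<le> 2 * exp (- ((1 - ln 2) / 2 * real m / K)) * (1 - real m * ln 2 / (2 * K) / real L) ^ L"
proof -
  define x where "x = real m * ln 2 / (2 * K)"
  define e where "e = exp (- ((1 - ln 2) / 2 * real m / K))"
  have g: "(\<lambda>L. (1 + (- x) / real L) ^ L) \<longlonglongrightarrow> exp (- x)" by (rule tendsto_exp_limit_sequentially)
  define F where "F = (\<lambda>L :: nat. exp (- (real m / (2 * K)) * (1 - real m * ln 2 * inverse (real L))))"
  have "F \<longlonglongrightarrow> exp (- (real m / (2 * K)) * (1 - real m * ln 2 * 0))"
    unfolding F_def by (intro tendsto_intros lim_inverse_n)
  then have f: "F \<longlonglongrightarrow> exp (- (real m / (2 * K)))" by simp
  have "(\<lambda>L. 2 * e * (1 + (- x) / real L) ^ L - F L)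
     \<longlonglongrightarrow> 2 * e * exp (- x) - exp (- (real m / (2 * K)))"
    by (intro tendsto_diff tendsto_mult tendsto_const g f)
  \<comment> \<open>The exponents (1 - ln 2)/2 and (ln 2)/2 add up to 1/2. In the limit the right
    side is therefore twice the bound \<open>F\<close> of the left side, and the strict gap persists
    for large L.\<close>
  also have "e * exp (- x) = exp (- (real m / (2 * K)))"
    unfolding e_def x_def exp_add[symmetric] using assms by (simp add: field_simps)
  then have "2 * e * exp (- x) - exp (- (real m / (2 * K))) = exp (- (real m / (2 * K)))"
    by simp
  finally have "eventually (\<lambda>L. 0 < 2 * e * (1 + (- x) / real L) ^ L - F L) sequentially"
    by (rule order_tendstoD(1)) simp
  moreover have "eventually (\<lambda>L. real m * ln 2 < real L) sequentially"
    using filterlim_real_sequentially unfolding filterlim_at_top_dense by blast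
  ultimately have "eventually (\<lambda>L. real m * ln 2 < real L \<and> L \<ge> 2 \<and>
      0 < 2 * e * (1 + (- x) / real L) ^ L - F L) sequentially"
    using eventually_ge_at_top[of 2] by eventually_elim auto
  then obtain L0 where L0: "\<And>L. L \<ge> L0 \<Longrightarrow> real m * ln 2 < real L \<and> L \<ge> 2 \<and>
      0 < 2 * e * (1 + (- x) / real L) ^ L - F L"
    unfolding eventually_sequentially by blast
  \<comment> \<open>Doubling makes the exponent even and keeps it beyond the threshold.\<close>
  define L where "L = 2 * L0"
  have L: "real m * ln 2 < real L" "L \<ge> 2"
    "F L \<le> 2 * e * (1 + (- x) / real L) ^ L"
    using L0[of L] by (auto simp: L_def)
  define \<gamma> where "\<gamma> = 1 - real m * ln 2 / real L"
  have \<gamma>: "\<gamma> \<le> 1" using L by (simp add: \<gamma>_def)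
  have "0 \<le> 1 - \<gamma> / (2 * K)" using \<gamma> assms by (simp add: field_simps)
  then have "(1 - \<gamma> / (2 * K)) ^ m \<le> exp (- \<gamma> / (2 * K)) ^ m"
    using exp_ge_add_one_self[of "- \<gamma> / (2 * K)"] by (intro power_mono) auto
  also have "\<dots> = exp (- (real m / (2 * K)) * \<gamma>)" by (simp add: exp_of_nat_mult[symmetric])
  also have "\<dots> \<le> 2 * e * (1 + (- x) / real L) ^ L" using L by (simp add: \<gamma>_def F_def field_simps)
  finally show ?thesis using L by (intro exI[of _ L]) (simp add: \<gamma>_def e_def x_def L_def)
qed

context orthonormal_sample begin

text \<open>A unit vector whose empirical squared norm is below 1/2 has <v, A v> at least 1 - c m/2,
  hence forces the trace of A^L up to (1 - c m/2)^L. Markov's inequality bounds the probability of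
  such a large trace.\<close>

lemma empirical_norm_lower_bound:
  fixes P :: "'w measure" and Y :: "nat \<Rightarrow> 'w \<Rightarrow> 'y"
  assumes P: "prob_space P" and m: "m \<ge> 1"
    and indep: "prob_space.indep_vars P (\<lambda>_. R) Y {1..m}"
    and dist: "\<forall>j\<in>{1..m}. distr P R (Y j) = R"
  shows "\<exists>B\<in>sets P. measure P B \<le> 2 * real (card I) * exp (- ((1 - ln 2) / 2 * real m / K)) \<and>
    (\<forall>\<omega>\<in>space P - B. \<forall>v. (\<Sum>i\<in>I. (v i)\<^sup>2) \<le> 2 * (1 / real m * (\<Sum>j=1..m. (\<Sum>i\<in>I. v i * \<phi> i (Y j \<omega>))\<^sup>2)))"
proof -
  interpret P: prob_space P by fact
  obtain L where L: "even L" "L \<ge> 2" and mL: "real m * ln 2 < real L"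
    and ex: "(1 - (1 - real m * ln 2 / real L) / (2 * K)) ^ m
       \<le> 2 * exp (- ((1 - ln 2) / 2 * real m / K)) * (1 - real m * ln 2 / (2 * K) / real L) ^ L"
    using exists_good_exponent[OF K_ge_1] by blast
  define c where "c = ln 2 / (K * real L)"
  define \<gamma> where "\<gamma> = 1 - c * real m * K"
  define t where "t = (1 - real m * ln 2 / (2 * K) / real L) ^ L"
  have K: "K > 0" using K_ge_1 by simp
  have L0: "real L > 0" using L by simp
  have c0: "c > 0" using K L0 by (simp add: c_def)
  have \<gamma>e: "\<gamma> = 1 - real m * ln 2 / real L" using K by (simp add: \<gamma>_def c_def field_simps)
  have \<gamma>0: "\<gamma> > 0" using mL L0 by (simp add: \<gamma>e)
  have "real m * ln 2 / (2 * K) \<le> real m * ln 2 / 1" using K_ge_1 by (intro divide_left_mono) auto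
  then have "real m * ln 2 / (2 * K) < real L" using mL by linarith
  then have "real m * ln 2 / (2 * K) / real L < 1" by (rule divide_less_eq_1_pos[OF L0, THEN iffD2])
  then have b0: "1 - real m * ln 2 / (2 * K) / real L > 0" by linarith
  have t0: "t > 0" using b0 by (simp add: t_def)
  have meas[measurable]: "Y j \<in> measurable P R" if "j \<in> {1..m}" for j
    using indep that unfolding P.indep_vars_def by auto
  have YR: "Y j \<omega> \<in> space R" if "j \<in> {1..m}" "\<omega> \<in> space P" for j \<omega>
    using meas[OF that(1)] that(2) by (rule measurable_space)
  let ?X = "\<lambda>\<omega>. \<lambda>j\<in>{1..m}. Y j \<omega>"
  let ?T = "\<lambda>y. trace_pow I (resid c {1..m} y) L"
  have X: "?X \<in> measurable P (PiM {1..m} (\<lambda>_. R))" by (intro measurable_restrict meas)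
  have TX: "?T (?X \<omega>) = ?T (\<lambda>j. Y j \<omega>)" for \<omega>
    by (rule arg_cong[where f = "\<lambda>M. trace_pow I M L"], rule resid_cong) simp
  have "distr P (PiM {1..m} (\<lambda>_. R)) ?X = PiM {1..m} (\<lambda>j. distr P R (Y j))"
    using indep m by (subst P.indep_vars_iff_distr_eq_PiM'[symmetric]) auto
  also have "\<dots> = PiM {1..m} (\<lambda>_. R)" using dist by (intro PiM_cong) auto
  finally have D: "distr P (PiM {1..m} (\<lambda>_. R)) ?X = PiM {1..m} (\<lambda>_. R)" .
  have E: "P.expectation (\<lambda>\<omega>. ?T (\<lambda>j. Y j \<omega>)) = (LINT y|PiM {1..m} (\<lambda>_. R). ?T y)"
    using integral_distr[OF X trace_resid_measurable, of c L] unfolding D TX by simp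
  have "integrable (distr P (PiM {1..m} (\<lambda>_. R)) ?X) ?T"
    unfolding D using L c0 \<gamma>0 by (intro integrable_trace_resid) (auto simp: \<gamma>_def)
  then have int: "integrable P (\<lambda>\<omega>. ?T (\<lambda>j. Y j \<omega>))"
    using integrable_distr_eq[OF X trace_resid_measurable, of c L] unfolding TX by simp
  have nn: "?T y \<ge> 0" for y using sym_mat.trace_pow_nonneg[OF sym_mat_resid L(1)] .
  \<comment> \<open>The exceptional event is defined by the trace, a measurable function, and not by
    the failure of the norm inequality for some \<open>v\<close>, which quantifies over uncountably
    many vectors.\<close>
  define B where "B = {\<omega>\<in>space P. t \<le> ?T (\<lambda>j. Y j \<omega>)}"
  have [measurable]: "(\<lambda>\<omega>. ?T (\<lambda>j. Y j \<omega>)) \<in> borel_measurable P" using int by auto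
  have "B \<in> sets P" unfolding B_def by measurable
  moreover have "measure P B \<le> 2 * real (card I) * exp (- ((1 - ln 2) / 2 * real m / K))"
  proof -
    have "measure P B \<le> P.expectation (\<lambda>\<omega>. ?T (\<lambda>j. Y j \<omega>)) / t"
      unfolding B_def using integral_Markov_inequality_measure[OF int, of "{}" t] nn t0 by simp
    also have "\<dots> \<le> (real (card I) * (1 - \<gamma> / (2 * K)) ^ m) / t"
      unfolding E using integral_trace_resid_le[OF L c_def \<gamma>_def \<gamma>0, of "{1..m}"] t0
      by (intro divide_right_mono) auto
    also have "\<dots> \<le> (real (card I) * (2 * exp (- ((1 - ln 2) / 2 * real m / K)) * t)) / t"
      using ex t0 unfolding \<gamma>e t_def by (intro divide_right_mono mult_left_mono) auto
    also have "\<dots> = 2 * real (card I) * exp (- ((1 - ln 2) / 2 * real m / K))" using t0 by simp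
    finally show ?thesis .
  qed
  moreover have "(\<Sum>i\<in>I. (v i)\<^sup>2) \<le> 2 * (1 / real m * (\<Sum>j=1..m. (\<Sum>i\<in>I. v i * \<phi> i (Y j \<omega>))\<^sup>2))"
    if \<omega>: "\<omega> \<in> space P - B" for \<omega> v
  proof (rule ccontr)
    assume "\<not> ?thesis"
    then have lt: "2 * (1 / real m * (\<Sum>j=1..m. (dot I v (\<Phi> (Y j \<omega>)))\<^sup>2)) < dot I v v"
      by (simp add: dot_def power2_eq_square)
    moreover have "0 \<le> 2 * (1 / real m * (\<Sum>j=1..m. (dot I v (\<Phi> (Y j \<omega>)))\<^sup>2))"
      by (simp add: sum_nonneg)
    ultimately have vv: "dot I v v > 0" by linarith
    \<comment> \<open>Normalises \<open>v\<close>, since the trace is compared with the form at unit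
      vectors.\<close>
    define r where "r = 1 / sqrt (dot I v v)"
    define w where "w = (\<lambda>i. r * v i)"
    have ipw: "dot I w x = r * dot I v x" for x by (simp add: w_def dot_def sum_distrib_left mult.assoc)
    have r2: "r * r * dot I v v = 1" using vv by (simp add: r_def)
    have w1: "dot I w w = 1" using ipw[of v] r2 by (simp add: ipw dot_commute[of I v w])
    have r0: "r\<^sup>2 > 0" using vv by (simp add: r_def)
    have "(\<Sum>j=1..m. (dot I w (\<Phi> (Y j \<omega>)))\<^sup>2) = r\<^sup>2 * (\<Sum>j=1..m. (dot I v (\<Phi> (Y j \<omega>)))\<^sup>2)"
      by (simp add: ipw power_mult_distrib sum_distrib_left)
    also have "\<dots> \<le> r\<^sup>2 * (real m / 2 * dot I v v)"
      using lt r0 m by (intro mult_left_mono) (auto simp: field_simps)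
    also have "\<dots> = real m / 2" using r2 by (simp add: power2_eq_square)
    finally have "c * (\<Sum>j=1..m. (dot I w (\<Phi> (Y j \<omega>)))\<^sup>2) \<le> c * (real m / 2)"
      using c0 by (intro mult_left_mono) auto
    interpret posdef_mat I "resid c {1..m} (\<lambda>j. Y j \<omega>)" \<gamma>
      using c0 \<gamma>0 YR \<omega> by (intro posdef_resid) (auto simp: \<gamma>_def)
    have "1 - real m * ln 2 / (2 * K) / real L = 1 - c * (real m / 2)" by (simp add: c_def mult_ac)
    also have "\<dots> \<le> moment w 1"
      using \<open>c * _ \<le> c * (real m / 2)\<close> unfolding moment_def by (simp add: form_resid w1)
    finally have "t \<le> moment w 1 ^ L" unfolding t_def using b0 by (intro power_mono) auto
    also have "\<dots> \<le> moment w L" by (rule moment_ge_power[OF w1])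
    also have "\<dots> \<le> ?T (\<lambda>j. Y j \<omega>)" unfolding moment_def by (rule trace_ge_form[OF L(1) w1])
    finally show False using \<omega> by (simp add: B_def)
  qed
  ultimately show ?thesis by blast
qed

end

section \<open>Downward closed sets\<close>

text \<open>Convexity of the s-th power: its increments over a fixed length grow.\<close>

lemma powr_increment_mono:
  fixes s :: real
  assumes s: "s \<ge> 1" and "0 < x" "x \<le> y" "0 \<le> a"
  shows "(x + a) powr s - x powr s \<le> (y + a) powr s - y powr s"
proof (rule DERIV_nonneg_imp_nondecreasing[OF \<open>x \<le> y\<close>])
  fix t assume t: "x \<le> t" "t \<le> y"
  then have "t > 0" using assms by simp
  then have "((\<lambda>t. (t + a) powr s - t powr s) has_real_derivative (s * (t + a) powr (s - 1) - s * t powr (s - 1))) (at t)"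
    using assms by (auto intro!: derivative_eq_intros)
  moreover have "s * t powr (s - 1) \<le> s * (t + a) powr (s - 1)"
    using assms \<open>t > 0\<close> by (intro mult_left_mono powr_mono2) auto
  ultimately show "\<exists>d. ((\<lambda>t. (t + a) powr s - t powr s) has_real_derivative d) (at t) \<and> 0 \<le> d" by force
qed

text \<open>For a decreasing sequence the partial sum S before \<open>a n\<close> is at least n a_n.
  By convexity, adding a_n to S increases the s-th power at least as much as adding it to n a_n, and
  the latter increment is the summand on the left.\<close>

lemma sum_increments_le_powr:
  fixes a :: "nat \<Rightarrow> real"
  assumes s: "s \<ge> 1" and nonneg: "\<And>k. a k \<ge> 0" and dec: "decseq a"
  shows "(\<Sum>k<n. (real (Suc k) powr s - real k powr s) * a k powr s) \<le> (\<Sum>k<n. a k) powr s"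
proof (induction n)
  case (Suc n)
  define S where "S = (\<Sum>k<n. a k)"
  have "real n * a n = (\<Sum>k<n. a n)" by simp
  also have "\<dots> \<le> S" unfolding S_def using dec by (intro sum_mono) (auto simp: decseq_def)
  finally have S: "real n * a n \<le> S" .
  have "(real (Suc n) powr s - real n powr s) * a n powr s \<le> (S + a n) powr s - S powr s"
  proof (cases "n = 0 \<or> a n = 0")
    case True then show ?thesis by (auto simp: S_def)
  next
    case False
    then have p: "a n > 0" "n > 0" using nonneg[of n] by auto
    have "(real n * a n + a n) powr s - (real n * a n) powr s \<le> (S + a n) powr s - S powr s"
      using p S s by (intro powr_increment_mono) auto
    also have "real n * a n + a n = real (Suc n) * a n" by (simp add: algebra_simps)
    finally have "(real (Suc n) * a n) powr s - (real n * a n) powr s \<le> (S + a n) powr s - S powr s" .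
    moreover have "(real (Suc n) * a n) powr s = real (Suc n) powr s * a n powr s"
      "(real n * a n) powr s = real n powr s * a n powr s"
      using p by (simp_all add: powr_mult del: of_nat_Suc)
    ultimately show ?thesis by (simp add: left_diff_distrib del: of_nat_Suc)
  qed
  then show ?case using Suc by (simp add: S_def)
qed simp

text \<open>Abel summation: with nonnegative decreasing weights it suffices to compare partial sums,
  not single terms.\<close>

lemma weighted_sum_mono_partial_sums:
  fixes b c d :: "nat \<Rightarrow> real"
  assumes part: "\<And>n. (\<Sum>k<n. c k) \<le> (\<Sum>k<n. d k)" and nonneg: "\<And>k. b k \<ge> 0" and dec: "decseq b"
  shows "(\<Sum>k<n. c k * b k) \<le> (\<Sum>k<n. d k * b k)"
proof -
  define e where "e = (\<lambda>k. d k - c k)"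
  have E: "(\<Sum>k<n. e k) \<ge> 0" for n using part[of n] by (simp add: e_def sum_subtractf)
  \<comment> \<open>The invariant keeps the last weight times the full partial sum; passing to the
    next, smaller weight can only lower it, as the partial sums are nonnegative.\<close>
  have *: "b n * (\<Sum>k<Suc n. e k) \<le> (\<Sum>k<Suc n. e k * b k)" for n
  proof (induction n)
    case (Suc n)
    have "b (Suc n) * (\<Sum>k<Suc n. e k) \<le> b n * (\<Sum>k<Suc n. e k)"
      using dec E by (intro mult_right_mono) (auto simp: decseq_Suc_iff simp del: sum.lessThan_Suc)
    then show ?case using Suc by (simp add: algebra_simps)
  qed simp
  have "0 \<le> (\<Sum>k<n. e k * b k)"
  proof (cases n)
    case (Suc m)
    have "0 \<le> b m * (\<Sum>k<Suc m. e k)" using nonneg E by (intro mult_nonneg_nonneg)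
    also note *[of m]
    finally show ?thesis using Suc by simp
  qed simp
  then show ?thesis by (simp add: e_def left_diff_distrib sum_subtractf)
qed

text \<open>The j-th entry is reset to 0, so that slices at different heights live in the same set
  of indices and can be nested.\<close>

definition slice :: "nat \<Rightarrow> (nat \<Rightarrow> nat) set \<Rightarrow> nat \<Rightarrow> (nat \<Rightarrow> nat) set" where
  "slice j \<Lambda> k = {\<mu>. \<mu> j = 0 \<and> \<mu>(j := k) \<in> \<Lambda>}"

lemma inj_on_slice: "inj_on (\<lambda>\<mu>. \<mu>(j := k)) (slice j \<Lambda> k)"
proof (rule inj_onI)
  fix x y assume "x \<in> slice j \<Lambda> k" "y \<in> slice j \<Lambda> k" and e: "x(j := k) = y(j := k)"
  then have "x j = y j" by (simp add: slice_def)
  show "x = y"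
  proof
    fix i show "x i = y i" using fun_cong[OF e, of i] \<open>x j = y j\<close> by (cases "i = j") auto
  qed
qed

lemma finite_slice: "finite \<Lambda> \<Longrightarrow> finite (slice j \<Lambda> k)"
  by (rule inj_on_finite[OF inj_on_slice]) (auto simp: slice_def)

lemma downward_closed_slice:
  assumes "downward_closed \<Lambda>" shows "downward_closed (slice j \<Lambda> k)"
  unfolding downward_closed_def
proof (intro ballI allI impI)
  fix \<nu> \<mu> assume \<nu>: "\<nu> \<in> slice j \<Lambda> k" and le: "\<mu> \<le> \<nu>"
  have "\<mu>(j := k) \<le> \<nu>(j := k)" using le by (simp add: le_fun_def)
  then have "\<mu>(j := k) \<in> \<Lambda>" using \<nu> assms by (auto simp: slice_def downward_closed_def)
  moreover have "\<mu> j = 0" using le \<nu> by (auto simp: slice_def le_fun_def dest: spec[of _ j])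
  ultimately show "\<mu> \<in> slice j \<Lambda> k" by (simp add: slice_def)
qed

lemma slice_antimono:
  assumes "downward_closed \<Lambda>" "k \<le> l" shows "slice j \<Lambda> l \<subseteq> slice j \<Lambda> k"
proof
  fix \<mu> assume \<mu>: "\<mu> \<in> slice j \<Lambda> l"
  have "\<mu>(j := k) \<le> \<mu>(j := l)" using assms by (simp add: le_fun_def)
  then show "\<mu> \<in> slice j \<Lambda> k" using \<mu> assms by (auto simp: slice_def downward_closed_def)
qed

lemma sum_slices:
  fixes f :: "(nat \<Rightarrow> nat) \<Rightarrow> 'b :: comm_monoid_add"
  assumes "finite \<Lambda>" "\<And>\<nu>. \<nu> \<in> \<Lambda> \<Longrightarrow> \<nu> j < n"
  shows "(\<Sum>\<nu>\<in>\<Lambda>. f \<nu>) = (\<Sum>k<n. \<Sum>\<mu>\<in>slice j \<Lambda> k. f (\<mu>(j := k)))"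
proof -
  have "(\<Sum>k<n. \<Sum>\<mu>\<in>slice j \<Lambda> k. f (\<mu>(j := k))) = (\<Sum>(k, \<mu>)\<in>Sigma {..<n} (slice j \<Lambda>). f (\<mu>(j := k)))"
    using assms by (subst sum.Sigma) (auto simp: finite_slice)
  also have "\<dots> = (\<Sum>\<nu>\<in>\<Lambda>. f \<nu>)"
    by (rule sum.reindex_bij_witness[of _ "\<lambda>\<nu>. (\<nu> j, \<nu>(j := 0))" "\<lambda>(k, \<mu>). \<mu>(j := k)"])
       (use assms in \<open>auto simp: slice_def fun_upd_idem_iff\<close>)
  finally show ?thesis by simp
qed

text \<open>Induction over the coordinates. Slicing along \<open>j\<close> gives downward closed
  sets of decreasing size a_k, each bounded by a_k^s through the induction hypothesis; what remains
  is a univariate sum with decreasing weights a_k^s.\<close>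

lemma sum_prod_downward_closed_le:
  fixes c :: "nat \<Rightarrow> nat \<Rightarrow> real"
  assumes s: "s \<ge> 1" and "finite J"
    and nonneg: "\<And>j k. c j k \<ge> 0" and part: "\<And>j n. j \<in> J \<Longrightarrow> (\<Sum>k<n. c j k) \<le> real n powr s"
    and \<Lambda>: "finite \<Lambda>" "downward_closed \<Lambda>" "\<And>\<nu> j. \<nu> \<in> \<Lambda> \<Longrightarrow> j \<notin> J \<Longrightarrow> \<nu> j = 0"
  shows "(\<Sum>\<nu>\<in>\<Lambda>. \<Prod>j\<in>J. c j (\<nu> j)) \<le> real (card \<Lambda>) powr s"
  using assms(2) part \<Lambda>
proof (induction J arbitrary: \<Lambda> rule: finite_induct)
  case empty
  then have "\<Lambda> \<subseteq> {\<lambda>_. 0}" by auto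
  then have "\<Lambda> = {} \<or> \<Lambda> = {\<lambda>_. 0}" by blast
  then show ?case by auto
next
  case (insert j J)
  obtain n where n: "\<And>\<nu>. \<nu> \<in> \<Lambda> \<Longrightarrow> \<nu> j < n"
    using finite_nat_bounded[of "(\<lambda>\<nu>. \<nu> j) ` \<Lambda>"] insert.prems(2) by auto
  have split: "(\<Sum>\<nu>\<in>\<Lambda>. f \<nu>) = (\<Sum>k<n. \<Sum>\<mu>\<in>slice j \<Lambda> k. f (\<mu>(j := k)))" for f :: "(nat \<Rightarrow> nat) \<Rightarrow> real"
    by (rule sum_slices) (use insert.prems(2) n in auto)
  define a where "a = (\<lambda>k. real (card (slice j \<Lambda> k)))"
  have card: "real (card \<Lambda>) = (\<Sum>k<n. a k)"
    using split[of "\<lambda>_. 1"] by (simp add: a_def)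
  have dec: "decseq a" unfolding decseq_def a_def
    using insert.prems(2,3) by (intro allI impI of_nat_mono card_mono finite_slice slice_antimono)
  have "(\<Sum>\<nu>\<in>\<Lambda>. \<Prod>i\<in>insert j J. c i (\<nu> i)) = (\<Sum>k<n. \<Sum>\<mu>\<in>slice j \<Lambda> k. c j k * (\<Prod>i\<in>J. c i (\<mu> i)))"
    unfolding split
  proof (intro sum.cong refl)
    fix k and \<mu> :: "nat \<Rightarrow> nat"
    have "(\<Prod>i\<in>J. c i ((\<mu>(j := k)) i)) = (\<Prod>i\<in>J. c i (\<mu> i))"
      using insert by (intro prod.cong) auto
    then show "(\<Prod>i\<in>insert j J. c i ((\<mu>(j := k)) i)) = c j k * (\<Prod>i\<in>J. c i (\<mu> i))"
      using insert.hyps by simp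
  qed
  also have "\<dots> = (\<Sum>k<n. c j k * (\<Sum>\<mu>\<in>slice j \<Lambda> k. \<Prod>i\<in>J. c i (\<mu> i)))" by (simp add: sum_distrib_left)
  also have "\<dots> \<le> (\<Sum>k<n. c j k * a k powr s)"
  proof (intro sum_mono mult_left_mono nonneg)
    fix k
    show "(\<Sum>\<mu>\<in>slice j \<Lambda> k. \<Prod>i\<in>J. c i (\<mu> i)) \<le> a k powr s"
      unfolding a_def
    proof (rule insert.IH)
      fix \<mu> i assume "\<mu> \<in> slice j \<Lambda> k" "i \<notin> J"
      then have "\<mu>(j := k) \<in> \<Lambda>" "\<mu> j = 0" by (simp_all add: slice_def)
      then show "\<mu> i = 0" using insert.prems(4)[OF \<open>\<mu>(j := k) \<in> \<Lambda>\<close>, of i] \<open>i \<notin> J\<close> by (cases "i = j") auto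
    qed (use insert.prems finite_slice downward_closed_slice in auto)
  qed
  \<comment> \<open>The coefficients are replaced by the worst case with the admissible partial sums
    n^s, namely the increments of the s-th power.\<close>
  also have "\<dots> \<le> (\<Sum>k<n. (real (Suc k) powr s - real k powr s) * a k powr s)"
  proof (rule weighted_sum_mono_partial_sums)
    fix n
    have "(\<Sum>k<n. real (Suc k) powr s - real k powr s) = real n powr s"
      by (subst sum_lessThan_telescope) simp
    then show "(\<Sum>k<n. c j k) \<le> (\<Sum>k<n. real (Suc k) powr s - real k powr s)" using insert.prems(1)[of j n] by simp
  next
    show "decseq (\<lambda>k. a k powr s)" using dec s by (auto simp: decseq_def a_def intro!: powr_mono2)
  qed simp
  also have "\<dots> \<le> (\<Sum>k<n. a k) powr s" by (rule sum_increments_le_powr[OF s _ dec]) (simp add: a_def)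
  finally show ?case by (simp add: card)
qed

section \<open>Hyperbolic crosses as envelopes of downward closed sets\<close>

lemma downward_closed_Un: "downward_closed A \<Longrightarrow> downward_closed B \<Longrightarrow> downward_closed (A \<union> B)"
  by (auto simp: downward_closed_def)

lemma downward_closed_Int: "downward_closed A \<Longrightarrow> downward_closed B \<Longrightarrow> downward_closed (A \<inter> B)"
  by (auto simp: downward_closed_def)

lemma downward_closed_zero: "downward_closed \<Lambda> \<Longrightarrow> \<Lambda> \<noteq> {} \<Longrightarrow> (\<lambda>_. 0) \<in> \<Lambda>"
  by (auto simp: downward_closed_def le_fun_def)

lemma downward_closed_multi_indices: "downward_closed (multi_indices d)"
  unfolding downward_closed_def multi_indices_def
proof safe
  fix \<nu> \<mu> :: "nat \<Rightarrow> nat" assume "finite {j. \<nu> j \<noteq> 0}" "{j. \<nu> j \<noteq> 0} \<subseteq> coords d" and le: "\<mu> \<le> \<nu>"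
  have "{j. \<mu> j \<noteq> 0} \<subseteq> {j. \<nu> j \<noteq> 0}" using le by (auto simp: le_fun_def intro: less_le_trans)
  then show "finite {j. \<mu> j \<noteq> 0}" "\<And>j. 0 < \<mu> j \<Longrightarrow> j \<in> coords d"
    using \<open>finite {j. \<nu> j \<noteq> 0}\<close> \<open>{j. \<nu> j \<noteq> 0} \<subseteq> coords d\<close> by (auto intro: finite_subset)
qed

lemma coords_enat: "coords (enat k) = {..<k}"
  by (auto simp: coords_def)

lemma multi_indices_enat: "multi_indices (enat k) = {\<nu>. \<forall>j\<ge>k. \<nu> j = 0}"
proof -
  have "finite {j. \<nu> j \<noteq> 0}" if "{j. \<nu> j \<noteq> 0} \<subseteq> {..<k}" for \<nu> :: "nat \<Rightarrow> nat"
    using that by (rule finite_subset) simp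
  moreover have "{j. \<nu> j \<noteq> 0} \<subseteq> {..<k} \<longleftrightarrow> (\<forall>j\<ge>k. \<nu> j = 0)" for \<nu> :: "nat \<Rightarrow> nat"
    unfolding subset_eq mem_Collect_eq Ball_def lessThan_iff by (meson not_le)
  ultimately show ?thesis unfolding multi_indices_def coords_enat by blast
qed

lemma finite_hyperbolic_cross: "finite (hyperbolic_cross q n)"
proof -
  have "hyperbolic_cross q n \<subseteq> {\<mu>. \<forall>j. (j \<in> {..<q} \<longrightarrow> \<mu> j \<in> {..n}) \<and> (j \<notin> {..<q} \<longrightarrow> \<mu> j = 0)}"
  proof
    fix \<mu> assume \<mu>: "\<mu> \<in> hyperbolic_cross q n"
    have "\<mu> j \<le> n" if "j < q" for j
    proof -
      have "\<mu> j + 1 dvd (\<Prod>j<q. \<mu> j + 1)" using that by (intro dvd_prodI) auto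
      moreover have "(\<Prod>j<q. \<mu> j + 1) > 0" by (intro prod_pos) auto
      ultimately have "\<mu> j + 1 \<le> (\<Prod>j<q. \<mu> j + 1)" by (rule dvd_imp_le)
      then show ?thesis using \<mu> by (simp add: hyperbolic_cross_def)
    qed
    then show "\<mu> \<in> {\<mu>. \<forall>j. (j \<in> {..<q} \<longrightarrow> \<mu> j \<in> {..n}) \<and> (j \<notin> {..<q} \<longrightarrow> \<mu> j = 0)}"
      using \<mu> by (auto simp: hyperbolic_cross_def multi_indices_enat)
  qed
  moreover have "finite {\<mu>. \<forall>j. (j \<in> {..<q} \<longrightarrow> \<mu> j \<in> {..n}) \<and> (j \<notin> {..<q} \<longrightarrow> \<mu> j = 0)}"
    by (rule finite_set_of_finite_funs) auto
  ultimately show ?thesis by (rule finite_subset)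
qed

lemma downward_closed_hyperbolic_cross: "downward_closed (hyperbolic_cross q n)"
  unfolding downward_closed_def
proof (intro ballI allI impI)
  fix \<nu> \<mu> assume \<nu>: "\<nu> \<in> hyperbolic_cross q n" and le: "\<mu> \<le> \<nu>"
  have "(\<Prod>j<q. \<mu> j + 1) \<le> (\<Prod>j<q. \<nu> j + 1)" using le by (intro prod_mono) (auto simp: le_fun_def)
  then show "\<mu> \<in> hyperbolic_cross q n"
    using \<nu> le downward_closed_multi_indices[of "enat q"] by (auto simp: hyperbolic_cross_def downward_closed_def)
qed

text \<open>Together with \<nu> the set contains the whole box below \<nu>, whose cardinality is the
  product defining the cross.\<close>

lemma downward_closed_subset_hyperbolic_cross:
  assumes "finite \<Lambda>" "downward_closed \<Lambda>" "\<Lambda> \<subseteq> multi_indices (enat q)" "card \<Lambda> \<le> n"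
  shows "\<Lambda> \<subseteq> hyperbolic_cross q n"
proof
  fix \<nu> assume \<nu>: "\<nu> \<in> \<Lambda>"
  \<comment> \<open>Functions in a \<open>PiE\<close> take the value \<open>undefined\<close> off
    the index range; \<open>emb\<close> replaces it by 0 to obtain multi-indices.\<close>
  define emb where "emb = (\<lambda>g j. if j < q then g j else (0::nat))"
  have "(\<Prod>j<q. \<nu> j + 1) = card (PiE {..<q} (\<lambda>j. {..\<nu> j}))" by (simp add: card_PiE)
  also have "\<dots> \<le> card \<Lambda>"
  proof (rule card_inj_on_le[of emb])
    show "inj_on emb (PiE {..<q} (\<lambda>j. {..\<nu> j}))"
    proof (rule inj_onI)
      fix f g assume fg: "f \<in> PiE {..<q} (\<lambda>j. {..\<nu> j})" "g \<in> PiE {..<q} (\<lambda>j. {..\<nu> j})" and e: "emb f = emb g"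
      show "f = g"
      proof (rule PiE_ext[OF fg])
        fix j assume "j \<in> {..<q}"
        then show "f j = g j" using fun_cong[OF e, of j] by (simp add: emb_def)
      qed
    qed
    show "emb ` PiE {..<q} (\<lambda>j. {..\<nu> j}) \<subseteq> \<Lambda>"
    proof safe
      fix g assume "g \<in> PiE {..<q} (\<lambda>j. {..\<nu> j})"
      then have "emb g \<le> \<nu>" by (auto simp: emb_def le_fun_def PiE_iff)
      then show "emb g \<in> \<Lambda>" using assms(2) \<nu> by (auto simp: downward_closed_def)
    qed
  qed (rule assms(1))
  finally show "\<nu> \<in> hyperbolic_cross q n" using \<nu> assms by (auto simp: hyperbolic_cross_def)
qed

section \<open>Counting downward closed sets\<close>

lemma downward_family_enat:
  "downward_family (enat k) n = {\<Lambda>. (\<forall>\<nu>\<in>\<Lambda>. \<forall>j\<ge>k. \<nu> j = 0) \<and> finite \<Lambda> \<and> card \<Lambda> = n \<and> downward_closed \<Lambda>}"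
  by (auto simp: downward_family_def multi_indices_enat)

lemma downward_family_0: "downward_family (enat k) 0 = {{}}"
  by (auto simp: downward_family_enat downward_closed_def)

definition raise :: "nat \<Rightarrow> (nat \<Rightarrow> nat) \<Rightarrow> nat \<Rightarrow> nat" where
  "raise j \<nu> = \<nu>(j := Suc (\<nu> j))"

lemma inj_raise: "inj (raise j)"
proof (rule injI)
  fix x y assume e: "raise j x = raise j y"
  show "x = y"
  proof
    fix i show "x i = y i" using fun_cong[OF e, of i] by (cases "i = j") (auto simp: raise_def)
  qed
qed

lemma le_raise: "\<nu> \<le> raise j \<nu>"
  by (simp add: raise_def le_fun_def)

lemma raise_mono: "\<mu> \<le> \<nu> \<Longrightarrow> raise j \<mu> \<le> raise j \<nu>"
  by (simp add: raise_def le_fun_def)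

lemma in_range_raise: "\<nu> j > 0 \<Longrightarrow> \<exists>\<mu>. \<nu> = raise j \<mu>"
  by (rule exI[of _ "\<nu>(j := \<nu> j - 1)"]) (simp add: raise_def)

abbreviation "fam k n \<equiv> downward_family (enat k) n"

text \<open>A downward closed set is determined by its face $\nu_k = 0$ and the rest, lowered by one in
  the direction $k$.\<close>

lemma downward_family_Suc_subset:
  assumes "n > 0"
  shows "fam (Suc k) n \<subseteq>
    (\<lambda>(A, B). A \<union> raise k ` B) ` (\<Union>a\<in>{1..n}. fam k a \<times> fam (Suc k) (n - a))"
proof
  fix \<Lambda> assume \<Lambda>: "\<Lambda> \<in> fam (Suc k) n"
  then have fin: "finite \<Lambda>" and card: "card \<Lambda> = n" and dc: "downward_closed \<Lambda>"
    and supp: "\<And>\<nu> j. \<nu> \<in> \<Lambda> \<Longrightarrow> j \<ge> Suc k \<Longrightarrow> \<nu> j = 0" by (auto simp: downward_family_enat)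
  define A where "A = {\<nu>\<in>\<Lambda>. \<nu> k = 0}"
  define B where "B = {\<nu>. raise k \<nu> \<in> \<Lambda>}"
  have B\<Lambda>: "raise k ` B = {\<nu>\<in>\<Lambda>. \<nu> k > 0}"
    using in_range_raise[of _ k] by (auto simp: B_def) (auto simp: raise_def)
  have eq: "\<Lambda> = A \<union> raise k ` B" unfolding B\<Lambda> by (auto simp: A_def)
  have finA: "finite A" using fin by (simp add: A_def)
  have "finite (raise k ` B)" unfolding B\<Lambda> using fin by simp
  then have finB: "finite B" using inj_raise by (metis finite_imageD inj_on_subset subset_UNIV)
  have "card \<Lambda> = card A + card (raise k ` B)"
    by (subst eq, rule card_Un_disjoint) (use finA finB in \<open>auto simp: A_def raise_def\<close>)
  also have "card (raise k ` B) = card B" using inj_raise by (intro card_image) (auto intro: inj_on_subset)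
  finally have n: "n = card A + card B" using card by simp
  have "\<Lambda> \<noteq> {}" using assms card by auto
  then have "(\<lambda>_. 0) \<in> A" using downward_closed_zero[OF dc] by (simp add: A_def)
  then have "card A > 0" using finA by (auto simp: card_gt_0_iff)
  moreover have "A \<in> fam k (card A)"
  proof -
    have "downward_closed A" using dc by (auto simp: downward_closed_def A_def le_fun_def) (metis le_zero_eq)
    moreover have "\<nu> j = 0" if "\<nu> \<in> A" "j \<ge> k" for \<nu> j
      using that supp[of \<nu> j] by (cases "j = k") (auto simp: A_def)
    ultimately show ?thesis using finA by (auto simp: downward_family_enat)
  qed
  moreover have "B \<in> fam (Suc k) (card B)"
  proof -
    have "downward_closed B" unfolding downward_closed_def
    proof (intro ballI allI impI)
      fix \<nu> \<mu> assume "\<nu> \<in> B" "\<mu> \<le> \<nu>"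
      then show "\<mu> \<in> B" using dc raise_mono[of \<mu> \<nu> k] unfolding B_def downward_closed_def by blast
    qed
    moreover have "\<nu> j = 0" if "\<nu> \<in> B" "j \<ge> Suc k" for \<nu> j
      using supp[of "raise k \<nu>" j] that by (auto simp: B_def raise_def)
    ultimately show ?thesis using finB by (auto simp: downward_family_enat)
  qed
  ultimately have "(A, B) \<in> (\<Union>a\<in>{1..n}. fam k a \<times> fam (Suc k) (n - a))"
    using n by (intro UN_I[of "card A"]) auto
  then show "\<Lambda> \<in> (\<lambda>(A, B). A \<union> raise k ` B) ` (\<Union>a\<in>{1..n}. fam k a \<times> fam (Suc k) (n - a))"
    using eq by (intro image_eqI[of _ _ "(A, B)"]) auto
qed

lemma sum_power2_diff_le: "n \<le> N \<Longrightarrow> (\<Sum>a=1..n. (2::nat) ^ (N - a)) + 2 ^ (N - n) = 2 ^ N"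
proof (induction n)
  case (Suc n)
  have "(2::nat) ^ (N - n) = 2 * 2 ^ (N - Suc n)"
    using Suc by (simp flip: power_Suc add: Suc_diff_Suc)
  then show ?case using Suc by simp
qed simp

text \<open>Splitting off a face of a points leaves 2^(k a) times 2^((k+1)(n-a)), that is 2^((k+1)n
  - a), possibilities. The face contains the zero index, so a starts at 1 and the geometric sum
  stays below 2^((k+1)n).\<close>

lemma card_downward_family_le_power2:
  "finite (fam k n) \<and> card (fam k n) \<le> 2 ^ (k * n)"
proof (induction k arbitrary: n)
  case 0
  have "fam 0 n \<subseteq> (if n = 0 then {{}} else {{\<lambda>_. 0}})"
  proof
    fix \<Lambda> assume \<Lambda>: "\<Lambda> \<in> fam 0 n"
    then have "\<Lambda> \<subseteq> {\<lambda>_. 0}" by (auto simp: downward_family_enat)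
    then have "\<Lambda> = {} \<or> \<Lambda> = {\<lambda>_. 0}" by blast
    then show "\<Lambda> \<in> (if n = 0 then {{}} else {{\<lambda>_. 0}})" using \<Lambda> by (auto simp: downward_family_enat)
  qed
  moreover have "finite (if n = 0 then {{}} else {{\<lambda>_. 0}} :: (nat \<Rightarrow> nat) set set)"
    "card (if n = 0 then {{}} else {{\<lambda>_. 0}} :: (nat \<Rightarrow> nat) set set) = 1" by auto
  ultimately show ?case using finite_subset card_mono by fastforce
next
  case (Suc k)
  show ?case
  proof (induction n rule: less_induct)
    case (less n)
    show ?case
    proof (cases "n = 0")
      case True then show ?thesis by (simp add: downward_family_0)
    next
      case False
      let ?F = "\<lambda>a. fam k a \<times> fam (Suc k) (n - a)"
      let ?U = "\<Union>a\<in>{1..n}. ?F a"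
      have fin: "finite (?F a)" if "a \<in> {1..n}" for a
        using Suc.IH less.IH[of "n - a"] that by auto
      have finU: "finite ?U" using fin by blast
      have "card ?U \<le> (\<Sum>a=1..n. card (?F a))" by (rule card_UN_le) simp
      also have "\<dots> \<le> (\<Sum>a=1..n. 2 ^ (Suc k * n - a))"
      proof (rule sum_mono)
        fix a assume a: "a \<in> {1..n}"
        then have "card (?F a) \<le> 2 ^ (k * a) * 2 ^ (Suc k * (n - a))"
          unfolding card_cartesian_product using Suc.IH less.IH[of "n - a"] by (intro mult_mono) auto
        also have "k * a + Suc k * (n - a) = Suc k * n - a"
        proof -
          obtain b where "n = a + b" using a le_Suc_ex[of a n] by auto
          then show ?thesis by (simp add: algebra_simps)
        qed
        then have "(2::nat) ^ (k * a) * 2 ^ (Suc k * (n - a)) = 2 ^ (Suc k * n - a)" by (metis power_add)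
        finally show "card (?F a) \<le> 2 ^ (Suc k * n - a)" .
      qed
      also have "\<dots> \<le> 2 ^ (Suc k * n)"
        using sum_power2_diff_le[of n "Suc k * n"] by simp
      finally have cU: "card ?U \<le> 2 ^ (Suc k * n)" .
      have sub: "fam (Suc k) n \<subseteq> (\<lambda>(A, B). A \<union> raise k ` B) ` ?U"
        by (rule downward_family_Suc_subset) (use False in simp)
      have "finite (fam (Suc k) n)" by (rule finite_subset[OF sub]) (use finU in simp)
      moreover have "card (fam (Suc k) n) \<le> card ((\<lambda>(A, B). A \<union> raise k ` B) ` ?U)"
        by (rule card_mono[OF _ sub]) (use finU in simp)
      moreover have "\<dots> \<le> card ?U" by (rule card_image_le[OF finU])
      ultimately show ?thesis using cU by simp
    qed
  qed
qed

text \<open>An element of maximal total degree lies below no other element, so the set without it is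
  still downward closed. It is nonzero because there are at least two elements, and lowering one of
  its positive entries gives an element that remains.\<close>

lemma downward_family_extend:
  assumes "n > 0" and \<Lambda>: "\<Lambda> \<in> fam k (Suc n)"
  shows "\<exists>\<Lambda>'\<in>fam k n. \<exists>\<mu>\<in>\<Lambda>'. \<exists>j<k. \<Lambda> = insert (raise j \<mu>) \<Lambda>'"
proof -
  have fin: "finite \<Lambda>" and card: "card \<Lambda> = Suc n" and dc: "downward_closed \<Lambda>"
    and supp: "\<And>\<nu> j. \<nu> \<in> \<Lambda> \<Longrightarrow> j \<ge> k \<Longrightarrow> \<nu> j = 0" using \<Lambda> by (auto simp: downward_family_enat)
  define S where "S = (\<lambda>\<nu> :: nat \<Rightarrow> nat. \<Sum>j<k. \<nu> j)"
  have ne: "\<Lambda> \<noteq> {}" using card by auto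
  have "Max (S ` \<Lambda>) \<in> S ` \<Lambda>" using fin ne by (intro Max_in) auto
  then obtain \<nu> where \<nu>: "\<nu> \<in> \<Lambda>" "Max (S ` \<Lambda>) = S \<nu>" by blast
  have max: "S \<mu> \<le> S \<nu>" if "\<mu> \<in> \<Lambda>" for \<mu> unfolding \<nu>(2)[symmetric] using fin that by simp
  note \<nu> = \<nu>(1)
  have "\<exists>\<rho>\<in>\<Lambda>. \<rho> \<noteq> (\<lambda>_. 0)"
  proof (rule ccontr)
    assume "\<not> ?thesis"
    then have "\<Lambda> \<subseteq> {\<lambda>_. 0}" by auto
    then have "card \<Lambda> \<le> card {\<lambda>_ :: nat. 0 :: nat}" by (rule card_mono[rotated]) simp
    then show False using card assms(1) by simp
  qed
  then obtain \<rho> i where \<rho>: "\<rho> \<in> \<Lambda>" "\<rho> i > 0" by fastforce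
  then have "i < k" using supp[of \<rho> i] by (cases "k \<le> i") auto
  then have "S \<rho> > 0" unfolding S_def using \<rho> by (intro sum_pos2[of _ i]) auto
  then have "S \<nu> > 0" using max[OF \<rho>(1)] by simp
  then obtain j where j: "j < k" "\<nu> j > 0" unfolding S_def using sum.neutral[of "{..<k}" \<nu>] by fastforce
  obtain \<mu> where \<mu>: "\<nu> = raise j \<mu>" using in_range_raise[of \<nu> j] j by blast
  have "\<mu> \<in> \<Lambda>" using dc \<nu> le_raise[of \<mu> j] unfolding \<mu> downward_closed_def by blast
  moreover have "\<mu> \<noteq> \<nu>" unfolding \<mu> raise_def by (metis fun_upd_same n_not_Suc_n)
  moreover have "\<Lambda> - {\<nu>} \<in> fam k n"
  proof -
    have "downward_closed (\<Lambda> - {\<nu>})" unfolding downward_closed_def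
    proof (intro ballI allI impI)
      fix \<sigma> \<tau> assume \<sigma>: "\<sigma> \<in> \<Lambda> - {\<nu>}" and le: "\<tau> \<le> \<sigma>"
      have "\<tau> \<noteq> \<nu>"
      proof
        assume "\<tau> = \<nu>"
        have "\<nu> \<noteq> \<sigma>" using \<sigma> by auto
        then obtain i where i: "\<nu> i \<noteq> \<sigma> i" by blast
        then have lt: "\<nu> i < \<sigma> i" using le \<open>\<tau> = \<nu>\<close> by (simp add: le_fun_def le_neq_implies_less)
        then have "i < k" using supp[of \<sigma> i] \<sigma> by (cases "k \<le> i") auto
        then have "S \<nu> < S \<sigma>" unfolding S_def using lt le \<open>\<tau> = \<nu>\<close>
          by (intro sum_strict_mono_ex1) (auto simp: le_fun_def)
        then show False using max[of \<sigma>] \<sigma> by simp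
      qed
      then show "\<tau> \<in> \<Lambda> - {\<nu>}" using dc \<sigma> le unfolding downward_closed_def by blast
    qed
    then show ?thesis using fin card \<nu> supp by (auto simp: downward_family_enat)
  qed
  ultimately show ?thesis using \<nu> j \<mu> by (intro bexI[of _ "\<Lambda> - {\<nu>}"] bexI[of _ \<mu>] exI[of _ j]) auto
qed

text \<open>Every set grows from the singleton of the zero index by n insertions; each raises one of
  the present elements in one of \<open>k\<close> directions, so at most k times the present
  cardinality choices arise.\<close>

lemma card_downward_family_le_power:
  "card (fam k (Suc n)) \<le> (k * Suc n) ^ n"
proof (induction n)
  case 0
  have "fam k (Suc 0) \<subseteq> {{\<lambda>_. 0}}"
  proof
    fix \<Lambda> assume \<Lambda>: "\<Lambda> \<in> fam k (Suc 0)"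
    then obtain x where "\<Lambda> = {x}" by (auto simp: downward_family_enat card_Suc_eq)
    then show "\<Lambda> \<in> {{\<lambda>_. 0}}" using \<Lambda> downward_closed_zero[of \<Lambda>] by (auto simp: downward_family_enat)
  qed
  then have "card (fam k (Suc 0)) \<le> card {{\<lambda>_ :: nat. 0 :: nat}}" by (intro card_mono) auto
  then show ?case by simp
next
  case (Suc n)
  let ?F = "fam k (Suc n)"
  let ?U = "\<Union>\<Lambda>\<in>?F. (\<lambda>(\<mu>, j). insert (raise j \<mu>) \<Lambda>) ` (\<Lambda> \<times> {..<k})"
  have finF: "finite ?F" using card_downward_family_le_power2 by blast
  have fin\<Lambda>: "finite \<Lambda>" "card \<Lambda> = Suc n" if "\<Lambda> \<in> ?F" for \<Lambda> using that by (auto simp: downward_family_enat)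
  have "fam k (Suc (Suc n)) \<subseteq> ?U"
  proof
    fix \<Lambda> assume "\<Lambda> \<in> fam k (Suc (Suc n))"
    then obtain \<Lambda>' \<mu> j where "\<Lambda>' \<in> ?F" "\<mu> \<in> \<Lambda>'" "j < k" "\<Lambda> = insert (raise j \<mu>) \<Lambda>'"
      using downward_family_extend[of "Suc n"] by blast
    then show "\<Lambda> \<in> ?U" by (intro UN_I[of \<Lambda>'] image_eqI[of _ _ "(\<mu>, j)"]) auto
  qed
  then have "card (fam k (Suc (Suc n))) \<le> card ?U"
    using finF fin\<Lambda> by (intro card_mono) auto
  also have "\<dots> \<le> (\<Sum>\<Lambda>\<in>?F. card ((\<lambda>(\<mu>, j). insert (raise j \<mu>) \<Lambda>) ` (\<Lambda> \<times> {..<k})))"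
    by (rule card_UN_le[OF finF])
  also have "\<dots> \<le> (\<Sum>\<Lambda>\<in>?F. Suc n * k)"
  proof (rule sum_mono)
    fix \<Lambda> assume \<Lambda>: "\<Lambda> \<in> ?F"
    then have "finite (\<Lambda> \<times> {..<k})" using fin\<Lambda> by simp
    then have "card ((\<lambda>(\<mu>, j). insert (raise j \<mu>) \<Lambda>) ` (\<Lambda> \<times> {..<k})) \<le> card (\<Lambda> \<times> {..<k})" by (rule card_image_le)
    then show "card ((\<lambda>(\<mu>, j). insert (raise j \<mu>) \<Lambda>) ` (\<Lambda> \<times> {..<k})) \<le> Suc n * k"
      using fin\<Lambda>[OF \<Lambda>] by (simp add: card_cartesian_product)
  qed
  also have "\<dots> = card ?F * (k * Suc n)" by simp
  also have "\<dots> \<le> (k * Suc n) ^ n * (k * Suc n)" using Suc by (rule mult_right_mono) simp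
  also have "\<dots> = (k * Suc n) ^ Suc n" by simp
  also have "\<dots> \<le> (k * Suc (Suc n)) ^ Suc n" by (intro power_mono mult_left_mono) auto
  finally show ?case .
qed

text \<open>If some element is nonzero at coordinate j, the set contains the unit indices at 0, ...,
  j and the zero index, hence at least j + 2 elements. This is what makes anchored sets independent
  of the dimension.\<close>

lemma anchored_family_subset: "anchored_family d n \<subseteq> fam (n - 1) n"
proof
  fix \<Lambda> assume \<Lambda>: "\<Lambda> \<in> anchored_family d n"
  then have fin: "finite \<Lambda>" and card: "card \<Lambda> = n" and dc: "downward_closed \<Lambda>"
    and anc: "\<And>i j. kronecker_seq j \<in> \<Lambda> \<Longrightarrow> i \<le> j \<Longrightarrow> kronecker_seq i \<in> \<Lambda>"
    by (auto simp: anchored_family_def anchored_def)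
  have "\<nu> j = 0" if \<nu>: "\<nu> \<in> \<Lambda>" and j: "j \<ge> n - 1" for \<nu> j
  proof (rule ccontr)
    assume "\<nu> j \<noteq> 0"
    then have "kronecker_seq j \<le> \<nu>" by (auto simp: kronecker_seq_def le_fun_def)
    then have "kronecker_seq j \<in> \<Lambda>" using dc \<nu> unfolding downward_closed_def by blast
    then have sub: "insert (\<lambda>_. 0) (kronecker_seq ` {..j}) \<subseteq> \<Lambda>"
      using anc downward_closed_zero[OF dc] by auto
    have inj: "inj_on kronecker_seq {..j}"
    proof (rule inj_onI)
      fix x y assume "kronecker_seq x = kronecker_seq y"
      from fun_cong[OF this, of x] show "x = y" by (auto simp: kronecker_seq_def split: if_splits)
    qed
    have "(\<lambda>_. 0) \<notin> kronecker_seq ` {..j}"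
    proof
      assume "(\<lambda>_. 0) \<in> kronecker_seq ` {..j}"
      then obtain i where e: "(\<lambda>_. 0) = kronecker_seq i" by blast
      show False using fun_cong[OF e, of i] by (simp add: kronecker_seq_def)
    qed
    then have "card (insert (\<lambda>_. 0) (kronecker_seq ` {..j})) = Suc (Suc j)"
      using inj by (simp add: card_image)
    then have "Suc (Suc j) \<le> n" using card_mono[OF fin sub] card by simp
    then show False using j by simp
  qed
  then show "\<Lambda> \<in> fam (n - 1) n" using fin card dc by (auto simp: downward_family_enat)
qed

section \<open>A weighted Nikolskii inequality on $[-1,1]$\<close>

lemma lagrange_interpolation:
  fixes Q :: "real poly" and x :: "nat \<Rightarrow> real"
  assumes deg: "degree Q < n" and inj: "inj_on x {..<n}"
  shows "poly Q t = (\<Sum>j<n. poly Q (x j) / (\<Prod>l\<in>{..<n} - {j}. x j - x l) * (\<Prod>l\<in>{..<n} - {j}. t - x l))"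
proof -
  define c where "c = (\<lambda>j. poly Q (x j) / (\<Prod>l\<in>{..<n} - {j}. x j - x l))"
  define R where "R = (\<Sum>j<n. smult (c j) (\<Prod>l\<in>{..<n} - {j}. [:- x l, 1:]))"
  have R: "poly R t = (\<Sum>j<n. c j * (\<Prod>l\<in>{..<n} - {j}. t - x l))" for t
    by (simp add: R_def poly_sum poly_prod)
  have "degree R \<le> n - 1" unfolding R_def
  proof (rule degree_sum_le)
    fix j assume j: "j \<in> {..<n}"
    have "degree (\<Prod>l\<in>{..<n} - {j}. [:- x l, 1:]) \<le> sum (degree \<circ> (\<lambda>l. [:- x l, 1:])) ({..<n} - {j})"
      by (rule degree_prod_sum_le) simp
    also have "\<dots> = n - 1" using j by simp
    finally show "degree (smult (c j) (\<Prod>l\<in>{..<n} - {j}. [:- x l, 1:])) \<le> n - 1"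
      using degree_smult_le le_trans by blast
  qed simp
  moreover have "card (x ` {..<n}) = n" using inj by (simp add: card_image)
  moreover have "poly Q (x i) = poly R (x i)" if i: "i < n" for i
  proof -
    have "(\<Prod>l\<in>{..<n} - {j}. x i - x l) = 0" if "j < n" "j \<noteq> i" for j
      using that i by (intro prod_zero) auto
    then have "poly R (x i) = (\<Sum>j<n. if j = i then c i * (\<Prod>l\<in>{..<n} - {i}. x i - x l) else 0)"
      unfolding R by (intro sum.cong) auto
    also have "\<dots> = c i * (\<Prod>l\<in>{..<n} - {i}. x i - x l)" using i by simp
    also have "\<dots> = poly Q (x i)"
    proof -
      have "(\<Prod>l\<in>{..<n} - {i}. x i - x l) \<noteq> 0" using i inj by (auto simp: inj_on_def)
      then show ?thesis by (simp add: c_def)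
    qed
    finally show ?thesis by simp
  qed
  ultimately have "Q = R" using deg by (intro poly_eqI_degree[of "x ` {..<n}"]) auto
  then show ?thesis using R[of t] by (simp add: c_def)
qed

text \<open>The product is the binomial coefficient of n + a + 1 over n. Bernoulli's inequality
  bounds the factor that joins at each step by a quotient of consecutive (a+1)-st powers, which
  telescopes.\<close>

lemma prod_shifted_quotient_le:
  "(\<Prod>i=1..<Suc n. (real a + 1 + real i) / real i) \<le> real (Suc n) ^ (a + 1)"
proof (induction n)
  case (Suc n)
  have "(\<Prod>i=1..<Suc (Suc n). (real a + 1 + real i) / real i)
      = (\<Prod>i=1..<Suc n. (real a + 1 + real i) / real i) * ((real a + 1 + real (Suc n)) / real (Suc n))"
    by simp
  also have "(real a + 1 + real (Suc n)) / real (Suc n) = 1 + real (a + 1) * (1 / real (Suc n))"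
    by (simp add: field_simps)
  also have "\<dots> \<le> (1 + 1 / real (Suc n)) ^ (a + 1)"
    by (rule Bernoulli_inequality) (simp add: order_trans[of _ 0])
  also have "(\<Prod>i=1..<Suc n. (real a + 1 + real i) / real i) * (1 + 1 / real (Suc n)) ^ (a + 1)
      \<le> real (Suc n) ^ (a + 1) * (1 + 1 / real (Suc n)) ^ (a + 1)"
    using Suc by (intro mult_right_mono) auto
  also have "\<dots> = real (Suc (Suc n)) ^ (a + 1)"
  proof -
    have "real (Suc n) * (1 + 1 / real (Suc n)) = real (Suc (Suc n))" by (simp add: field_simps)
    then show ?thesis unfolding power_mult_distrib[symmetric] by (rule arg_cong)
  qed
  finally show ?case by (simp add: mult_left_mono prod_nonneg)
qed simp

text \<open>The first column of the inverse of the Cauchy matrix $1/(i+j+a+1)$, by partial fractions.\<close>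

lemma cauchy_matrix_kernel:
  "\<exists>k :: nat \<Rightarrow> real. (\<forall>i<Suc n. (\<Sum>j<Suc n. k j / real (i + j + a + 1)) = (if i = 0 then 1 else 0)) \<and>
     0 < k 0 \<and> k 0 \<le> real (a + 1) * real (Suc n) ^ (2 * a + 2)"
proof -
  let ?q = "\<Prod>i=1..<Suc n. (real a + 1 + real i) / real i"
  define x where "x = (\<lambda>j. - real (j + a + 1))"
  define D where "D = (\<Prod>j<Suc n. real (j + a + 1))"
  \<comment> \<open>The quotient of \<open>Q\<close> by the product of all t - x_j has partial
    fraction coefficients k_j. \<open>Q\<close> vanishes at t = 1, ..., n and is scaled so that the
    quotient is 1 at t = 0: these are the required row sums.\<close>
  define Q where "Q = smult (D / (\<Prod>i=1..<Suc n. - real i)) (\<Prod>i=1..<Suc n. [:- real i, 1:])"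
  define k where "k = (\<lambda>j. poly Q (x j) / (\<Prod>l\<in>{..<Suc n} - {j}. x j - x l))"
  have Q: "poly Q t = D / (\<Prod>i=1..<Suc n. - real i) * (\<Prod>i=1..<Suc n. t - real i)" for t
  proof -
    have "poly [:- real i, 1:] t = t - real i" for i by simp
    then show ?thesis by (simp only: Q_def poly_smult poly_prod)
  qed
  have "degree (\<Prod>i=1..<Suc n. [:- real i, 1:]) \<le> sum (degree \<circ> (\<lambda>i. [:- real i, 1:])) {1..<Suc n}"
    by (rule degree_prod_sum_le) simp
  then have deg: "degree Q < Suc n" unfolding Q_def by (intro le_less_trans[OF degree_smult_le]) simp
  have inj: "inj_on x {..<Suc n}" by (auto simp: x_def inj_on_def)
  have "(\<Sum>j<Suc n. k j / real (i + j + a + 1)) = (if i = 0 then 1 else 0)" if i: "i < Suc n" for i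
  proof -
    define W where "W = (\<Prod>j<Suc n. real i - x j)"
    have pos: "real i - x j > 0" for j by (simp add: x_def)
    have W: "W > 0" unfolding W_def using pos by (intro prod_pos) auto
    have "poly Q (real i) = (\<Sum>j<Suc n. k j * (\<Prod>l\<in>{..<Suc n} - {j}. real i - x l))"
      unfolding k_def by (rule lagrange_interpolation[OF deg inj])
    also have "\<dots> = (\<Sum>j<Suc n. W * (k j / real (i + j + a + 1)))"
    proof (rule sum.cong[OF refl])
      fix j assume "j \<in> {..<Suc n}"
      then have "W = (real i - x j) * (\<Prod>l\<in>{..<Suc n} - {j}. real i - x l)"
        unfolding W_def by (intro prod.remove) auto
      moreover have "real i - x j = real (i + j + a + 1)" by (simp add: x_def)
      ultimately show "k j * (\<Prod>l\<in>{..<Suc n} - {j}. real i - x l) = W * (k j / real (i + j + a + 1))"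
        using pos[of j] by (simp add: field_simps)
    qed
    also have "\<dots> = W * (\<Sum>j<Suc n. k j / real (i + j + a + 1))" by (simp only: sum_distrib_left)
    finally have e: "poly Q (real i) = W * (\<Sum>j<Suc n. k j / real (i + j + a + 1))" .
    show ?thesis
    proof (cases "i = 0")
      case True
      have "poly Q 0 = D" unfolding Q by simp
      moreover have "W = D" unfolding W_def D_def x_def using True by (intro prod.cong) auto
      ultimately show ?thesis using e W True by simp
    next
      case False
      then have "(\<Prod>l=1..<Suc n. real i - real l) = 0" using i by (intro prod_zero) auto
      then have "poly Q (real i) = 0" unfolding Q by simp
      then show ?thesis using e W False by simp
    qed
  qed
  \<comment> \<open>This entry is the reproducing kernel at the endpoint 0 for the weight t^a on
    [0,1]: a + 1 times a squared binomial coefficient. The two signs (-1)^n cancel.\<close>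
  moreover have k0: "k 0 = (real a + 1) * ?q\<^sup>2"
  proof -
    define p where "p = (\<Prod>i=1..<Suc n. real i)"
    define r where "r = (\<Prod>i=1..<Suc n. real a + 1 + real i)"
    have p: "p > 0" unfolding p_def by (intro prod_pos) auto
    have S: "{..<Suc n} = insert 0 {1..<Suc n}" by auto
    have 1: "(\<Prod>l\<in>{..<Suc n} - {0}. x 0 - x l) = p"
      unfolding p_def x_def by (intro prod.cong) auto
    have 2: "D = (real a + 1) * r" unfolding D_def S r_def by (simp add: add_ac)
    have neg: "(\<Prod>i=1..<Suc n. - f i) = (-1) ^ n * (\<Prod>i=1..<Suc n. f i)" for f :: "nat \<Rightarrow> real"
      by (simp add: prod_uminus)
    have "(\<Prod>i=1..<Suc n. x 0 - real i) = (\<Prod>i=1..<Suc n. - (real a + 1 + real i))"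
      by (intro prod.cong) (auto simp: x_def)
    also have "\<dots> = (-1) ^ n * r" unfolding neg r_def ..
    finally have 3: "(\<Prod>i=1..<Suc n. x 0 - real i) = (-1) ^ n * r" .
    have 4: "(\<Prod>i=1..<Suc n. - real i) = (-1) ^ n * p" unfolding neg p_def ..
    have "k 0 = (real a + 1) * r / ((-1) ^ n * p) * ((-1) ^ n * r) / p"
      unfolding k_def Q 1 2 3 4 ..
    also have "\<dots> = (real a + 1) * (r / p)\<^sup>2" using p by (simp add: field_simps power2_eq_square)
    also have "r / p = ?q" by (simp add: r_def p_def prod_dividef)
    finally show ?thesis .
  qed
  moreover have "?q > 0" by (intro prod_pos) auto
  then have "?q\<^sup>2 \<le> (real (Suc n) ^ (a + 1))\<^sup>2"
    using prod_shifted_quotient_le[of a n] by (intro power_mono) auto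
  then have "?q\<^sup>2 \<le> real (Suc n) ^ ((a + 1) * 2)"
    by (simp only: power_mult)
  then have "(real a + 1) * ?q\<^sup>2 \<le> (real a + 1) * real (Suc n) ^ ((a + 1) * 2)"
    by (rule mult_left_mono) simp
  then have "k 0 \<le> real (a + 1) * real (Suc n) ^ (2 * a + 2)"
    unfolding k0 by (simp only: of_nat_add of_nat_1 add_mult_distrib mult.commute[of a] mult_1)
  moreover have "0 < k 0" unfolding k0 using \<open>?q > 0\<close> by (intro mult_pos_pos zero_less_power) auto
  ultimately show ?thesis by blast
qed

section \<open>Point evaluation at an endpoint against power weights\<close>

lemma has_integral_power_0:
  fixes x :: real assumes "x \<ge> 0"
  shows "((\<lambda>t. t ^ k) has_integral x ^ Suc k / real (Suc k)) {0..x}"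
proof -
  have "((\<lambda>t. t ^ k) has_integral x ^ Suc k / real (Suc k) - 0 ^ Suc k / real (Suc k)) {0..x}"
  proof (rule fundamental_theorem_of_calculus[OF assms])
    fix t
    have "((\<lambda>t. t ^ Suc k / real (Suc k)) has_real_derivative t ^ k) (at t within {0..x})"
      using DERIV_cdivide[OF DERIV_pow[of "Suc k" t "{0..x}"], of "real (Suc k)"] by (simp del: of_nat_Suc power_Suc)
    then show "((\<lambda>t. t ^ Suc k / real (Suc k)) has_vector_derivative t ^ k) (at t within {0..x})"
      by (simp only: has_real_derivative_iff_has_vector_derivative)
  qed
  then show ?thesis by simp
qed

text \<open>Rescaling [0,x] to [0,1] absorbs the powers of x into the coefficients, so that one
  Cauchy matrix serves all intervals.\<close>

lemma has_integral_square_poly_power: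
  fixes c :: "nat \<Rightarrow> real" and x :: real assumes "x \<ge> 0"
  shows "((\<lambda>t. (\<Sum>i<n. c i * t ^ i)\<^sup>2 * t ^ a) has_integral
     x ^ Suc a * (\<Sum>i<n. \<Sum>j<n. (c i * x ^ i) * (c j * x ^ j) / real (i + j + a + 1))) {0..x}"
proof -
  have "((\<lambda>t. \<Sum>i<n. \<Sum>j<n. c i * c j * t ^ (i + j + a)) has_integral
      (\<Sum>i<n. \<Sum>j<n. c i * c j * (x ^ Suc (i + j + a) / real (Suc (i + j + a))))) {0..x}"
    using assms by (intro has_integral_sum has_integral_mult_right has_integral_power_0) auto
  moreover have "(\<Sum>i<n. \<Sum>j<n. c i * c j * t ^ (i + j + a)) = (\<Sum>i<n. c i * t ^ i)\<^sup>2 * t ^ a" for t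
    by (simp add: power2_eq_square sum_distrib_left sum_distrib_right power_add mult_ac)
  moreover have "(\<Sum>i<n. \<Sum>j<n. c i * c j * (x ^ Suc (i + j + a) / real (Suc (i + j + a))))
      = x ^ Suc a * (\<Sum>i<n. \<Sum>j<n. (c i * x ^ i) * (c j * x ^ j) / real (i + j + a + 1))"
    by (simp add: sum_distrib_left power_add mult_ac)
  ultimately show ?thesis by simp
qed

text \<open>The kernel column \<open>k\<close> represents evaluation at 0: the form of
  \<open>d\<close> and \<open>k\<close> is \<open>d 0\<close>. Since the form is an integral of
  squares it is nonnegative, and subtracting the projection onto \<open>k\<close> gives the
  Cauchy-Schwarz bound with constant \<open>k 0\<close>.\<close>

lemma cauchy_form_lower_bound:
  fixes c :: "nat \<Rightarrow> real"
  shows "(c 0)\<^sup>2 \<le> real (a + 1) * real (Suc n) ^ (2 * a + 2) * (\<Sum>i<Suc n. \<Sum>j<Suc n. c i * c j / real (i + j + a + 1))"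
proof -
  define N where "N = Suc n"
  obtain k :: "nat \<Rightarrow> real" where k: "\<And>i. i < N \<Longrightarrow> (\<Sum>j<N. k j / real (i + j + a + 1)) = (if i = 0 then 1 else 0)"
    "0 < k 0" "k 0 \<le> real (a + 1) * real N ^ (2 * a + 2)" using cauchy_matrix_kernel[of n a] unfolding N_def by blast
  define q where "q = (\<lambda>c d :: nat \<Rightarrow> real. \<Sum>i<N. \<Sum>j<N. c i * d j / real (i + j + a + 1))"
  have nonneg: "q d d \<ge> 0" for d
  proof -
    have "0 \<le> 1 ^ Suc a * (\<Sum>i<N. \<Sum>j<N. (d i * 1 ^ i) * (d j * 1 ^ j) / real (i + j + a + 1))"
      by (rule has_integral_nonneg[OF has_integral_square_poly_power]) auto
    then show ?thesis by (simp add: q_def)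
  qed
  have qk: "q d k = d 0" for d
  proof -
    have "q d k = (\<Sum>i<N. d i * (\<Sum>j<N. k j / real (i + j + a + 1)))" by (simp add: q_def sum_distrib_left)
    also have "\<dots> = (\<Sum>i<N. if i = 0 then d 0 else 0)" using k(1) by (intro sum.cong) auto
    also have "\<dots> = d 0" by (simp add: N_def)
    finally show ?thesis .
  qed
  have qc: "q k d = q d k" for d unfolding q_def by (subst sum.swap) (simp add: add_ac mult_ac)
  define r where "r = c 0 / k 0"
  have "0 \<le> q (\<lambda>i. c i - r * k i) (\<lambda>i. c i - r * k i)" by (rule nonneg)
  also have "\<dots> = q c c - r * q c k - r * q k c + r * r * q k k"
    by (simp add: q_def algebra_simps sum_subtractf sum.distrib sum_distrib_left diff_divide_distrib add_divide_distrib)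
  also have "\<dots> = q c c - (c 0)\<^sup>2 / k 0" using k(2) by (simp add: qc qk r_def power2_eq_square)
  finally have "(c 0)\<^sup>2 \<le> k 0 * q c c" using k(2) by (simp add: field_simps)
  also have "\<dots> \<le> real (a + 1) * real N ^ (2 * a + 2) * q c c" using k(3) nonneg by (intro mult_right_mono) auto
  finally show ?thesis by (simp add: q_def N_def)
qed

lemma poly_eq_sum_coeff:
  fixes p :: "real poly" assumes "degree p < n" shows "poly p t = (\<Sum>i<n. coeff p i * t ^ i)"
  unfolding poly_altdef using assms
  by (intro sum.mono_neutral_left) (auto simp: coeff_eq_0)

text \<open>The factor i + 1 of the kernel bound cancels against the mass x^(i+1)/(i+1) of the
  weight, and since n is at least 1 the exponent may be raised from i to \<open>q\<close>. Written
  as a nonnegative integral, the inequality can be added up over \<open>i\<close> with one and the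
  same constant.\<close>

lemma endpoint_inequality:
  fixes p :: "real poly" and x :: real
  assumes deg: "degree p < n" and x: "x \<ge> 0" and "i \<le> q"
  shows "0 \<le> integral {0..x} (\<lambda>t. ((poly p t)\<^sup>2 - (poly p 0)\<^sup>2 / real n ^ (2 * q + 2)) * t ^ i)"
proof -
  obtain m where m: "n = Suc m" using deg by (cases n) auto
  define C where "C = (poly p 0)\<^sup>2 / real n ^ (2 * q + 2)"
  define d where "d = (\<lambda>j. coeff p j * x ^ j)"
  define S where "S = (\<Sum>i'<n. \<Sum>j<n. d i' * d j / real (i' + j + i + 1))"
  have p0: "poly p 0 = d 0" by (simp add: d_def poly_0_coeff_0)
  have "((\<lambda>t. (poly p t)\<^sup>2 * t ^ i - C * t ^ i) has_integral x ^ Suc i * S - C * (x ^ Suc i / real (Suc i))) {0..x}"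
    unfolding poly_eq_sum_coeff[OF deg, of _] S_def d_def
    by (intro has_integral_diff has_integral_mult_right has_integral_square_poly_power has_integral_power_0 x)
  then have I: "integral {0..x} (\<lambda>t. ((poly p t)\<^sup>2 - C) * t ^ i) = x ^ Suc i * (S - C / real (Suc i))"
    by (simp add: left_diff_distrib integral_unique algebra_simps)
  have "(d 0)\<^sup>2 \<le> real (i + 1) * real n ^ (2 * i + 2) * S"
    unfolding S_def m by (rule cauchy_form_lower_bound)
  also have "\<dots> \<le> real (i + 1) * real n ^ (2 * q + 2) * S"
  proof -
    have "0 \<le> (d 0)\<^sup>2" by simp
    also have "\<dots> \<le> real (i + 1) * real n ^ (2 * i + 2) * S" unfolding S_def m by (rule cauchy_form_lower_bound)
    finally have "0 \<le> (real (i + 1) * real n ^ (2 * i + 2)) * S" .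
    moreover have "0 < real (i + 1) * real n ^ (2 * i + 2)" using m by (intro mult_pos_pos zero_less_power) auto
    ultimately have "0 \<le> S" by (simp only: zero_le_mult_iff) auto
    moreover have "real n ^ (2 * i + 2) \<le> real n ^ (2 * q + 2)" using \<open>i \<le> q\<close> m by (intro power_increasing) auto
    ultimately show ?thesis by (intro mult_right_mono mult_left_mono) auto
  qed
  finally have "(d 0)\<^sup>2 \<le> (real (Suc i) * S) * real n ^ (2 * q + 2)" by (simp only: mult_ac Suc_eq_plus1)
  moreover have "0 < real n ^ (2 * q + 2)" using m by (intro zero_less_power) auto
  ultimately have "C \<le> real (Suc i) * S" unfolding C_def p0 by (simp only: pos_divide_le_eq)
  then have "0 \<le> S - C / real (Suc i)" by (simp add: field_simps)
  then show ?thesis unfolding C_def[symmetric] I using x by simp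
qed

text \<open>Integration by parts: the primitive of \<open>f\<close> is nonnegative by hypothesis,
  and the derivative of the decreasing factor is nonpositive.\<close>

lemma integral_mult_decreasing_nonneg:
  fixes f :: "real \<Rightarrow> real" and z :: real
  assumes z: "z \<ge> 0" and f: "continuous_on {0..z} f" and F: "\<And>x. x \<in> {0..z} \<Longrightarrow> 0 \<le> integral {0..x} f"
  shows "0 \<le> integral {0..z} (\<lambda>t. f t * (z - t) ^ b)"
proof -
  define G where "G = (\<lambda>x. integral {0..x} f)"
  define g' where "g' = (\<lambda>t. - (real b * (z - t) ^ (b - 1)))"
  have G: "continuous_on {0..z} G" unfolding G_def
    by (intro indefinite_integral_continuous_1 integrable_continuous_interval f)
  have "((\<lambda>t. f t * (z - t) ^ b + g' t * G t) has_integral G z * (z - z) ^ b - G 0 * (z - 0) ^ b) {0..z}"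
  proof (rule fundamental_theorem_of_calculus[OF z])
    fix t assume t: "t \<in> {0..z}"
    have "(G has_real_derivative f t) (at t within {0..z})"
      unfolding G_def by (rule integral_has_real_derivative[OF f t])
    moreover have "((\<lambda>t. (z - t) ^ b) has_real_derivative g' t) (at t within {0..z})"
      unfolding g'_def by (auto intro!: derivative_eq_intros)
    ultimately show "((\<lambda>t. G t * (z - t) ^ b) has_vector_derivative f t * (z - t) ^ b + g' t * G t) (at t within {0..z})"
      unfolding has_real_derivative_iff_has_vector_derivative[symmetric] by (rule DERIV_mult)
  qed
  \<comment> \<open>The boundary term at \<open>z\<close> is kept as \<open>0 ^ b\<close>: for b = 0
    it is the full primitive, which is nonnegative too.\<close>
  then have "integral {0..z} (\<lambda>t. f t * (z - t) ^ b + g' t * G t) = G z * 0 ^ b"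
    by (simp add: integral_unique G_def)
  then have "0 \<le> integral {0..z} (\<lambda>t. f t * (z - t) ^ b + g' t * G t)" using F[of z] z by (simp add: G_def)
  also have "\<dots> \<le> integral {0..z} (\<lambda>t. f t * (z - t) ^ b)"
  proof (rule integral_le)
    fix t assume t: "t \<in> {0..z}"
    then have "g' t * G t \<le> 0" using F[OF t] by (auto simp: g'_def G_def mult_nonneg_nonneg)
    then show "f t * (z - t) ^ b + g' t * G t \<le> f t * (z - t) ^ b" by simp
  qed (auto simp: g'_def intro!: integrable_continuous_interval continuous_intros f G)
  finally show ?thesis .
qed

text \<open>To the left of a point $y$, with $t = y - x$, the Jacobi weight is
  $(A + x)^a (z - x)^b$ for $A = 1 - y$ and $z = 1 + y$: the first factor is expanded into powers
  of $x$, to which the endpoint inequality applies, and the second is decreasing. Thus interior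
  points need no extremal property of the Jacobi polynomials.\<close>

lemma one_sided_inequality:
  fixes p :: "real poly" and A z :: real
  assumes deg: "degree p < n" and "A \<ge> 0" "z \<ge> 0" "a \<le> q"
  shows "0 \<le> integral {0..z} (\<lambda>t. ((poly p t)\<^sup>2 - (poly p 0)\<^sup>2 / real n ^ (2 * q + 2)) * (A + t) ^ a * (z - t) ^ b)"
proof (rule integral_mult_decreasing_nonneg[OF \<open>z \<ge> 0\<close>])
  let ?f = "\<lambda>t. ((poly p t)\<^sup>2 - (poly p 0)\<^sup>2 / real n ^ (2 * q + 2)) * (A + t) ^ a"
  define g where "g = (\<lambda>t. (poly p t)\<^sup>2 - (poly p 0)\<^sup>2 / real n ^ (2 * q + 2))"
  have g: "continuous_on S g" for S unfolding g_def by (intro continuous_intros)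
  show "continuous_on {0..z} ?f"
    by (intro continuous_intros)
  fix x assume x: "x \<in> {0..z}"
  have "g t * (A + t) ^ a = (\<Sum>i\<le>a. real (a choose i) * A ^ (a - i) * (g t * t ^ i))" for t
    using binomial_ring[of t A a] by (simp add: add.commute sum_distrib_left mult_ac)
  then have "integral {0..x} (\<lambda>t. g t * (A + t) ^ a) = integral {0..x} (\<lambda>t. \<Sum>i\<le>a. real (a choose i) * A ^ (a - i) * (g t * t ^ i))"
    by simp
  also have "\<dots> = (\<Sum>i\<le>a. integral {0..x} (\<lambda>t. real (a choose i) * A ^ (a - i) * (g t * t ^ i)))"
    by (intro integral_sum integrable_continuous_interval continuous_intros g) auto
  also have "\<dots> = (\<Sum>i\<le>a. real (a choose i) * A ^ (a - i) * integral {0..x} (\<lambda>t. g t * t ^ i))"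
    by simp
  also have "\<dots> \<ge> 0"
  proof (intro sum_nonneg mult_nonneg_nonneg)
    fix i assume "i \<in> {..a}"
    then show "0 \<le> integral {0..x} (\<lambda>t. g t * t ^ i)"
      unfolding g_def using x \<open>a \<le> q\<close> by (intro endpoint_inequality[OF deg]) auto
  qed (use \<open>A \<ge> 0\<close> in auto)
  finally show "0 \<le> integral {0..x} ?f"
    by (simp add: g_def)
qed

lemma left_inequality:
  fixes p :: "real poly" and y :: real
  assumes deg: "degree p < n" and y: "y \<in> {-1..1}" and "a \<le> q"
  shows "0 \<le> integral {-1..y} (\<lambda>t. ((poly p t)\<^sup>2 - (poly p y)\<^sup>2 / real n ^ (2 * q + 2)) * ((1 - t) ^ a * (1 + t) ^ b))"
proof -
  define h where "h = (\<lambda>t. ((poly p t)\<^sup>2 - (poly p y)\<^sup>2 / real n ^ (2 * q + 2)) * ((1 - t) ^ a * (1 + t) ^ b))"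
  define p' where "p' = p \<circ>\<^sub>p [:y, -1:]"
  have "degree p' < n" using deg unfolding p'_def by (simp add: degree_pcompose)
  then have "0 \<le> integral {0..1+y} (\<lambda>t. ((poly p' t)\<^sup>2 - (poly p' 0)\<^sup>2 / real n ^ (2 * q + 2)) * ((1 - y) + t) ^ a * ((1 + y) - t) ^ b)"
    using y \<open>a \<le> q\<close> by (intro one_sided_inequality) auto
  also have "(\<lambda>t. ((poly p' t)\<^sup>2 - (poly p' 0)\<^sup>2 / real n ^ (2 * q + 2)) * ((1 - y) + t) ^ a * ((1 + y) - t) ^ b)
      = (\<lambda>t. h (- t)) \<circ> (\<lambda>x. x + - y)"
    by (auto simp: p'_def h_def poly_pcompose algebra_simps)
  also have "integral {0..1+y} \<dots> = integral {0 + - y..1 + y + - y} (\<lambda>t. h (- t))"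
    unfolding h_def by (intro integral_shift continuous_intros)
  also have "\<dots> = integral {-1..y} h" using Henstock_Kurzweil_Integration.integral_reflect_real[of y "-1" h] by simp
  finally show ?thesis by (simp add: h_def)
qed

text \<open>The two one-sided inequalities at \<open>y\<close> have the same constant and add up to
  the whole interval. The right half is the left half for the reflected polynomial, where
  \<open>a\<close> and \<open>b\<close> change places; hence \<open>q\<close> must dominate
  both.\<close>

lemma poly_square_le_weighted_integral:
  fixes p :: "real poly" and y :: real
  assumes deg: "degree p < n" and y: "y \<in> {-1..1}" and q: "a \<le> q" "b \<le> q"
  shows "(poly p y)\<^sup>2 * integral {-1..1} (\<lambda>t. (1 - t) ^ a * (1 + t) ^ b)
     \<le> real n ^ (2 * q + 2) * integral {-1..1} (\<lambda>t. (poly p t)\<^sup>2 * ((1 - t) ^ a * (1 + t) ^ b))"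
proof -
  define C where "C = (poly p y)\<^sup>2 / real n ^ (2 * q + 2)"
  define w where "w = (\<lambda>t :: real. (1 - t) ^ a * (1 + t) ^ b)"
  define h where "h = (\<lambda>t. ((poly p t)\<^sup>2 - C) * w t)"
  have n: "n > 0" using deg by simp
  have c: "continuous_on S h" "continuous_on S w" for S unfolding h_def w_def by (auto intro!: continuous_intros)
  define p' where "p' = p \<circ>\<^sub>p [:0, -1:]"
  have "degree p' < n" using deg unfolding p'_def by (simp add: degree_pcompose)
  then have "0 \<le> integral {-1..-y} (\<lambda>t. ((poly p' t)\<^sup>2 - (poly p' (- y))\<^sup>2 / real n ^ (2 * q + 2)) * ((1 - t) ^ b * (1 + t) ^ a))"
    using y q by (intro left_inequality) auto
  also have "(\<lambda>t. ((poly p' t)\<^sup>2 - (poly p' (- y))\<^sup>2 / real n ^ (2 * q + 2)) * ((1 - t) ^ b * (1 + t) ^ a)) = (\<lambda>t. h (- t))"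
    by (auto simp: p'_def h_def C_def w_def poly_pcompose)
  also have "integral {-1..-y} \<dots> = integral {y..1} h" by (rule Henstock_Kurzweil_Integration.integral_reflect_real)
  finally have r: "0 \<le> integral {y..1} h" .
  have l: "0 \<le> integral {-1..y} h" using left_inequality[OF deg y q(1), of b] by (simp add: h_def C_def w_def)
  have "integral {-1..1} h = integral {-1..y} h + integral {y..1} h"
    using y c by (intro Henstock_Kurzweil_Integration.integral_combine[symmetric] integrable_continuous_interval) auto
  then have "0 \<le> integral {-1..1} h" using l r by simp
  also have "\<dots> = integral {-1..1} (\<lambda>t. (poly p t)\<^sup>2 * w t - C * w t)" by (simp add: h_def left_diff_distrib)
  also have "\<dots> = integral {-1..1} (\<lambda>t. (poly p t)\<^sup>2 * w t) - C * integral {-1..1} w"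
    by (subst integral_diff) (auto intro!: integrable_continuous_interval continuous_intros c)
  finally have "C * integral {-1..1} w \<le> integral {-1..1} (\<lambda>t. (poly p t)\<^sup>2 * w t)" by simp
  then have "(poly p y)\<^sup>2 * integral {-1..1} w / real n ^ (2 * q + 2) \<le> integral {-1..1} (\<lambda>t. (poly p t)\<^sup>2 * w t)"
    by (simp add: C_def)
  moreover have "0 < real n ^ (2 * q + 2)" using n by (intro zero_less_power) auto
  ultimately show ?thesis unfolding w_def by (simp only: pos_divide_le_eq mult.commute)
qed

section \<open>Orthonormal systems for the Jacobi measures\<close>

text \<open>The interface to the multivariate part, supplied by both families of weights. Everything
  is asked on [-1,1] only, as the functions \<open>L k\<close> need not be polynomials
  elsewhere.\<close>

locale christoffel_system = prob_space B for B :: "real measure" +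
  fixes L :: "nat \<Rightarrow> real \<Rightarrow> real" and s :: real
  assumes space_B: "space B = {-1..1}"
    and id_measurable: "(\<lambda>t. t) \<in> borel_measurable B"
    and s_ge_1: "s \<ge> 1"
    and L_0: "t \<in> {-1..1} \<Longrightarrow> L 0 t = 1"
    and L_measurable: "L k \<in> borel_measurable B"
    and L_orthonormal: "(LINT t|B. L j t * L k t) = (if j = k then 1 else 0)"
    and christoffel: "t \<in> {-1..1} \<Longrightarrow> (\<Sum>k<n. (L k t)\<^sup>2) \<le> real n powr s"
    and power_expansion: "\<exists>b. \<forall>t\<in>{-1..1}. t ^ k = (\<Sum>i\<le>k. b i * L i t)"

section \<open>Orthonormal polynomials from a Nikolskii inequality\<close>

fun gram_schmidt :: "(real poly \<Rightarrow> real poly \<Rightarrow> real) \<Rightarrow> nat \<Rightarrow> real poly" where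
  "gram_schmidt ip k = monom 1 k - (\<Sum>i<k. smult (ip (monom 1 k) (gram_schmidt ip i) /
     ip (gram_schmidt ip i) (gram_schmidt ip i)) (gram_schmidt ip i))"

declare gram_schmidt.simps [simp del]

text \<open>Only terms of lower degree are subtracted, whatever \<open>ip\<close> is, so the result
  is monic.\<close>

lemma gram_schmidt_degree: "degree (gram_schmidt ip k) = k \<and> gram_schmidt ip k \<noteq> 0"
proof (induction k rule: less_induct)
  case (less k)
  have "coeff (\<Sum>i<k. smult (c i) (gram_schmidt ip i)) n = 0" if "n \<ge> k" for c n
    unfolding coeff_sum using less that by (intro sum.neutral) (auto intro: coeff_eq_0)
  then have c: "coeff (gram_schmidt ip k) n = (if n = k then 1 else 0)" if "n \<ge> k" for n
    using that by (subst gram_schmidt.simps) simp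
  have "degree (gram_schmidt ip k) \<le> k" by (rule degree_le) (use c in auto)
  moreover have "k \<le> degree (gram_schmidt ip k)" by (rule le_degree) (use c in auto)
  moreover have "gram_schmidt ip k \<noteq> 0" using c[of k] by auto
  ultimately show ?case by simp
qed

lemma poly_eq_0_on_interval:
  assumes "\<And>t. t \<in> {-1..1} \<Longrightarrow> poly p t = (0::real)" shows "p = 0"
proof (rule ccontr)
  assume "p \<noteq> 0"
  then have "finite {t. poly p t = 0}" by (rule poly_roots_finite)
  then have "finite {-1..1::real}" by (rule rev_finite_subset) (use assms in auto)
  then show False using infinite_Icc[of "-1 :: real" 1] by simp
qed

text \<open>Duality for the Christoffel function: the Nikolskii constant at a point dominates the
  sum of squares of the orthonormal polynomials there, as one sees from the reproducing kernel at
  that point.\<close>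

lemma christoffel_system_gram_schmidt:
  fixes B :: "real measure" and s :: real
  assumes B: "prob_space B" "space B = {-1..1}" "(\<lambda>t. t) \<in> borel_measurable B" and s: "s \<ge> 1"
    and nikolskii: "\<And>p n y. degree p < n \<Longrightarrow> y \<in> {-1..1} \<Longrightarrow>
      (poly p y)\<^sup>2 \<le> real n powr s * (LINT t|B. (poly p t)\<^sup>2)"
  shows "\<exists>L. christoffel_system B L s"
proof -
  interpret prob_space B by fact
  define ip where "ip = (\<lambda>p q. LINT t|B. poly p t * poly q t)"
  define P where "P = gram_schmidt ip"
  define c where "c = (\<lambda>k i. ip (monom 1 k) (P i) / ip (P i) (P i))"
  define L where "L = (\<lambda>k t. poly (P k) t / sqrt (ip (P k) (P k)))"
  have meas: "poly p \<in> borel_measurable B" for p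
    using measurable_compose[OF B(3), of "poly p" borel] by (simp add: borel_measurable_continuous_onI continuous_intros)
  have int: "integrable B (\<lambda>t. poly p t * poly q t)" for p q
  proof -
    have "bounded (poly (p * q) ` {-1..1})"
      by (intro compact_imp_bounded compact_continuous_image continuous_intros) auto
    then obtain b where b: "\<forall>t\<in>{-1..1}. norm (poly (p * q) t) \<le> b"
      unfolding bounded_iff by blast
    have "integrable B (poly (p * q))"
      by (rule integrable_const_bound[where B = b]) (use b B(2) meas in \<open>auto intro!: AE_I2\<close>)
    moreover have "poly (p * q) = (\<lambda>t. poly p t * poly q t)" by auto
    ultimately show ?thesis by simp
  qed
  have ip_comm: "ip p q = ip q p" for p q by (simp add: ip_def mult.commute)
  have ip_diff: "ip (p - q) r = ip p r - ip q r" for p q r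
    unfolding ip_def by (simp add: left_diff_distrib int)
  have ip_smult: "ip (smult a p) r = a * ip p r" for a p r
    unfolding ip_def by (simp add: mult.assoc)
  have ip_sum: "ip (\<Sum>i\<in>A. f i) r = (\<Sum>i\<in>A. ip (f i) r)" for A and f :: "nat \<Rightarrow> real poly" and r
    unfolding ip_def by (simp add: poly_sum sum_distrib_right int)
  \<comment> \<open>The Nikolskii inequality also yields definiteness of the inner product: a
    polynomial of norm zero vanishes on [-1,1].\<close>
  have pos: "ip p p > 0" if "p \<noteq> 0" for p
  proof (rule ccontr)
    assume "\<not> ip p p > 0"
    moreover have "ip p p \<ge> 0" by (simp add: ip_def)
    ultimately have "ip p p = 0" by simp
    then have "(LINT t|B. (poly p t)\<^sup>2) = 0" by (simp add: ip_def power2_eq_square)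
    then have "poly p y = 0" if "y \<in> {-1..1}" for y
      using nikolskii[of p "Suc (degree p)" y] that by simp
    then show False using poly_eq_0_on_interval[of p] \<open>p \<noteq> 0\<close> by blast
  qed
  have P_deg: "degree (P k) = k" and P_ne: "P k \<noteq> 0" for k
    using gram_schmidt_degree[of ip k] by (auto simp: P_def)
  have P_rec: "P k = monom 1 k - (\<Sum>i<k. smult (c k i) (P i))" for k
    unfolding P_def c_def by (rule gram_schmidt.simps)
  have orth: "ip (P k) (P j) = 0" if "j < k" for j k
    using that
  proof (induction k arbitrary: j rule: less_induct)
    case (less k)
    have "ip (P k) (P j) = ip (monom 1 k) (P j) - (\<Sum>i<k. c k i * ip (P i) (P j))"
      by (subst P_rec) (simp add: ip_diff ip_sum ip_smult)
    also have "(\<Sum>i<k. c k i * ip (P i) (P j)) = (\<Sum>i<k. if i = j then c k j * ip (P j) (P j) else 0)"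
    proof (intro sum.cong refl)
      fix i assume "i \<in> {..<k}"
      then show "c k i * ip (P i) (P j) = (if i = j then c k j * ip (P j) (P j) else 0)"
        using less.IH[of i j] less.IH[of j i] less.prems ip_comm[of "P i" "P j"] by (cases i j rule: linorder_cases) auto
    qed
    also have "\<dots> = c k j * ip (P j) (P j)" using less.prems by simp
    also have "\<dots> = ip (monom 1 k) (P j)" using pos[OF P_ne[of j]] by (simp add: c_def)
    finally show ?case by simp
  qed
  have orthonormal: "(LINT t|B. L j t * L k t) = (if j = k then 1 else 0)" for j k
  proof -
    have "(LINT t|B. L j t * L k t) = ip (P j) (P k) / (sqrt (ip (P j) (P j)) * sqrt (ip (P k) (P k)))"
      by (simp add: L_def ip_def)
    then show ?thesis
      using orth[of j k] orth[of k j] ip_comm[of "P j" "P k"] pos[OF P_ne[of j]]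
      by (cases j k rule: linorder_cases) auto
  qed
  have "christoffel_system B L s"
  proof (unfold_locales; (fact B(2) B(3) s orthonormal)?)
    show "L 0 t = 1" for t
    proof -
      have "P 0 = 1" by (subst P_rec) simp
      then show ?thesis by (simp add: L_def ip_def prob_space)
    qed
    show "L k \<in> borel_measurable B" for k unfolding L_def using meas by simp
    show "(\<Sum>k<n. (L k t)\<^sup>2) \<le> real n powr s" if t: "t \<in> {-1..1}" for t n
    proof (cases "n = 0")
      case False
      define K where "K = (\<Sum>k<n. (L k t)\<^sup>2)"
      \<comment> \<open>The reproducing kernel with one argument fixed at \<open>t\<close>. Its
        value at \<open>t\<close> and its squared norm are both K, so the inequality reads K^2 \<le>
        n^s K.\<close>
      define p where "p = (\<Sum>k<n. smult (L k t / sqrt (ip (P k) (P k))) (P k))"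
      have pL: "poly p x = (\<Sum>k<n. L k t * L k x)" for x
        by (simp add: p_def L_def poly_sum)
      have "degree p \<le> n - 1" unfolding p_def
        by (rule degree_sum_le) (auto simp: P_deg intro: order_trans[OF degree_smult_le])
      then have "(poly p t)\<^sup>2 \<le> real n powr s * (LINT x|B. (poly p x)\<^sup>2)"
        using False t by (intro nikolskii) auto
      also have "poly p t = K" unfolding pL K_def by (simp add: power2_eq_square)
      also have "(LINT x|B. (poly p x)\<^sup>2) = K"
      proof -
        have iL: "integrable B (\<lambda>x. L i x * L j x)" for i j
          using int[of "P i" "P j"] by (simp add: L_def)
        have "(LINT x|B. (poly p x)\<^sup>2) = (LINT x|B. (\<Sum>i<n. \<Sum>j<n. L i t * L j t * (L i x * L j x)))"
          by (simp add: pL power2_eq_square sum_product mult_ac)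
        also have "\<dots> = (\<Sum>i<n. \<Sum>j<n. L i t * L j t * (LINT x|B. L i x * L j x))"
          using iL by simp
        also have "\<dots> = (\<Sum>i<n. \<Sum>j<n. if i = j then L i t * L i t else 0)"
          by (intro sum.cong refl) (simp add: orthonormal)
        also have "\<dots> = K" by (simp add: K_def power2_eq_square)
        finally show ?thesis .
      qed
      finally have "K * K \<le> real n powr s * K" by (simp add: power2_eq_square)
      moreover have "K \<ge> 0" by (simp add: K_def sum_nonneg)
      ultimately have "K \<le> real n powr s" by (cases "K = 0") auto
      then show ?thesis by (simp add: K_def)
    qed simp
    show "\<exists>b. \<forall>t\<in>{-1..1}. t ^ k = (\<Sum>i\<le>k. b i * L i t)" for k
    proof -
      define b where "b = (\<lambda>i. (if i = k then 1 else c k i) * sqrt (ip (P i) (P i)))"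
      have "t ^ k = (\<Sum>i\<le>k. b i * L i t)" for t
      proof -
        have "poly (monom 1 k) t = poly (P k + (\<Sum>i<k. smult (c k i) (P i))) t"
          using P_rec[of k] by simp
        then have "t ^ k = poly (P k) t + (\<Sum>i<k. c k i * poly (P i) t)"
          by (simp add: poly_monom poly_sum)
        also have "(\<Sum>i<k. c k i * poly (P i) t) = (\<Sum>i<k. b i * L i t)"
          using pos[OF P_ne] by (intro sum.cong refl) (auto simp: b_def L_def less_imp_neq[symmetric])
        also have "poly (P k) t = b k * L k t" using pos[OF P_ne[of k]] by (simp add: b_def L_def)
        finally show ?thesis by (simp add: lessThan_Suc_atMost[symmetric])
      qed
      then show ?thesis by blast
    qed
  qed
  then show ?thesis by blast
qed

section \<open>Jacobi measures with natural exponents\<close>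

lemma space_jacobi_measure: "space (jacobi_measure \<theta>1 \<theta>2) = {-1..1}"
  by (simp add: jacobi_measure_def space_restrict_space)

lemma sets_jacobi_measure: "sets (jacobi_measure \<theta>1 \<theta>2) = sets (restrict_space borel {-1..1})"
  by (simp add: jacobi_measure_def sets_restrict_space)

lemma borel_measurable_jacobi: "f \<in> borel_measurable borel \<Longrightarrow> f \<in> borel_measurable (jacobi_measure \<theta>1 \<theta>2)"
  unfolding measurable_cong_sets[OF sets_jacobi_measure refl] by (rule measurable_restrict_space1)

lemma jacobi_weight_measurable: "jacobi_weight \<theta>1 \<theta>2 \<in> borel_measurable borel"
  unfolding jacobi_weight_def by measurable

lemma jacobi_weight_nonneg: "jacobi_weight \<theta>1 \<theta>2 t \<ge> 0"
  by (simp add: jacobi_weight_def)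

lemma
  fixes \<theta>1 \<theta>2 :: real
  defines "w \<equiv> jacobi_weight \<theta>1 \<theta>2"
  defines "Z \<equiv> (LINT x:{-1..1}|lborel. w x)"
  assumes int: "set_integrable lborel {-1..1} w" and Z: "Z > 0"
  shows prob_space_jacobi: "prob_space (jacobi_measure \<theta>1 \<theta>2)"
    and integral_jacobi: "f \<in> borel_measurable borel \<Longrightarrow>
      integral\<^sup>L (jacobi_measure \<theta>1 \<theta>2) f = (LINT t:{-1..1}|lborel. w t * f t) / Z"
proof -
  let ?R = "restrict_space lborel {-1..1::real}"
  have J: "jacobi_measure \<theta>1 \<theta>2 = density ?R (\<lambda>t. ennreal (w t / Z))"
    by (simp add: jacobi_measure_def w_def Z_def)
  have mw: "w \<in> borel_measurable ?R"
    unfolding w_def using jacobi_weight_measurable by (intro measurable_restrict_space1) simp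
  then have m: "(\<lambda>t. w t / Z) \<in> borel_measurable ?R" by simp
  have nn: "w t / Z \<ge> 0" for t using Z by (simp add: w_def jacobi_weight_nonneg)
  have iR: "integrable ?R w"
    using int by (simp add: integrable_restrict_space set_integrable_def)
  have Z': "integral\<^sup>L ?R w = Z"
    by (simp add: Z_def integral_restrict_space set_lebesgue_integral_def)
  show "prob_space (jacobi_measure \<theta>1 \<theta>2)"
  proof
    have "emeasure (jacobi_measure \<theta>1 \<theta>2) (space (jacobi_measure \<theta>1 \<theta>2)) = (\<integral>\<^sup>+ t. ennreal (w t / Z) * indicator (space ?R) t \<partial>?R)"
      unfolding J space_density by (rule emeasure_density[OF _ sets.top]) (use m in measurable)
    also have "\<dots> = (\<integral>\<^sup>+ t. ennreal (w t / Z) \<partial>?R)" by (intro nn_integral_cong) simp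
    also have "\<dots> = ennreal (integral\<^sup>L ?R (\<lambda>t. w t / Z))"
      using iR nn by (intro nn_integral_eq_integral) auto
    also have "\<dots> = 1" using Z Z' by simp
    finally show "emeasure (jacobi_measure \<theta>1 \<theta>2) (space (jacobi_measure \<theta>1 \<theta>2)) = 1" .
  qed
  assume f: "f \<in> borel_measurable borel"
  then have "f \<in> borel_measurable ?R" by (intro measurable_restrict_space1) simp
  then have "integral\<^sup>L (jacobi_measure \<theta>1 \<theta>2) f = integral\<^sup>L ?R (\<lambda>t. (w t / Z) *\<^sub>R f t)"
    unfolding J using m nn by (intro integral_density) auto
  also have "\<dots> = integral\<^sup>L ?R (\<lambda>t. w t * f t) / Z" by (simp add: field_simps)
  also have "integral\<^sup>L ?R (\<lambda>t. w t * f t) = (LINT t:{-1..1}|lborel. w t * f t)"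
    by (simp add: integral_restrict_space set_lebesgue_integral_def)
  finally show "integral\<^sup>L (jacobi_measure \<theta>1 \<theta>2) f = (LINT t:{-1..1}|lborel. w t * f t) / Z" .
qed

lemma christoffel_system_jacobi_nat:
  fixes a b :: nat
  shows "\<exists>L. christoffel_system (jacobi_measure (real a) (real b)) L (2 * real (max a b) + 2)"
proof -
  define w where "w = jacobi_weight (real a) (real b)"
  define v where "v = (\<lambda>t :: real. (1 - t) ^ a * (1 + t) ^ b)"
  define Z where "Z = integral {-1..1} v"
  have v: "continuous_on S v" for S unfolding v_def by (intro continuous_intros)
  have vm: "v \<in> borel_measurable borel" using v by (rule borel_measurable_continuous_onI)
  have wm: "w \<in> borel_measurable borel" unfolding w_def by (rule jacobi_weight_measurable)
  \<comment> \<open>The two weights can differ at the endpoints: \<open>0 powr 0\<close> is 0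
    whereas \<open>0 ^ 0\<close> is 1. Two points are a null set.\<close>
  have ae: "AE t in lborel. t \<in> {-1..1} \<longrightarrow> w t = v t"
  proof -
    have "AE t in lborel. t \<notin> {-1, 1 :: real}"
      by (intro AE_not_in finite_imp_null_set_lborel) auto
    then show ?thesis
      by eventually_elim (auto simp: w_def v_def jacobi_weight_def powr_realpow)
  qed
  have si_cont: "set_integrable lborel {-1..1} f" if "continuous_on {-1..1} f" for f :: "real \<Rightarrow> real"
    using borel_integrable_atLeastAtMost'[OF that] .
  have weight: "(LINT t:{-1..1}|lborel. w t * f t) = integral {-1..1} (\<lambda>t. v t * f t)" if f: "continuous_on UNIV f" for f
  proof -
    have fm: "f \<in> borel_measurable borel" using f by (rule borel_measurable_continuous_onI)
    have "(LINT t:{-1..1}|lborel. w t * f t) = (LINT t:{-1..1}|lborel. v t * f t)"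
      unfolding set_lebesgue_integral_def
    proof (rule integral_cong_AE)
      show "AE t in lborel. indicat_real {-1..1} t *\<^sub>R (w t * f t) = indicat_real {-1..1} t *\<^sub>R (v t * f t)"
        using ae by eventually_elim (auto simp: indicator_def)
    qed (use fm vm wm in measurable)
    also have "\<dots> = integral {-1..1} (\<lambda>t. v t * f t)"
      using f by (intro set_borel_integral_eq_integral si_cont continuous_intros v) (auto intro: continuous_on_subset)
    finally show ?thesis .
  qed
  have ws: "set_integrable lborel {-1..1} w"
  proof -
    have "integrable lborel (\<lambda>t. indicat_real {-1..1} t *\<^sub>R v t)"
      using si_cont[OF v] by (simp add: set_integrable_def)
    moreover have "AE t in lborel. indicat_real {-1..1} t *\<^sub>R v t = indicat_real {-1..1} t *\<^sub>R w t"
      using ae by eventually_elim (auto simp: indicator_def)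
    ultimately show ?thesis unfolding set_integrable_def
      by (subst integrable_cong_AE[of _ _ "\<lambda>t. indicat_real {-1..1} t *\<^sub>R v t"]) (use vm wm in auto)
  qed
  have vnn: "v t \<ge> 0" if "t \<in> {-1..1}" for t using that by (auto simp: v_def)
  \<comment> \<open>A continuous nonnegative function with integral 0 would vanish, but
    \<open>v 0\<close> is 1.\<close>
  have "Z \<noteq> 0"
  proof
    assume "Z = 0"
    then have "(v has_integral 0) (cbox (-1) 1)"
      using integrable_integral[OF integrable_continuous_interval[OF v, of "-1" 1]] by (simp add: Z_def)
    then have "v 0 = 0"
      by (rule has_integral_0_cbox_imp_0[rotated 2]) (use v vnn in auto)
    then show False by (simp add: v_def)
  qed
  moreover have "Z \<ge> 0" unfolding Z_def using vnn by (intro integral_nonneg integrable_continuous_interval v)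
  ultimately have Z: "Z > 0" by simp
  have wZ: "(LINT t:{-1..1}|lborel. w t) = Z" using weight[of "\<lambda>_. 1"] by (simp add: Z_def)
  let ?J = "jacobi_measure (real a) (real b)"
  show ?thesis
  proof (rule christoffel_system_gram_schmidt)
    show "prob_space (?J)"
      by (rule prob_space_jacobi) (use ws wZ Z in \<open>simp_all add: w_def\<close>)
    show "space (?J) = {-1..1}" by (rule space_jacobi_measure)
    show "(\<lambda>t. t) \<in> borel_measurable (?J)" by (rule borel_measurable_jacobi) simp
    fix p :: "real poly" and n y assume p: "degree p < n" and y: "y \<in> {-1..1::real}"
    have c: "continuous_on UNIV (\<lambda>t. (poly p t)\<^sup>2)" by (intro continuous_intros)
    have "(LINT t|?J. (poly p t)\<^sup>2) = (LINT t:{-1..1}|lborel. w t * (poly p t)\<^sup>2) / Z"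
      unfolding wZ[symmetric] unfolding w_def
      by (rule integral_jacobi) (use ws wZ Z borel_measurable_continuous_onI[OF c] in \<open>simp_all add: w_def\<close>)
    also have "\<dots> = integral {-1..1} (\<lambda>t. (poly p t)\<^sup>2 * v t) / Z" unfolding weight[OF c] by (simp add: mult.commute)
    finally have I: "(LINT t|?J. (poly p t)\<^sup>2) = integral {-1..1} (\<lambda>t. (poly p t)\<^sup>2 * v t) / Z" .
    have "real n powr (2 * real (max a b) + 2) = real n powr (real (2 * max a b + 2))" by (simp add: add.commute)
    also have "\<dots> = real n ^ (2 * max a b + 2)" using p by (intro powr_realpow) auto
    finally have e: "real n powr (2 * real (max a b) + 2) = real n ^ (2 * max a b + 2)" .
    have "(poly p y)\<^sup>2 * Z \<le> real n ^ (2 * max a b + 2) * integral {-1..1} (\<lambda>t. (poly p t)\<^sup>2 * v t)"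
      unfolding Z_def v_def using p y by (rule poly_square_le_weighted_integral) auto
    then show "(poly p y)\<^sup>2 \<le> real n powr (2 * real (max a b) + 2) * (LINT t|?J. (poly p t)\<^sup>2)"
      unfolding I e using Z by (simp add: pos_le_divide_eq)
  qed simp
qed

text \<open>The clamping makes the function continuous on the whole line;
  \<^const>\<open>arccos\<close> is unspecified outside $[-1,1]$.\<close>

definition cheb :: "nat \<Rightarrow> real \<Rightarrow> real" where
  "cheb k t = cos (real k * arccos (max (-1) (min 1 t)))"

section \<open>Chebyshev polynomials of the first kind\<close>

lemma continuous_on_cheb: "continuous_on S (cheb k)"
  unfolding cheb_def
  by (intro continuous_intros continuous_on_arccos') auto

lemma cheb_le_1: "\<bar>cheb k t\<bar> \<le> 1"
  by (simp add: cheb_def)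

lemma cheb_0 [simp]: "cheb 0 t = 1"
  by (simp add: cheb_def)

lemma cheb_1: "t \<in> {-1..1} \<Longrightarrow> cheb (Suc 0) t = t"
  by (simp add: cheb_def)

lemma cheb_mult: "k \<le> j \<Longrightarrow> cheb j t * cheb k t = (cheb (j - k) t + cheb (j + k) t) / 2"
  unfolding cheb_def cos_times_cos by (simp add: of_nat_diff algebra_simps)

text \<open>The weight is singular at both endpoints. The primitives - arccos t and - sin (k arccos
  t)/k are continuous on the closed interval and differentiable inside it, which suffices for the
  gauge integral; nonnegativity turns the first one into Lebesgue integrability.\<close>

lemma set_integrable_chebyshev_weight: "set_integrable lborel {-1..1} (jacobi_weight (-1/2) (-1/2))"
  and integral_chebyshev_weight: "(LINT t:{-1..1}|lborel. jacobi_weight (-1/2) (-1/2) t * cheb k t) = (if k = 0 then pi else 0)"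
proof -
  define w where "w = jacobi_weight (-1/2) (-1/2)"
  have wm: "w \<in> borel_measurable borel" unfolding w_def by (rule jacobi_weight_measurable)
  have w: "w t = inverse (sqrt (1 - t\<^sup>2))" if "t \<in> {-1<..<1}" for t
  proof -
    have "w t = ((1 - t) * (1 + t)) powr (-1/2)"
      using that by (simp add: w_def jacobi_weight_def powr_mult)
    also have "(1 - t) * (1 + t) = 1 - t\<^sup>2" by (simp add: algebra_simps power2_eq_square)
    also have "(1 - t\<^sup>2) powr (-1/2) = inverse ((1 - t\<^sup>2) powr (1/2))" by (simp add: powr_minus)
    also have "(1 - t\<^sup>2) powr (1/2) = sqrt (1 - t\<^sup>2)"
      using that by (intro powr_half_sqrt) (auto simp: abs_square_le_1)
    finally show ?thesis .
  qed
  have I0: "(w has_integral pi) {-1..1}"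
  proof -
    have "(w has_integral (- arccos 1) - (- arccos (-1))) {-1..1}"
    proof (rule fundamental_theorem_of_calculus_interior)
      show "continuous_on {-1..1} (\<lambda>t. - arccos t)" by (intro continuous_intros continuous_on_arccos') auto
      fix t :: real assume t: "t \<in> {-1<..<1}"
      have "((\<lambda>t. - arccos t) has_real_derivative w t) (at t)"
        using t by (auto intro!: derivative_eq_intros simp: w)
      then show "((\<lambda>t. - arccos t) has_vector_derivative w t) (at t)"
        by (simp add: has_real_derivative_iff_has_vector_derivative)
    qed simp
    then show ?thesis by simp
  qed
  have "((\<lambda>t. if t \<in> {-1..1} then w t else 0) has_integral pi) UNIV"
    using I0 by (subst has_integral_restrict_UNIV)
  moreover have m: "(\<lambda>t. if t \<in> {-1..1} then w t else 0) \<in> borel_measurable borel"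
    using wm by measurable
  moreover have nn: "0 \<le> (if t \<in> {-1..1} then w t else 0)" for t by (simp add: w_def jacobi_weight_nonneg)
  ultimately have "integral\<^sup>N lborel (\<lambda>t. ennreal (if t \<in> {-1..1} then w t else 0)) = ennreal pi"
    by (intro nn_integral_has_integral_lborel)
  then have "integrable lborel (\<lambda>t. if t \<in> {-1..1} then w t else 0)"
    using m nn by (intro integrableI_nn_integral_finite[where x = pi]) auto
  moreover have "(\<lambda>t. if t \<in> {-1..1} then w t else 0) = (\<lambda>t. indicat_real {-1..1} t *\<^sub>R w t)" by auto
  ultimately show si: "set_integrable lborel {-1..1} (jacobi_weight (-1/2) (-1/2))"
    unfolding set_integrable_def w_def by simp
  have "set_integrable lborel {-1..1} (\<lambda>t. w t * cheb k t)"
  proof (rule set_integrable_bound[OF si])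
    show "set_borel_measurable lborel {-1..1} (\<lambda>t. w t * cheb k t)"
      unfolding set_borel_measurable_def
      using wm borel_measurable_continuous_onI[OF continuous_on_cheb[of UNIV k]] by measurable
    have "norm (w t * cheb k t) \<le> norm (w t)" for t
      using mult_left_mono[OF cheb_le_1[of k t], of "\<bar>w t\<bar>"] by (simp add: abs_mult)
    then show "AE t in lborel. t \<in> {-1..1} \<longrightarrow> norm (w t * cheb k t) \<le> norm (jacobi_weight (-1/2) (-1/2) t)"
      by (intro AE_I2) (simp add: w_def)
  qed
  then have "(LINT t:{-1..1}|lborel. w t * cheb k t) = integral {-1..1} (\<lambda>t. w t * cheb k t)"
    by (rule set_borel_integral_eq_integral)
  also have "\<dots> = (if k = 0 then pi else 0)"
  proof (cases "k = 0")
    case True then show ?thesis using I0 by (simp add: integral_unique)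
  next
    case False
    have "((\<lambda>t. w t * cheb k t) has_integral
      (- sin (real k * arccos 1) / real k) - (- sin (real k * arccos (-1)) / real k)) {-1..1}"
    proof (rule fundamental_theorem_of_calculus_interior)
      show "continuous_on {-1..1} (\<lambda>t. - sin (real k * arccos t) / real k)"
        using False by (intro continuous_intros continuous_on_arccos') auto
      fix t :: real assume t: "t \<in> {-1<..<1}"
      have "((\<lambda>t. - sin (real k * arccos t) / real k) has_real_derivative w t * cheb k t) (at t)"
        using t False by (auto intro!: derivative_eq_intros simp: w cheb_def field_simps)
      then show "((\<lambda>t. - sin (real k * arccos t) / real k) has_vector_derivative w t * cheb k t) (at t)"
        by (simp add: has_real_derivative_iff_has_vector_derivative)
    qed simp
    then show ?thesis using False by (simp add: integral_unique)
  qed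
  finally show "(LINT t:{-1..1}|lborel. jacobi_weight (-1/2) (-1/2) t * cheb k t) = (if k = 0 then pi else 0)"
    by (simp add: w_def)
qed

lemma cheb_power_expansion: "\<exists>b. \<forall>t\<in>{-1..1}. t ^ k = (\<Sum>i\<le>k. b i * cheb i t)"
proof (induction k)
  case 0 then show ?case by (intro exI[of _ "\<lambda>_. 1"]) simp
next
  case (Suc k)
  then obtain b where b: "\<And>t. t \<in> {-1..1} \<Longrightarrow> t ^ k = (\<Sum>i\<le>k. b i * cheb i t)" by blast
  \<comment> \<open>Matrix of multiplication by t in the Chebyshev basis: t maps T_0 to T_1 and T_i
    to the mean of its two neighbours.\<close>
  define c where "c = (\<lambda>i j :: nat. if i = 0 then (if j = 1 then 1 else 0)
    else ((if j = i - 1 then 1 else 0) + (if j = i + 1 then 1 else 0)) / (2 :: real))"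
  have c: "t * cheb i t = (\<Sum>j\<le>Suc k. c i j * cheb j t)" if t: "t \<in> {-1..1}" and i: "i \<le> k" for t i
  proof (cases "i = 0")
    case True
    then have "(\<Sum>j\<le>Suc k. c i j * cheb j t) = (\<Sum>j\<le>Suc k. if j = 1 then cheb 1 t else 0)"
      by (intro sum.cong) (auto simp: c_def)
    then show ?thesis using True t by (simp add: cheb_1 del: sum.atMost_Suc)
  next
    case False
    have "(\<Sum>j\<le>Suc k. c i j * cheb j t)
        = (\<Sum>j\<le>Suc k. (if j = i - 1 then cheb (i - 1) t / 2 else 0) + (if j = i + 1 then cheb (i + 1) t / 2 else 0))"
      using False by (intro sum.cong) (auto simp: c_def)
    also have "\<dots> = cheb (i - 1) t / 2 + cheb (i + 1) t / 2"
      using i False by (simp add: sum.distrib del: sum.atMost_Suc)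
    also have "\<dots> = cheb i t * cheb 1 t" using False cheb_mult[of 1 i t] by simp
    finally show ?thesis using t by (simp add: cheb_1 mult.commute)
  qed
  have "t ^ Suc k = (\<Sum>j\<le>Suc k. (\<Sum>i\<le>k. b i * c i j) * cheb j t)" if t: "t \<in> {-1..1}" for t
  proof -
    have "t ^ Suc k = (\<Sum>i\<le>k. b i * (t * cheb i t))" using b[OF t] by (simp add: sum_distrib_left mult_ac)
    also have "\<dots> = (\<Sum>i\<le>k. \<Sum>j\<le>Suc k. b i * c i j * cheb j t)"
      using c[OF t] by (simp add: sum_distrib_left mult_ac del: sum.atMost_Suc)
    also have "\<dots> = (\<Sum>j\<le>Suc k. (\<Sum>i\<le>k. b i * c i j) * cheb j t)"
      by (subst sum.swap) (simp add: sum_distrib_right del: sum.atMost_Suc)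
    finally show ?thesis .
  qed
  then show ?case by (intro exI[of _ "\<lambda>j. \<Sum>i\<le>k. b i * c i j"]) blast
qed

text \<open>The normalised functions satisfy e_0^2 = 1 and e_k^2 = 2, so the sum of squares is at
  most 2n - 1. The exponent ln 3 / ln 2 gives 2^s = 3, that is equality at n = 2; convexity makes
  every later increment of n^s at least 3 - 1 = 2.\<close>

lemma christoffel_system_chebyshev:
  "\<exists>L. christoffel_system (jacobi_measure (-1/2) (-1/2)) L (ln 3 / ln 2)"
proof -
  define \<beta> where "\<beta> = jacobi_measure (-1/2) (-1/2)"
  define s :: real where "s = ln 3 / ln 2"
  define e where "e = (\<lambda>k :: nat. if k = 0 then 1 else sqrt 2)"
  define L where "L = (\<lambda>k t. e k * cheb k t)"
  have Z: "(LINT t:{-1..1}|lborel. jacobi_weight (-1/2) (-1/2) t) = pi"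
    using integral_chebyshev_weight[of 0] by simp
  interpret B: prob_space \<beta> unfolding \<beta>_def
    by (rule prob_space_jacobi) (simp_all only: set_integrable_chebyshev_weight Z pi_gt_zero)
  have cm: "cheb k \<in> borel_measurable borel" for k
    by (rule borel_measurable_continuous_onI[OF continuous_on_cheb])
  have cB: "cheb k \<in> borel_measurable \<beta>" for k unfolding \<beta>_def by (rule borel_measurable_jacobi[OF cm])
  have ci: "integrable \<beta> (cheb k)" for k
    by (rule B.integrable_const_bound[where B = 1]) (use cB cheb_le_1 in auto)
  have int: "integral\<^sup>L \<beta> (cheb k) = (if k = 0 then 1 else 0)" for k
  proof -
    have "integral\<^sup>L \<beta> (cheb k) = (LINT t:{-1..1}|lborel. jacobi_weight (-1/2) (-1/2) t * cheb k t) / pi"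
      unfolding \<beta>_def Z[symmetric]
      by (rule integral_jacobi) (simp_all only: set_integrable_chebyshev_weight Z pi_gt_zero cm)
    then show ?thesis unfolding integral_chebyshev_weight by simp
  qed
  have orth: "(LINT t|\<beta>. L j t * L k t) = (if j = k then 1 else 0)" if "k \<le> j" for j k
  proof -
    have "L j t * L k t = e j * e k * ((cheb (j - k) t + cheb (j + k) t) / 2)" for t
      unfolding cheb_mult[OF that, symmetric] by (simp add: L_def)
    then have "(LINT t|\<beta>. L j t * L k t) = (LINT t|\<beta>. e j * e k * ((cheb (j - k) t + cheb (j + k) t) / 2))"
      by presburger
    also have "\<dots> = e j * e k * ((integral\<^sup>L \<beta> (cheb (j - k)) + integral\<^sup>L \<beta> (cheb (j + k))) / 2)"
      using ci by simp
    finally have "(LINT t|\<beta>. L j t * L k t) = e j * e k * (((if j - k = 0 then 1 else 0) + (if j + k = 0 then 1 else 0)) / 2)"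
      unfolding int .
    then show ?thesis using that by (cases "k = 0"; cases "j = k") (simp_all add: e_def)
  qed
  have two: "(2::real) powr s = 3" by (simp add: s_def powr_def)
  have s: "s \<ge> 1" by (simp add: s_def)
  have bound: "(\<Sum>k<n. (e k)\<^sup>2) \<le> real n powr s" for n
  proof (induction n)
    case (Suc n)
    have "real n powr s + (e n)\<^sup>2 \<le> real (Suc n) powr s"
    proof (cases "n = 0")
      case True then show ?thesis by (simp add: e_def)
    next
      case False
      then have "(1 + 1) powr s - 1 powr s \<le> (real n + 1) powr s - real n powr s"
        using s by (intro powr_increment_mono) auto
      then show ?thesis using False two by (simp add: e_def add.commute)
    qed
    then show ?case using Suc by simp
  qed simp
  have "christoffel_system \<beta> L s"
  proof (unfold_locales; (fact s)?)
    show "space \<beta> = {-1..1}" by (simp add: \<beta>_def space_jacobi_measure)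
    show "(\<lambda>t. t) \<in> borel_measurable \<beta>" unfolding \<beta>_def by (rule borel_measurable_jacobi) simp
    show "L 0 t = 1" for t by (simp add: L_def e_def)
    show "L k \<in> borel_measurable \<beta>" for k unfolding L_def using cB by simp
    show "(LINT t|\<beta>. L j t * L k t) = (if j = k then 1 else 0)" for j k
      using orth[of k j] orth[of j k] by (cases "k \<le> j") (auto simp: mult.commute)
    show "(\<Sum>k<n. (L k t)\<^sup>2) \<le> real n powr s" for t n
    proof -
      have "(L k t)\<^sup>2 \<le> (e k)\<^sup>2" for k
      proof -
        have "(cheb k t)\<^sup>2 \<le> 1" using cheb_le_1[of k t] by (simp add: abs_square_le_1)
        then show ?thesis unfolding L_def power_mult_distrib by (intro mult_left_le) auto
      qed
      then have "(\<Sum>k<n. (L k t)\<^sup>2) \<le> (\<Sum>k<n. (e k)\<^sup>2)" by (intro sum_mono)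
      then show ?thesis using bound[of n] by simp
    qed
    show "\<exists>b. \<forall>t\<in>{-1..1}. t ^ k = (\<Sum>i\<le>k. b i * L i t)" for k
    proof -
      obtain b where b: "\<forall>t\<in>{-1..1}. t ^ k = (\<Sum>i\<le>k. b i * cheb i t)" using cheb_power_expansion by blast
      have "b i * cheb i t = (b i / e i) * L i t" for i t by (simp add: L_def e_def)
      then show ?thesis using b by (intro exI[of _ "\<lambda>i. b i / e i"]) simp
    qed
  qed
  then show ?thesis unfolding \<beta>_def s_def by blast
qed

section \<open>Tensorisation\<close>

lemma multi_indicesD: "\<nu> \<in> multi_indices d \<Longrightarrow> finite {j. \<nu> j \<noteq> 0}" "\<nu> \<in> multi_indices d \<Longrightarrow> {j. \<nu> j \<noteq> 0} \<subseteq> coords d"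
  by (auto simp: multi_indices_def)

context christoffel_system begin

abbreviation cube :: "enat \<Rightarrow> (nat \<Rightarrow> real) measure" where "cube d \<equiv> PiM (coords d) (\<lambda>_. B)"

text \<open>Restricting the product to the support keeps it finite in infinite dimension; the
  omitted factors are \<open>L 0\<close>, which is 1 on the cube.\<close>

definition tensor :: "(nat \<Rightarrow> nat) \<Rightarrow> (nat \<Rightarrow> real) \<Rightarrow> real" where
  "tensor \<nu> y = (\<Prod>j | \<nu> j \<noteq> 0. L (\<nu> j) (y j))"

lemma prob_space_cube: "prob_space (cube d)"
  by (intro prob_space_PiM prob_space_axioms)

lemma cube_coord: "y \<in> space (cube d) \<Longrightarrow> j \<in> coords d \<Longrightarrow> y j \<in> {-1..1}"
  by (auto simp: space_PiM space_B[symmetric])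

lemma tensor_eq_prod:
  assumes "finite J" "{j. \<nu> j \<noteq> 0} \<subseteq> J" "J \<subseteq> coords d" "y \<in> space (cube d)"
  shows "tensor \<nu> y = (\<Prod>j\<in>J. L (\<nu> j) (y j))"
  unfolding tensor_def
proof (rule prod.mono_neutral_left)
  show "\<forall>j\<in>J - {j. \<nu> j \<noteq> 0}. L (\<nu> j) (y j) = 1"
    using cube_coord[OF assms(4)] assms(3) by (auto intro!: L_0)
qed (use assms in auto)

lemma component_measurable: "f \<in> borel_measurable B \<Longrightarrow> j \<in> coords d \<Longrightarrow> (\<lambda>y. f (y j)) \<in> borel_measurable (cube d)"
  by (rule measurable_compose[OF measurable_component_singleton])

lemma tensor_measurable: "\<nu> \<in> multi_indices d \<Longrightarrow> tensor \<nu> \<in> borel_measurable (cube d)"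
  unfolding tensor_def[abs_def] using multi_indicesD[of \<nu> d]
  by (intro borel_measurable_prod component_measurable L_measurable) auto

lemma L_sq_le: "t \<in> {-1..1} \<Longrightarrow> (L k t)\<^sup>2 \<le> real (Suc k) powr s"
  using christoffel[of t "Suc k"] sum_nonneg[of "{..<k}" "\<lambda>k. (L k t)\<^sup>2"] by simp

lemma integrable_L_mult: "integrable B (\<lambda>t. L i t * L j t)"
proof (rule integrable_const_bound)
  show "AE t in B. norm (L i t * L j t) \<le> real (Suc i) powr s + real (Suc j) powr s"
  proof (rule AE_I2)
    fix t assume "t \<in> space B"
    then have t: "t \<in> {-1..1}" by (simp add: space_B)
    have "2 * \<bar>L i t\<bar> * \<bar>L j t\<bar> \<le> (L i t)\<^sup>2 + (L j t)\<^sup>2"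
      using sum_squares_bound[of "\<bar>L i t\<bar>" "\<bar>L j t\<bar>"] by simp
    moreover have "0 \<le> \<bar>L i t\<bar> * \<bar>L j t\<bar>" by simp
    ultimately show "norm (L i t * L j t) \<le> real (Suc i) powr s + real (Suc j) powr s"
      using L_sq_le[OF t, of i] L_sq_le[OF t, of j] unfolding real_norm_def abs_mult by linarith
  qed
qed (use L_measurable in measurable)

text \<open>Only finitely many coordinates occur: the infinite product is pushed forward to them by
  restriction, and there finite Fubini applies.\<close>

lemma integral_cube_prod:
  fixes f :: "nat \<Rightarrow> real \<Rightarrow> real"
  assumes J: "finite J" "J \<subseteq> coords d" and f: "\<And>j. j \<in> J \<Longrightarrow> integrable B (f j)"
  shows "(LINT y|cube d. (\<Prod>j\<in>J. f j (y j))) = (\<Prod>j\<in>J. integral\<^sup>L B (f j))"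
proof -
  interpret PP: product_prob_space "\<lambda>_. B" "coords d" by unfold_locales
  have m: "(\<lambda>y. restrict y J) \<in> measurable (cube d) (PiM J (\<lambda>_. B))"
    using J(2) by (rule measurable_restrict_subset)
  have fm: "(\<lambda>y. \<Prod>j\<in>J. f j (y j)) \<in> borel_measurable (PiM J (\<lambda>_. B))"
  proof (rule borel_measurable_prod)
    fix j assume j: "j \<in> J"
    show "(\<lambda>y. f j (y j)) \<in> borel_measurable (PiM J (\<lambda>_. B))"
      using measurable_component_singleton[OF j, of "\<lambda>_. B"] borel_measurable_integrable[OF f[OF j]]
      by (rule measurable_compose)
  qed
  have "distr (cube d) (PiM J (\<lambda>_. B)) (\<lambda>y. restrict y J) = PiM J (\<lambda>_. B)"
    by (rule PP.distr_PiM_restrict_finite[OF J])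
  then have "(LINT y|PiM J (\<lambda>_. B). (\<Prod>j\<in>J. f j (y j))) = (LINT y|cube d. (\<Prod>j\<in>J. f j (restrict y J j)))"
    using integral_distr[OF m fm] by simp
  also have "\<dots> = (LINT y|cube d. (\<Prod>j\<in>J. f j (y j)))"
    by (intro Bochner_Integration.integral_cong prod.cong) auto
  finally show ?thesis using PP.product_integral_prod[OF J(1), of f] f by simp
qed

lemma tensor_orthonormal:
  assumes "\<mu> \<in> multi_indices d" "\<nu> \<in> multi_indices d"
  shows "(LINT y|cube d. tensor \<mu> y * tensor \<nu> y) = (if \<mu> = \<nu> then 1 else 0)"
proof -
  define J where "J = {j. \<mu> j \<noteq> 0} \<union> {j. \<nu> j \<noteq> 0}"
  have J: "finite J" "J \<subseteq> coords d" using assms multi_indicesD by (auto simp: J_def)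
  have "(LINT y|cube d. tensor \<mu> y * tensor \<nu> y) = (LINT y|cube d. (\<Prod>j\<in>J. L (\<mu> j) (y j) * L (\<nu> j) (y j)))"
  proof (rule Bochner_Integration.integral_cong[OF refl])
    fix y assume y: "y \<in> space (cube d)"
    have "tensor \<mu> y = (\<Prod>j\<in>J. L (\<mu> j) (y j))" "tensor \<nu> y = (\<Prod>j\<in>J. L (\<nu> j) (y j))"
      by (rule tensor_eq_prod[OF J(1) _ J(2) y]; auto simp: J_def)+
    then show "tensor \<mu> y * tensor \<nu> y = (\<Prod>j\<in>J. L (\<mu> j) (y j) * L (\<nu> j) (y j))" by (simp add: prod.distrib)
  qed
  also have "\<dots> = (\<Prod>j\<in>J. if \<mu> j = \<nu> j then 1 else 0)"
    by (subst integral_cube_prod[OF J]) (auto simp: integrable_L_mult L_orthonormal)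
  also have "\<dots> = (if \<mu> = \<nu> then 1 else 0)"
  proof (cases "\<mu> = \<nu>")
    case False
    then obtain j where "\<mu> j \<noteq> \<nu> j" by blast
    then have "j \<in> J" "(if \<mu> j = \<nu> j then 1 else 0 :: real) = 0" by (auto simp: J_def)
    then have "(\<Prod>j\<in>J. if \<mu> j = \<nu> j then 1 else 0 :: real) = 0" using J(1) by (intro prod_zero) blast+
    then show ?thesis using False by simp
  qed simp
  finally show ?thesis .
qed

text \<open>The slicing bound is applied at a fixed point \<open>y\<close>, with the squares of the
  univariate functions at the coordinates of \<open>y\<close> as coefficients.\<close>

lemma sum_tensor_square_le:
  assumes \<Lambda>: "finite \<Lambda>" "downward_closed \<Lambda>" "\<Lambda> \<subseteq> multi_indices d" and y: "y \<in> space (cube d)"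
  shows "(\<Sum>\<nu>\<in>\<Lambda>. (tensor \<nu> y)\<^sup>2) \<le> real (card \<Lambda>) powr s"
proof -
  define J where "J = (\<Union>\<nu>\<in>\<Lambda>. {j. \<nu> j \<noteq> 0})"
  have "finite J" unfolding J_def
    by (rule finite_UN_I[OF \<Lambda>(1)], rule multi_indicesD(1)[of _ d]) (use \<Lambda>(3) in blast)
  moreover have "J \<subseteq> coords d" unfolding J_def
    by (rule UN_least, rule multi_indicesD(2)) (use \<Lambda>(3) in blast)
  ultimately have J: "finite J" "J \<subseteq> coords d" .
  have "(\<Sum>\<nu>\<in>\<Lambda>. (tensor \<nu> y)\<^sup>2) = (\<Sum>\<nu>\<in>\<Lambda>. \<Prod>j\<in>J. (L (\<nu> j) (y j))\<^sup>2)"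
  proof (rule sum.cong[OF refl])
    fix \<nu> assume "\<nu> \<in> \<Lambda>"
    then have "tensor \<nu> y = (\<Prod>j\<in>J. L (\<nu> j) (y j))"
      by (intro tensor_eq_prod[OF J(1) _ J(2) y]) (auto simp: J_def)
    then show "(tensor \<nu> y)\<^sup>2 = (\<Prod>j\<in>J. (L (\<nu> j) (y j))\<^sup>2)" by (simp add: prod_power_distrib)
  qed
  also have "\<dots> \<le> real (card \<Lambda>) powr s"
  proof (rule sum_prod_downward_closed_le[OF s_ge_1 J(1), where c = "\<lambda>j k. (L k (y j))\<^sup>2"])
    show "(\<Sum>k<n. (L k (y j))\<^sup>2) \<le> real n powr s" if "j \<in> J" for j n
      using cube_coord[OF y] that J(2) by (intro christoffel) auto
  qed (use \<Lambda> in \<open>auto simp: J_def\<close>)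
  finally show ?thesis .
qed

text \<open>Multiplying out the univariate expansions produces only tensors with index at most
  \<nu>, and these belong to \<Lambda> because it is downward closed.\<close>

lemma monomial_tensor_expansion:
  assumes \<nu>: "\<nu> \<in> multi_indices d" "\<nu> \<in> \<Lambda>" and \<Lambda>: "finite \<Lambda>" "downward_closed \<Lambda>"
  shows "\<exists>c. \<forall>y\<in>space (cube d). monomial \<nu> y = (\<Sum>\<mu>\<in>\<Lambda>. c \<mu> * tensor \<mu> y)"
proof -
  define S where "S = {j. \<nu> j \<noteq> 0}"
  have S: "finite S" "S \<subseteq> coords d" using multi_indicesD[OF \<nu>(1)] by (auto simp: S_def)
  have "\<forall>k. \<exists>b. \<forall>t\<in>{-1..1}. t ^ k = (\<Sum>i\<le>k. b i * L i t)" using power_expansion by blast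
  then obtain b where b: "\<And>k t. t \<in> {-1..1} \<Longrightarrow> t ^ k = (\<Sum>i\<le>k. b k i * L i t)" by metis
  define E where "E = PiE S (\<lambda>j. {..\<nu> j})"
  \<comment> \<open>Turns a choice of degrees on the support of \<nu> into a multi-index by padding
    with zeros.\<close>
  define ext where "ext = (\<lambda>g j. if j \<in> S then g j else (0::nat))"
  define a where "a = (\<lambda>g. \<Prod>j\<in>S. b (\<nu> j) (g j))"
  have finE: "finite E" unfolding E_def using S by (intro finite_PiE) auto
  have ext: "ext ` E \<subseteq> \<Lambda>"
  proof safe
    fix g assume "g \<in> E"
    then have "ext g \<le> \<nu>" by (auto simp: E_def ext_def le_fun_def PiE_iff)
    then show "ext g \<in> \<Lambda>" using \<Lambda> \<nu> by (auto simp: downward_closed_def)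
  qed
  have "monomial \<nu> y = (\<Sum>\<mu>\<in>\<Lambda>. (\<Sum>g | g \<in> E \<and> ext g = \<mu>. a g) * tensor \<mu> y)" if y: "y \<in> space (cube d)" for y
  proof -
    have "monomial \<nu> y = (\<Prod>j\<in>S. \<Sum>i\<le>\<nu> j. b (\<nu> j) i * L i (y j))"
      unfolding monomial_def S_def[symmetric]
      using cube_coord[OF y] S(2) by (intro prod.cong refl b) auto
    also have "\<dots> = (\<Sum>g\<in>E. \<Prod>j\<in>S. b (\<nu> j) (g j) * L (g j) (y j))"
      unfolding E_def using S by (intro prod_sum_PiE) auto
    also have "\<dots> = (\<Sum>g\<in>E. a g * tensor (ext g) y)"
    proof (rule sum.cong[OF refl])
      fix g
      have "tensor (ext g) y = (\<Prod>j\<in>S. L (ext g j) (y j))"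
        by (rule tensor_eq_prod[OF S(1) _ S(2) y]) (auto simp: ext_def)
      also have "\<dots> = (\<Prod>j\<in>S. L (g j) (y j))" by (intro prod.cong) (auto simp: ext_def)
      finally show "(\<Prod>j\<in>S. b (\<nu> j) (g j) * L (g j) (y j)) = a g * tensor (ext g) y"
        by (simp add: prod.distrib a_def)
    qed
    also have "\<dots> = (\<Sum>\<mu>\<in>\<Lambda>. \<Sum>g | g \<in> E \<and> ext g = \<mu>. a g * tensor (ext g) y)"
      by (rule sum.group[OF finE \<Lambda>(1) ext, symmetric])
    also have "\<dots> = (\<Sum>\<mu>\<in>\<Lambda>. (\<Sum>g | g \<in> E \<and> ext g = \<mu>. a g) * tensor \<mu> y)"
      by (simp add: sum_distrib_right)
    finally show ?thesis .
  qed
  then show ?thesis by (intro exI[of _ "\<lambda>\<mu>. \<Sum>g | g \<in> E \<and> ext g = \<mu>. a g"]) blast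
qed

lemma poly_space_tensor_expansion:
  assumes \<Lambda>: "finite \<Lambda>" "downward_closed \<Lambda>" "\<Lambda> \<subseteq> multi_indices d" and v: "v \<in> poly_space \<Lambda>"
  shows "\<exists>c. \<forall>y\<in>space (cube d). v y = (\<Sum>\<mu>\<in>\<Lambda>. c \<mu> * tensor \<mu> y)"
proof -
  obtain a where a: "v = (\<lambda>y. \<Sum>\<nu>\<in>\<Lambda>. a \<nu> * monomial \<nu> y)" using v by (auto simp: poly_space_def)
  have "\<forall>\<nu>\<in>\<Lambda>. \<exists>c. \<forall>y\<in>space (cube d). monomial \<nu> y = (\<Sum>\<mu>\<in>\<Lambda>. c \<mu> * tensor \<mu> y)"
    using \<Lambda> monomial_tensor_expansion by blast
  then obtain c where c: "\<And>\<nu> y. \<nu> \<in> \<Lambda> \<Longrightarrow> y \<in> space (cube d) \<Longrightarrow> monomial \<nu> y = (\<Sum>\<mu>\<in>\<Lambda>. c \<nu> \<mu> * tensor \<mu> y)"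
    by metis
  have "v y = (\<Sum>\<mu>\<in>\<Lambda>. (\<Sum>\<nu>\<in>\<Lambda>. a \<nu> * c \<nu> \<mu>) * tensor \<mu> y)" if "y \<in> space (cube d)" for y
  proof -
    have "v y = (\<Sum>\<nu>\<in>\<Lambda>. \<Sum>\<mu>\<in>\<Lambda>. a \<nu> * c \<nu> \<mu> * tensor \<mu> y)"
      unfolding a using c that by (simp add: sum_distrib_left mult.assoc)
    also have "\<dots> = (\<Sum>\<mu>\<in>\<Lambda>. (\<Sum>\<nu>\<in>\<Lambda>. a \<nu> * c \<nu> \<mu>) * tensor \<mu> y)"
      by (subst sum.swap) (simp add: sum_distrib_right)
    finally show ?thesis .
  qed
  then show ?thesis by (intro exI[of _ "\<lambda>\<mu>. \<Sum>\<nu>\<in>\<Lambda>. a \<nu> * c \<nu> \<mu>"]) blast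
qed

lemma poly_space_measurable:
  assumes "\<Lambda> \<subseteq> multi_indices d" "v \<in> poly_space \<Lambda>"
  shows "v \<in> borel_measurable (cube d)"
proof -
  have "monomial \<nu> \<in> borel_measurable (cube d)" if "\<nu> \<in> multi_indices d" for \<nu>
    unfolding monomial_def[abs_def] using multi_indicesD[OF that] id_measurable
    by (intro borel_measurable_prod borel_measurable_power component_measurable) auto
  then show ?thesis using assms by (auto simp: poly_space_def intro!: borel_measurable_sum borel_measurable_times)
qed

lemma poly_space_bounded:
  assumes "\<Lambda> \<subseteq> multi_indices d" "v \<in> poly_space \<Lambda>"
  shows "\<exists>b. \<forall>y\<in>space (cube d). \<bar>v y\<bar> \<le> b"
proof -
  obtain a where a: "v = (\<lambda>y. \<Sum>\<nu>\<in>\<Lambda>. a \<nu> * monomial \<nu> y)" using assms by (auto simp: poly_space_def)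
  have mono: "\<bar>monomial \<nu> y\<bar> \<le> 1" if \<nu>: "\<nu> \<in> multi_indices d" and y: "y \<in> space (cube d)" for \<nu> y
    unfolding monomial_def abs_prod
  proof (rule prod_le_1)
    fix j assume "j \<in> {j. \<nu> j \<noteq> 0}"
    then have "j \<in> coords d" using multi_indicesD(2)[OF \<nu>] by blast
    then have "\<bar>y j\<bar> \<le> 1" using cube_coord[OF y, of j] by auto
    then show "0 \<le> \<bar>y j ^ \<nu> j\<bar> \<and> \<bar>y j ^ \<nu> j\<bar> \<le> 1" by (simp add: power_abs power_le_one)
  qed
  have "\<bar>v y\<bar> \<le> (\<Sum>\<nu>\<in>\<Lambda>. \<bar>a \<nu>\<bar>)" if "y \<in> space (cube d)" for y
    unfolding a
  proof (rule order_trans[OF sum_abs sum_mono])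
    fix \<nu> assume "\<nu> \<in> \<Lambda>"
    then show "\<bar>a \<nu> * monomial \<nu> y\<bar> \<le> \<bar>a \<nu>\<bar>"
      using mono[of \<nu> y] assms(1) that unfolding abs_mult by (intro mult_left_le) auto
  qed
  then show ?thesis by blast
qed

end

section \<open>Comparison of true and empirical norms on polynomial spaces\<close>

locale sampling = christoffel_system B L s + P: prob_space P
  for B L s and P :: "'w measure" +
  fixes d :: enat and Y :: "nat \<Rightarrow> 'w \<Rightarrow> nat \<Rightarrow> real" and m :: nat and \<tau> :: real
    and u :: "(nat \<Rightarrow> real) \<Rightarrow> real"
  assumes m: "m \<ge> 1"
    and indep: "P.indep_vars (\<lambda>_. PiM (coords d) (\<lambda>_. B)) Y {1..m}"
    and dist: "\<forall>j\<in>{1..m}. distr P (PiM (coords d) (\<lambda>_. B)) (Y j) = PiM (coords d) (\<lambda>_. B)"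
    and u: "u \<in> borel_measurable (PiM (coords d) (\<lambda>_. B))" "\<forall>y\<in>space (PiM (coords d) (\<lambda>_. B)). \<bar>u y\<bar> \<le> \<tau>"
    and \<tau>: "\<tau> \<ge> 0"
begin

abbreviation "R \<equiv> cube d"

sublocale R: prob_space R by (rule prob_space_cube)

abbreviation "risk w \<equiv> (LINT \<omega>|P. (l2norm R (\<lambda>y. u y - truncation \<tau> (w \<omega> y)))\<^sup>2)"

abbreviation "err v \<equiv> l2norm R (\<lambda>y. u y - v y)"

abbreviation "norm_equiv \<omega> v \<equiv> (l2norm R v)\<^sup>2 \<le> 2 * (sample_norm m (\<lambda>i. Y i \<omega>) v)\<^sup>2"

lemma Y_measurable: "j \<in> {1..m} \<Longrightarrow> Y j \<in> measurable P R"
  using indep unfolding P.indep_vars_def by auto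

text \<open>Parseval's identity turns the coefficient bound of the Chernoff estimate into a bound
  for the true norm. \<open>K\<close> may exceed the Christoffel bound of \<Lambda>, so that sets of
  different size can share one constant.\<close>

lemma norm_equivalence_event:
  assumes \<Lambda>: "finite \<Lambda>" "downward_closed \<Lambda>" "\<Lambda> \<subseteq> multi_indices d"
    and K: "K \<ge> 1" "real (card \<Lambda>) powr s \<le> K"
  shows "\<exists>E\<in>sets P. measure P E \<le> 2 * real (card \<Lambda>) * exp (- ((1 - ln 2) / 2 * real m / K)) \<and>
    (\<forall>\<omega>\<in>space P - E. \<forall>v\<in>poly_space \<Lambda>.
      norm_equiv \<omega> v)"
proof -
  interpret S: orthonormal_sample R \<Lambda> tensor K
  proof unfold_locales
    show "tensor i \<in> borel_measurable R" if "i \<in> \<Lambda>" for i using that \<Lambda> by (intro tensor_measurable) auto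
    show "(\<Sum>i\<in>\<Lambda>. (tensor i z)\<^sup>2) \<le> K" if "z \<in> space R" for z
      using sum_tensor_square_le[OF \<Lambda> that] K by simp
    show "(LINT z|R. tensor i z * tensor k z) = (if i = k then 1 else 0)" if "i \<in> \<Lambda>" "k \<in> \<Lambda>" for i k
      using that \<Lambda> by (intro tensor_orthonormal) auto
  qed (use \<Lambda> K in auto)
  obtain E where E: "E \<in> sets P" "measure P E \<le> 2 * real (card \<Lambda>) * exp (- ((1 - ln 2) / 2 * real m / K))"
    and good: "\<And>\<omega> c. \<omega> \<in> space P - E \<Longrightarrow>
      (\<Sum>i\<in>\<Lambda>. (c i)\<^sup>2) \<le> 2 * (1 / real m * (\<Sum>j=1..m. (\<Sum>i\<in>\<Lambda>. c i * tensor i (Y j \<omega>))\<^sup>2))"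
    using S.empirical_norm_lower_bound[OF P.prob_space_axioms m indep dist] by blast
  have "norm_equiv \<omega> v"
    if \<omega>: "\<omega> \<in> space P - E" and v: "v \<in> poly_space \<Lambda>" for \<omega> v
  proof -
    obtain c where c: "\<And>y. y \<in> space R \<Longrightarrow> v y = (\<Sum>\<mu>\<in>\<Lambda>. c \<mu> * tensor \<mu> y)"
      using poly_space_tensor_expansion[OF \<Lambda> v] by blast
    have Y: "Y j \<omega> \<in> space R" if "j \<in> {1..m}" for j
      using measurable_space[OF Y_measurable[OF that]] \<omega> by auto
    have "(l2norm R v)\<^sup>2 = (LINT y|R. (v y)\<^sup>2)" by (simp add: l2norm_def)
    also have "\<dots> = (LINT y|R. (\<Sum>\<mu>\<in>\<Lambda>. \<Sum>\<nu>\<in>\<Lambda>. c \<mu> * c \<nu> * (tensor \<mu> y * tensor \<nu> y)))"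
      by (intro Bochner_Integration.integral_cong refl) (simp add: c power2_eq_square sum_product mult_ac)
    also have "\<dots> = (\<Sum>\<mu>\<in>\<Lambda>. \<Sum>\<nu>\<in>\<Lambda>. c \<mu> * c \<nu> * (LINT y|R. tensor \<mu> y * tensor \<nu> y))"
      using S.integrable_\<phi>_mult by simp
    also have "\<dots> = (\<Sum>\<mu>\<in>\<Lambda>. \<Sum>\<nu>\<in>\<Lambda>. if \<mu> = \<nu> then c \<mu> * c \<mu> else 0)"
      by (intro sum.cong refl) (simp add: S.orthonormal)
    also have "\<dots> = (\<Sum>\<mu>\<in>\<Lambda>. (c \<mu>)\<^sup>2)" using \<Lambda> by (simp add: power2_eq_square)
    also have "\<dots> \<le> 2 * (1 / real m * (\<Sum>j=1..m. (\<Sum>i\<in>\<Lambda>. c i * tensor i (Y j \<omega>))\<^sup>2))" by (rule good[OF \<omega>])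
    also have "(\<Sum>j=1..m. (\<Sum>i\<in>\<Lambda>. c i * tensor i (Y j \<omega>))\<^sup>2) = (\<Sum>j=1..m. (v (Y j \<omega>))\<^sup>2)"
      using c[OF Y] by (intro sum.cong) auto
    also have "1 / real m * \<dots> = (sample_norm m (\<lambda>i. Y i \<omega>) v)\<^sup>2"
      by (simp add: sample_norm_def sum_nonneg)
    finally show ?thesis .
  qed
  then show ?thesis using E by blast
qed

end

section \<open>Error of the truncated estimator\<close>

lemma l2norm_nonneg: "l2norm M v \<ge> 0"
  by (simp add: l2norm_def)

lemma l2norm_power2: "(l2norm M v)\<^sup>2 = (LINT y|M. (v y)\<^sup>2)"
  by (simp add: l2norm_def)

lemma l2norm_mono:
  assumes "integrable M (\<lambda>y. (g y)\<^sup>2)" "\<And>y. y \<in> space M \<Longrightarrow> \<bar>f y\<bar> \<le> \<bar>g y\<bar>"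
  shows "l2norm M f \<le> l2norm M g"
  unfolding l2norm_def using assms by (intro real_sqrt_le_mono integral_mono') (auto simp: abs_le_square_iff)

lemma integral_Cauchy_Schwarz:
  fixes f g :: "'a \<Rightarrow> real"
  assumes f: "integrable M (\<lambda>y. (f y)\<^sup>2)" and g: "integrable M (\<lambda>y. (g y)\<^sup>2)" and fg: "integrable M (\<lambda>y. f y * g y)"
  shows "(LINT y|M. f y * g y)\<^sup>2 \<le> (LINT y|M. (f y)\<^sup>2) * (LINT y|M. (g y)\<^sup>2)"
proof -
  define a where "a = (LINT y|M. (f y)\<^sup>2)"
  define b where "b = (LINT y|M. (g y)\<^sup>2)"
  define c where "c = (LINT y|M. f y * g y)"
  have q: "0 \<le> a - 2 * t * c + t\<^sup>2 * b" for t
  proof -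
    have "0 \<le> (LINT y|M. (f y - t * g y)\<^sup>2)" by simp
    also have "\<dots> = (LINT y|M. (f y)\<^sup>2 - 2 * t * (f y * g y) + t\<^sup>2 * (g y)\<^sup>2)"
      by (intro Bochner_Integration.integral_cong refl) (simp add: power2_eq_square algebra_simps)
    also have "\<dots> = a - 2 * t * c + t\<^sup>2 * b"
      using f g fg by (simp add: a_def b_def c_def)
    finally show ?thesis .
  qed
  have "c\<^sup>2 \<le> a * b"
  proof (cases "b = 0")
    case True
    have "c = 0"
    proof (rule ccontr)
      assume "c \<noteq> 0"
      then show False using q[of "(a + 1) / (2 * c)"] True by simp
    qed
    then show ?thesis using True by simp
  next
    case False
    moreover have "b \<ge> 0" by (simp add: b_def)
    ultimately have "b > 0" by simp
    then show ?thesis using q[of "c / b"] by (simp add: field_simps power2_eq_square)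
  qed
  then show ?thesis by (simp add: a_def b_def c_def)
qed

lemma integrable_mult_square:
  fixes f g :: "'a \<Rightarrow> real"
  assumes m: "f \<in> borel_measurable M" "g \<in> borel_measurable M"
    and "integrable M (\<lambda>y. (f y)\<^sup>2)" "integrable M (\<lambda>y. (g y)\<^sup>2)"
  shows "integrable M (\<lambda>y. f y * g y)"
proof (rule Bochner_Integration.integrable_bound)
  show "integrable M (\<lambda>y. (f y)\<^sup>2 + (g y)\<^sup>2)" using assms by simp
  show "AE y in M. norm (f y * g y) \<le> norm ((f y)\<^sup>2 + (g y)\<^sup>2)"
  proof (rule AE_I2)
    fix y
    have "2 * \<bar>f y\<bar> * \<bar>g y\<bar> \<le> (f y)\<^sup>2 + (g y)\<^sup>2"
      using sum_squares_bound[of "\<bar>f y\<bar>" "\<bar>g y\<bar>"] by simp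
    moreover have "0 \<le> \<bar>f y\<bar> * \<bar>g y\<bar>" by simp
    ultimately have "\<bar>f y\<bar> * \<bar>g y\<bar> \<le> (f y)\<^sup>2 + (g y)\<^sup>2" by linarith
    then show "norm (f y * g y) \<le> norm ((f y)\<^sup>2 + (g y)\<^sup>2)" by (simp add: abs_mult)
  qed
qed (use m in measurable)

text \<open>Square integrability is assumed because \<open>l2norm\<close> is built on the Bochner
  integral, which is 0 for a function that is not integrable.\<close>

lemma l2norm_triangle:
  assumes m: "f \<in> borel_measurable M" "g \<in> borel_measurable M"
    and f: "integrable M (\<lambda>y. (f y)\<^sup>2)" and g: "integrable M (\<lambda>y. (g y)\<^sup>2)"
  shows "l2norm M (\<lambda>y. f y + g y) \<le> l2norm M f + l2norm M g"
proof (rule power2_le_imp_le)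
  have fg: "integrable M (\<lambda>y. f y * g y)" by (rule integrable_mult_square[OF m f g])
  have "((LINT y|M. f y * g y))\<^sup>2 \<le> (l2norm M f * l2norm M g)\<^sup>2"
    using integral_Cauchy_Schwarz[OF f g fg] by (simp add: power_mult_distrib l2norm_power2)
  then have c: "(LINT y|M. f y * g y) \<le> l2norm M f * l2norm M g"
    by (rule power2_le_imp_le) (simp add: l2norm_nonneg)
  have "(l2norm M (\<lambda>y. f y + g y))\<^sup>2 = (LINT y|M. (f y)\<^sup>2 + 2 * (f y * g y) + (g y)\<^sup>2)"
    unfolding l2norm_power2 by (intro Bochner_Integration.integral_cong refl) (simp add: power2_eq_square algebra_simps)
  also have "\<dots> = (l2norm M f)\<^sup>2 + 2 * (LINT y|M. f y * g y) + (l2norm M g)\<^sup>2"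
    using f g fg by (simp add: l2norm_power2)
  also have "\<dots> \<le> (l2norm M f + l2norm M g)\<^sup>2" using c by (simp add: power2_sum)
  finally show "(l2norm M (\<lambda>y. f y + g y))\<^sup>2 \<le> (l2norm M f + l2norm M g)\<^sup>2" .
qed (simp add: l2norm_nonneg)

section \<open>Empirical seminorms, truncation and best approximations\<close>

lemma sample_norm_eq_L2_set: "sample_norm m y v = sqrt (1 / real m) * L2_set (\<lambda>i. v (y i)) {1..m}"
  unfolding sample_norm_def L2_set_def real_sqrt_mult ..

lemma sample_norm_nonneg: "sample_norm m y v \<ge> 0"
  by (simp add: sample_norm_def sum_nonneg)

lemma sample_norm_triangle: "sample_norm m y (\<lambda>x. f x + g x) \<le> sample_norm m y f + sample_norm m y g"
  unfolding sample_norm_eq_L2_set distrib_left[symmetric]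
  by (intro mult_left_mono L2_set_triangle_ineq) auto

lemma sample_norm_minus_commute: "sample_norm m y (\<lambda>x. f x - g x) = sample_norm m y (\<lambda>x. g x - f x)"
  by (simp add: sample_norm_def power2_commute)

lemma abs_truncation_le: "\<tau> \<ge> 0 \<Longrightarrow> \<bar>truncation \<tau> t\<bar> \<le> \<tau>"
  by (auto simp: truncation_def sgn_if abs_mult)

text \<open>Truncation is the projection onto the interval [-\<tau>, \<tau>], to which
  \<open>a\<close> belongs, so it cannot move \<open>t\<close> away from \<open>a\<close>.\<close>

lemma abs_diff_truncation_le: "\<bar>a\<bar> \<le> \<tau> \<Longrightarrow> \<bar>a - truncation \<tau> t\<bar> \<le> \<bar>a - t\<bar>"
proof -
  assume a: "\<bar>a\<bar> \<le> \<tau>"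
  consider "\<bar>t\<bar> \<le> \<tau>" | "t > \<tau>" | "t < - \<tau>" by linarith
  then show ?thesis
  proof cases
    case 1
    then have "truncation \<tau> t = t" by (simp add: truncation_def min_absorb2 mult_sgn_abs)
    then show ?thesis by simp
  next
    case 2
    moreover have "t > 0" using 2 a by linarith
    ultimately have "truncation \<tau> t = \<tau>" by (simp add: truncation_def)
    then show ?thesis using 2 a by linarith
  next
    case 3
    moreover have "t < 0" using 3 a by linarith
    ultimately have "truncation \<tau> t = - \<tau>" by (simp add: truncation_def)
    then show ?thesis using 3 a by linarith
  qed
qed

lemma poly_space_mono:
  assumes "finite \<Lambda>'" "\<Lambda> \<subseteq> \<Lambda>'" shows "poly_space \<Lambda> \<subseteq> poly_space \<Lambda>'"
proof
  fix v assume "v \<in> poly_space \<Lambda>"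
  then obtain c where c: "v = (\<lambda>y. \<Sum>\<nu>\<in>\<Lambda>. c \<nu> * monomial \<nu> y)" by (auto simp: poly_space_def)
  have "v = (\<lambda>y. \<Sum>\<nu>\<in>\<Lambda>'. (if \<nu> \<in> \<Lambda> then c \<nu> else 0) * monomial \<nu> y)"
    unfolding c using assms by (intro ext sum.mono_neutral_cong_left) auto
  then show "v \<in> poly_space \<Lambda>'" unfolding poly_space_def by (intro CollectI exI)
qed

lemma poly_space_diff:
  assumes "f \<in> poly_space \<Lambda>" "g \<in> poly_space \<Lambda>" shows "(\<lambda>y. f y - g y) \<in> poly_space \<Lambda>"
proof -
  obtain a b where "f = (\<lambda>y. \<Sum>\<nu>\<in>\<Lambda>. a \<nu> * monomial \<nu> y)" "g = (\<lambda>y. \<Sum>\<nu>\<in>\<Lambda>. b \<nu> * monomial \<nu> y)"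
    using assms by (auto simp: poly_space_def)
  then have "(\<lambda>y. f y - g y) = (\<lambda>y. \<Sum>\<nu>\<in>\<Lambda>. (a \<nu> - b \<nu>) * monomial \<nu> y)"
    by (simp add: left_diff_distrib sum_subtractf)
  then show ?thesis by (auto simp: poly_space_def)
qed

text \<open>Unfolds the two nested minimisations into one comparison with any competitor from any
  set of the family. Nonnegativity bounds the infima below.\<close>

lemma best_approximation_le:
  assumes best: "best_approximation nrm u \<F> \<Lambda> w" and nonneg: "\<And>v. nrm v \<ge> 0"
    and \<Lambda>': "\<Lambda>' \<in> \<F>" and v: "v \<in> poly_space \<Lambda>'"
  shows "\<Lambda> \<in> \<F>" "w \<in> poly_space \<Lambda>" "nrm (\<lambda>y. u y - w y) \<le> nrm (\<lambda>y. u y - v y)"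
proof -
  show \<Lambda>: "\<Lambda> \<in> \<F>" and w: "w \<in> poly_space \<Lambda>"
    using best by (auto simp: best_approximation_def is_arg_min_def)
  have "nrm (\<lambda>y. u y - w y) \<le> (INF p\<in>poly_space \<Lambda>. nrm (\<lambda>y. u y - p y))"
    using best w by (intro cINF_greatest) (auto simp: best_approximation_def is_arg_min_linorder)
  also have "\<dots> \<le> (INF p\<in>poly_space \<Lambda>'. nrm (\<lambda>y. u y - p y))"
    using best \<Lambda>' by (auto simp: best_approximation_def is_arg_min_linorder)
  also have "\<dots> \<le> nrm (\<lambda>y. u y - v y)"
    using v nonneg by (intro cINF_lower) (auto intro!: bdd_belowI[of _ 0])
  finally show "nrm (\<lambda>y. u y - w y) \<le> nrm (\<lambda>y. u y - v y)" .
qed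

context sampling begin

text \<open>Pointwise, the squared error is at most 4 \<tau>^2 on \<open>E\<close> and (A + 2 sqrt 2
  b)^2 off \<open>E\<close>, where A is the true and b the empirical error of \<open>un\<close>. The
  mean is then computed from that of b^2.\<close>

lemma expected_error_le:
  assumes \<F>: "\<And>\<Lambda>. \<Lambda> \<in> \<F> \<Longrightarrow> finite \<Lambda> \<and> \<Lambda> \<subseteq> multi_indices d"
    and opt: "\<Lambda>opt \<in> \<F>" "un \<in> poly_space \<Lambda>opt"
    and est: "sample_estimator P R m Y u \<F> \<Lambda>m w"
    and E: "E \<in> sets P"
    and good: "\<And>\<omega> \<Lambda> v. \<omega> \<in> space P - E \<Longrightarrow> \<Lambda> \<in> \<F> \<Longrightarrow> v \<in> poly_space (\<Lambda> \<union> \<Lambda>opt) \<Longrightarrow>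
      norm_equiv \<omega> v"
  shows "risk w
    \<le> (9 + 4 * sqrt 2) * (err un)\<^sup>2 + 4 * \<tau>\<^sup>2 * measure P E"
proof -
  define A where "A = err un"
  define b where "b = (\<lambda>\<omega>. sample_norm m (\<lambda>i. Y i \<omega>) (\<lambda>y. u y - un y))"
  have A: "A \<ge> 0" by (simp add: A_def l2norm_nonneg)
  have pm: "v \<in> borel_measurable R" if "v \<in> poly_space \<Lambda>" "\<Lambda> \<subseteq> multi_indices d" for v \<Lambda>
    using that by (intro poly_space_measurable)
  have sq: "integrable R (\<lambda>y. (f y)\<^sup>2)" if "f \<in> borel_measurable R" "\<forall>y\<in>space R. \<bar>f y\<bar> \<le> c" for f :: "(nat \<Rightarrow> real) \<Rightarrow> real" and c
  proof (rule R.integrable_const_bound)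
    show "AE y in R. norm ((f y)\<^sup>2) \<le> c\<^sup>2"
      using that(2) by (intro AE_I2) (auto simp: abs_le_square_iff[symmetric] intro: order_trans)
  qed (use that in measurable)
  have sq_poly: "integrable R (\<lambda>y. (v y)\<^sup>2)" if "v \<in> poly_space \<Lambda>" "\<Lambda> \<subseteq> multi_indices d" for v \<Lambda>
    using poly_space_bounded[OF that(2,1)] sq[OF pm[OF that]] by blast
  have sq_u: "integrable R (\<lambda>y. (u y - v y)\<^sup>2)" if v: "v \<in> poly_space \<Lambda>" "\<Lambda> \<subseteq> multi_indices d" for v \<Lambda>
  proof -
    obtain c where c: "\<forall>y\<in>space R. \<bar>v y\<bar> \<le> c" using poly_space_bounded[OF v(2,1)] by blast
    show ?thesis
    proof (rule sq[of _ "\<tau> + c"])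
      show "\<forall>y\<in>space R. \<bar>u y - v y\<bar> \<le> \<tau> + c" using c u(2) by (auto intro: order_trans[OF abs_triangle_ineq4] add_mono)
    qed (use u pm[OF v] in measurable)
  qed
  note opt\<Lambda> = \<F>[OF opt(1)]
  have h: "(\<lambda>y. (u y - un y)\<^sup>2) \<in> borel_measurable R" "integrable R (\<lambda>y. (u y - un y)\<^sup>2)"
    using sq_u[OF opt(2)] opt\<Lambda> by auto
  \<comment> \<open>\<open>un\<close> does not depend on the sample, so each summand of b^2 has mean
    A^2. The same would be false for the estimator itself.\<close>
  have Eh: "(LINT \<omega>|P. (u (Y j \<omega>) - un (Y j \<omega>))\<^sup>2) = A\<^sup>2" "integrable P (\<lambda>\<omega>. (u (Y j \<omega>) - un (Y j \<omega>))\<^sup>2)"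
    if j: "j \<in> {1..m}" for j
    using integral_distr[OF Y_measurable[OF j] h(1)] integrable_distr_eq[OF Y_measurable[OF j] h(1)] dist j h(2)
    by (auto simp: A_def l2norm_power2)
  have b2: "(b \<omega>)\<^sup>2 = 1 / real m * (\<Sum>j=1..m. (u (Y j \<omega>) - un (Y j \<omega>))\<^sup>2)" for \<omega>
    by (simp add: b_def sample_norm_def sum_nonneg)
  have b0: "b \<omega> \<ge> 0" for \<omega> by (simp add: b_def sample_norm_nonneg)
  have int_b: "integrable P (\<lambda>\<omega>. (b \<omega>)\<^sup>2)" unfolding b2
    using Eh(2) by (intro integrable_mult_right Bochner_Integration.integrable_sum)
  have Eb: "(LINT \<omega>|P. (b \<omega>)\<^sup>2) = A\<^sup>2"
    unfolding b2 using Eh m by simp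
  \<comment> \<open>An integrable majorant of the squared error on the whole probability space; the
    indicator takes care of the exceptional event.\<close>
  define g where "g = (\<lambda>\<omega>. A\<^sup>2 + 2 * sqrt 2 * (A\<^sup>2 + (b \<omega>)\<^sup>2) + 8 * (b \<omega>)\<^sup>2 + 4 * \<tau>\<^sup>2 * indicator E \<omega>)"
  have int_E: "integrable P (indicat_real E)" using E by (simp add: P.emeasure_eq_measure)
  have int_g: "integrable P g" unfolding g_def using int_b int_E by simp
  have "risk w \<le> (LINT \<omega>|P. g \<omega>)"
    using int_g
  proof (rule integral_mono')
    fix \<omega> assume \<omega>: "\<omega> \<in> space P"
    show "0 \<le> g \<omega>" by (simp add: g_def)
    show "(l2norm R (\<lambda>y. u y - truncation \<tau> (w \<omega> y)))\<^sup>2 \<le> g \<omega>"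
    proof (cases "\<omega> \<in> E")
      case True
      have "(l2norm R (\<lambda>y. u y - truncation \<tau> (w \<omega> y)))\<^sup>2 \<le> (LINT y|R. (2 * \<tau>)\<^sup>2)"
        unfolding l2norm_power2
      proof (rule integral_mono')
        fix y assume y: "y \<in> space R"
        have "\<bar>u y - truncation \<tau> (w \<omega> y)\<bar> \<le> \<bar>2 * \<tau>\<bar>"
          using u(2) y abs_truncation_le[OF \<tau>, of "w \<omega> y"] \<tau> by (auto intro!: order_trans[OF abs_triangle_ineq4])
        then show "(u y - truncation \<tau> (w \<omega> y))\<^sup>2 \<le> (2 * \<tau>)\<^sup>2" by (simp only: abs_le_square_iff)
      qed simp_all
      also have "\<dots> = 4 * \<tau>\<^sup>2" by (simp add: R.prob_space power_mult_distrib)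
      also have "\<dots> \<le> g \<omega>" using True by (simp add: g_def)
      finally show ?thesis .
    next
      case False
      have "best_approximation (sample_norm m (\<lambda>i. Y i \<omega>)) u \<F> (\<Lambda>m \<omega>) (w \<omega>)"
        using est \<omega> by (simp add: sample_estimator_def)
      note est' = best_approximation_le[OF this sample_norm_nonneg opt]
      define V where "V = \<Lambda>m \<omega> \<union> \<Lambda>opt"
      have V: "finite V" "V \<subseteq> multi_indices d" using \<F>[OF est'(1)] opt\<Lambda> by (auto simp: V_def)
      have wV: "w \<omega> \<in> poly_space V" using poly_space_mono[OF V(1), of "\<Lambda>m \<omega>"] est'(2) by (auto simp: V_def)
      have unV: "un \<in> poly_space V" using poly_space_mono[OF V(1), of \<Lambda>opt] opt(2) by (auto simp: V_def)
      have dV: "(\<lambda>y. un y - w \<omega> y) \<in> poly_space V" by (rule poly_space_diff[OF unV wV])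
      have "(l2norm R (\<lambda>y. un y - w \<omega> y))\<^sup>2 \<le> 2 * (sample_norm m (\<lambda>i. Y i \<omega>) (\<lambda>y. un y - w \<omega> y))\<^sup>2"
        using good[OF _ est'(1)] dV \<omega> False by (auto simp: V_def)
      also have "\<dots> \<le> 2 * (2 * b \<omega>)\<^sup>2"
      proof (intro mult_left_mono power_mono sample_norm_nonneg)
        have "sample_norm m (\<lambda>i. Y i \<omega>) (\<lambda>y. un y - w \<omega> y)
            = sample_norm m (\<lambda>i. Y i \<omega>) (\<lambda>y. (un y - u y) + (u y - w \<omega> y))" by simp
        also have "\<dots> \<le> b \<omega> + sample_norm m (\<lambda>i. Y i \<omega>) (\<lambda>y. u y - w \<omega> y)"
          using sample_norm_triangle[of m "\<lambda>i. Y i \<omega>" "\<lambda>y. un y - u y" "\<lambda>y. u y - w \<omega> y"]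
          by (simp add: b_def sample_norm_minus_commute[of m "\<lambda>i. Y i \<omega>" un u])
        also have "\<dots> \<le> 2 * b \<omega>" using est'(3) by (simp add: b_def)
        finally show "sample_norm m (\<lambda>i. Y i \<omega>) (\<lambda>y. un y - w \<omega> y) \<le> 2 * b \<omega>" .
      qed simp
      also have "\<dots> = (2 * sqrt 2 * b \<omega>)\<^sup>2" by (simp add: power_mult_distrib)
      finally have d: "l2norm R (\<lambda>y. un y - w \<omega> y) \<le> 2 * sqrt 2 * b \<omega>"
        by (rule power2_le_imp_le) (simp add: b0)
      have "l2norm R (\<lambda>y. u y - truncation \<tau> (w \<omega> y)) \<le> err (w \<omega>)"
        using sq_u[OF wV V(2)] u(2) by (intro l2norm_mono abs_diff_truncation_le) auto
      also have "\<dots> = l2norm R (\<lambda>y. (u y - un y) + (un y - w \<omega> y))" by simp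
      also have "\<dots> \<le> A + l2norm R (\<lambda>y. un y - w \<omega> y)"
        unfolding A_def
        by (rule l2norm_triangle[OF _ pm[OF dV V(2)] h(2) sq_poly[OF dV V(2)]]) (use u pm[OF unV V(2)] in measurable)
      also have "\<dots> \<le> A + 2 * sqrt 2 * b \<omega>" using d by simp
      finally have "(l2norm R (\<lambda>y. u y - truncation \<tau> (w \<omega> y)))\<^sup>2 \<le> (A + 2 * sqrt 2 * b \<omega>)\<^sup>2"
        using l2norm_nonneg by (intro power_mono)
      also have "\<dots> = A\<^sup>2 + 2 * sqrt 2 * (2 * A * b \<omega>) + 8 * (b \<omega>)\<^sup>2"
        by (simp add: power2_sum power_mult_distrib algebra_simps)
      \<comment> \<open>The mixed term is made quadratic, so that after integration only the mean
        A^2 of b^2 enters: 1 + 4 sqrt 2 + 8 in total.\<close>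
      also have "\<dots> \<le> A\<^sup>2 + 2 * sqrt 2 * (A\<^sup>2 + (b \<omega>)\<^sup>2) + 8 * (b \<omega>)\<^sup>2"
        using sum_squares_bound[of A "b \<omega>"] by (intro add_mono mult_left_mono) auto
      also have "\<dots> \<le> g \<omega>" by (simp add: g_def)
      finally show ?thesis .
    qed
  qed
  also have "(LINT \<omega>|P. g \<omega>) = A\<^sup>2 + 2 * sqrt 2 * (A\<^sup>2 + A\<^sup>2) + 8 * A\<^sup>2 + 4 * \<tau>\<^sup>2 * measure P E"
    unfolding g_def using int_b int_E Eb E by (simp add: P.prob_space)
  also have "\<dots> = (9 + 4 * sqrt 2) * A\<^sup>2 + 4 * \<tau>\<^sup>2 * measure P E" by (simp add: algebra_simps)
  finally show ?thesis by (simp add: A_def)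
qed

end

section \<open>Consequences of the condition on the sample size\<close>

lemma failure_exponent_le:
  fixes m :: nat and r K C :: real
  assumes m: "m \<ge> 2" and K: "K > 0" and C: "C > 0"
    and cond: "real m / ln (real m) \<ge> (1 + r + ln C / ln (real m)) * (K / ((1 - ln 2) / 2))"
  shows "C * exp (- ((1 - ln 2) / 2 * real m / K)) \<le> real m powr (- (1 + r))"
proof -
  define \<zeta> :: real where "\<zeta> = (1 - ln 2) / 2"
  have \<zeta>: "\<zeta> > 0" using ln_2_less_1 by (simp add: \<zeta>_def)
  have l: "ln (real m) > 0" using m by simp
  have "(1 + r) * ln (real m) + ln C = ((1 + r + ln C / ln (real m)) * (K / \<zeta>)) * (ln (real m) * \<zeta> / K)"
    using l \<zeta> K by (simp add: field_simps)
  also have "\<dots> \<le> (real m / ln (real m)) * (ln (real m) * \<zeta> / K)"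
    using cond l \<zeta> K unfolding \<zeta>_def[symmetric] by (intro mult_right_mono) auto
  also have "\<dots> = \<zeta> * real m / K" using l by (simp add: field_simps)
  finally have "exp (- (\<zeta> * real m / K)) \<le> exp (- ((1 + r) * ln (real m) + ln C))" by simp
  also have "\<dots> = exp (- (1 + r) * ln (real m)) * exp (- ln C)"
    by (simp add: exp_add[symmetric] algebra_simps)
  also have "\<dots> = real m powr (- (1 + r)) / C" using m C by (simp add: powr_def exp_minus field_simps)
  finally show ?thesis using C by (simp add: \<zeta>_def field_simps)
qed

text \<open>This makes one power of m sufficient to pay for the cardinality in the Chernoff
  prefactor. As ln 2 is at least 2/3, the reciprocal of (1 - ln 2)/2 is at least 6, which leaves
  ample room since 6 ln m is at least 4.\<close>

lemma constant_le_sample_size: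
  fixes m :: nat and r K c :: real
  assumes m: "m \<ge> 2" and K: "K > 0" and r: "r > 0" and c: "c \<ge> 0"
    and cond: "real m / ln (real m) \<ge> (1 + r + c) * (K / ((1 - ln 2) / 2))"
  shows "K \<le> real m"
proof -
  have l: "ln 2 \<le> ln (real m)" using m by simp
  have l2: "ln 2 \<ge> 2 / (3 :: real)" by (rule ln2_ge_two_thirds)
  have \<zeta>: "1 / ((1 - ln 2) / 2) \<ge> (6 :: real)" using l2 ln_2_less_1 by (simp add: field_simps)
  have "6 * K \<le> 1 / ((1 - ln 2) / 2) * K" using \<zeta> K by (intro mult_right_mono) auto
  also have "\<dots> = 1 * (K / ((1 - ln 2) / 2))" by simp
  also have "\<dots> \<le> (1 + r + c) * (K / ((1 - ln 2) / 2))"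
    using r c K ln_2_less_1 by (intro mult_right_mono) auto
  finally have "6 * K \<le> real m / ln (real m)" using cond by simp
  then have "6 * K * ln (real m) \<le> real m" using l l2 by (simp add: field_simps)
  moreover have "K * 1 \<le> K * (6 * ln (real m))" using K l l2 by (intro mult_left_mono) auto
  ultimately show ?thesis by simp
qed

lemma powr_neg_Suc_mult_le:
  fixes m :: nat and k r :: real
  assumes "m \<ge> 1" "k \<le> real m"
  shows "2 * k * real m powr (- (1 + r)) \<le> 2 * real m powr (- r)"
proof -
  have "k * real m powr (- (1 + r)) \<le> real m * real m powr (- (1 + r))"
    using assms by (intro mult_right_mono) auto
  also have "\<dots> = real m powr 1 * real m powr (- (1 + r))" by simp
  also have "\<dots> = real m powr (1 + - (1 + r))" by (rule powr_add[symmetric])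
  finally show ?thesis by simp
qed

text \<open>Both sets contain the zero index, which is counted once: this is the reason for 2n - 1
  in place of 2n.\<close>

lemma Un_downward_family:
  assumes "\<Lambda> \<in> downward_family d n" "\<Lambda>' \<in> downward_family d n" "n \<ge> 1"
  shows "finite (\<Lambda> \<union> \<Lambda>')" "downward_closed (\<Lambda> \<union> \<Lambda>')" "\<Lambda> \<union> \<Lambda>' \<subseteq> multi_indices d" "card (\<Lambda> \<union> \<Lambda>') \<le> 2 * n - 1"
proof -
  have D: "finite \<Lambda>" "finite \<Lambda>'" "card \<Lambda> = n" "card \<Lambda>' = n" "downward_closed \<Lambda>" "downward_closed \<Lambda>'"
    using assms by (auto simp: downward_family_def)
  then have "\<Lambda> \<noteq> {}" "\<Lambda>' \<noteq> {}" using assms(3) by auto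
  then have "(\<lambda>_. 0) \<in> \<Lambda> \<inter> \<Lambda>'" using downward_closed_zero D by blast
  then have "card (\<Lambda> \<inter> \<Lambda>') > 0" using D by (auto simp: card_gt_0_iff)
  then show "card (\<Lambda> \<union> \<Lambda>') \<le> 2 * n - 1" using card_Un_Int[OF D(1,2)] D by simp
qed (use assms in \<open>auto simp: downward_family_def intro: downward_closed_Un\<close>)

context sampling begin

lemma le_powr_s: "x \<ge> 1 \<Longrightarrow> x \<le> x powr s"
  using powr_mono[OF s_ge_1, of x] by simp

text \<open>Since $\Lambda^{opt}$ is deterministic, the cover $\mathcal{G}$ of the sets
  $\Lambda \cup \Lambda^{opt}$ need not contain the unions of all pairs in the family.\<close>

lemma truncated_error_bound:
  assumes m2: "m \<ge> 2" and r: "r > 0" and h: "h \<ge> 1"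
    and \<F>: "\<And>\<Lambda>. \<Lambda> \<in> \<F> \<Longrightarrow> finite \<Lambda> \<and> \<Lambda> \<subseteq> multi_indices d"
    and opt: "\<Lambda>opt \<in> \<F>" "un \<in> poly_space \<Lambda>opt"
    and est: "sample_estimator P R m Y u \<F> \<Lambda>m w"
    and \<G>: "finite \<G>" "real (card \<G>) \<le> C" "C \<ge> 1"
    and H: "\<And>H. H \<in> \<G> \<Longrightarrow> finite H \<and> downward_closed H \<and> H \<subseteq> multi_indices d \<and> card H \<le> h"
    and cover: "\<And>\<Lambda>. \<Lambda> \<in> \<F> \<Longrightarrow> \<exists>H\<in>\<G>. \<Lambda> \<union> \<Lambda>opt \<subseteq> H"
    and cond: "real m / ln (real m) \<ge> (1 + r + ln C / ln (real m)) * (real h powr s / ((1 - ln 2) / 2))"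
  shows "risk w
    \<le> (9 + 4 * sqrt 2) * (err un)\<^sup>2 + 8 * \<tau>\<^sup>2 * real m powr (- r)"
proof -
  define K where "K = real h powr s"
  define \<epsilon> where "\<epsilon> = exp (- ((1 - ln 2) / 2 * real m / K))"
  have hK: "real h \<le> K" unfolding K_def using h by (intro le_powr_s) simp
  have K1: "K \<ge> 1" using hK h by simp
  note cond' = cond[folded K_def]
  have "K \<le> real m" using constant_le_sample_size[OF m2 _ r _ cond'] K1 \<G>(3) m by simp
  then have hm: "real h \<le> real m" using hK by simp
  \<comment> \<open>One exceptional event for each covering set, all with the same constant K and
    the same probability bound, ready for the union bound.\<close>
  have "\<exists>E\<in>sets P. measure P E \<le> 2 * real h * \<epsilon> \<and> (\<forall>\<omega>\<in>space P - E. \<forall>v\<in>poly_space H.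
      norm_equiv \<omega> v)" if "H \<in> \<G>" for H
  proof -
    note D = H[OF that]
    have "real (card H) powr s \<le> K" unfolding K_def using D s_ge_1 by (intro powr_mono2) auto
    then obtain E where E: "E \<in> sets P" "measure P E \<le> 2 * real (card H) * \<epsilon>"
      "\<forall>\<omega>\<in>space P - E. \<forall>v\<in>poly_space H. norm_equiv \<omega> v"
      using norm_equivalence_event[of H K] D K1 unfolding \<epsilon>_def by blast
    have "2 * real (card H) * \<epsilon> \<le> 2 * real h * \<epsilon>" using D by (intro mult_right_mono) (auto simp: \<epsilon>_def)
    then show ?thesis using E by (intro bexI[of _ E]) auto
  qed
  then obtain E where E: "\<And>H. H \<in> \<G> \<Longrightarrow> E H \<in> sets P" "\<And>H. H \<in> \<G> \<Longrightarrow> measure P (E H) \<le> 2 * real h * \<epsilon>"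
    and good: "\<And>H \<omega> v. H \<in> \<G> \<Longrightarrow> \<omega> \<in> space P - E H \<Longrightarrow> v \<in> poly_space H \<Longrightarrow>
      norm_equiv \<omega> v" by metis
  define U where "U = (\<Union>H\<in>\<G>. E H)"
  have U: "U \<in> sets P" unfolding U_def using \<G>(1) E(1) by (intro sets.finite_UN) auto
  have "measure P U \<le> (\<Sum>H\<in>\<G>. measure P (E H))"
    unfolding U_def using \<G>(1) E(1) by (intro P.finite_measure_subadditive_finite) auto
  also have "\<dots> \<le> (\<Sum>H\<in>\<G>. 2 * real h * \<epsilon>)" using E(2) by (intro sum_mono)
  also have "\<dots> = real (card \<G>) * (2 * real h * \<epsilon>)" by simp
  also have "\<dots> \<le> C * (2 * real h * \<epsilon>)" using \<G>(2) by (intro mult_right_mono) (auto simp: \<epsilon>_def)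
  also have "\<dots> = 2 * real h * (C * \<epsilon>)" by simp
  also have "\<dots> \<le> 2 * real h * real m powr (- (1 + r))"
    unfolding \<epsilon>_def using K1 \<G>(3) by (intro mult_left_mono failure_exponent_le[OF m2 _ _ cond']) auto
  \<comment> \<open>Here the cardinality h, at most m, is absorbed by one power of m; this is the 1
    in 1 + r.\<close>
  also have "\<dots> \<le> 2 * real m powr (- r)" by (rule powr_neg_Suc_mult_le[OF m hm])
  finally have pU: "measure P U \<le> 2 * real m powr (- r)" .
  have "risk w
    \<le> (9 + 4 * sqrt 2) * (err un)\<^sup>2 + 4 * \<tau>\<^sup>2 * measure P U"
  proof (rule expected_error_le[OF \<F> opt est U])
    fix \<omega> \<Lambda> v assume \<omega>: "\<omega> \<in> space P - U" and "\<Lambda> \<in> \<F>" and v: "v \<in> poly_space (\<Lambda> \<union> \<Lambda>opt)"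
    then obtain G where G: "G \<in> \<G>" "\<Lambda> \<union> \<Lambda>opt \<subseteq> G" using cover by blast
    then have "v \<in> poly_space G" using v H[OF G(1)] poly_space_mono by blast
    then show "norm_equiv \<omega> v"
      using good[OF G(1)] \<omega> G(1) by (auto simp: U_def)
  qed
  also have "4 * \<tau>\<^sup>2 * measure P U \<le> 4 * \<tau>\<^sup>2 * (2 * real m powr (- r))" using pU by (intro mult_left_mono) auto
  finally show ?thesis by simp
qed

end

section \<open>The counts entering the final conditions\<close>

lemma anchored_family_subset_downward: "anchored_family d n \<subseteq> downward_family d n"
  by (auto simp: anchored_family_def downward_family_def anchored_def)

lemma card_anchored_family_le: "finite (anchored_family d n)"
  "card (anchored_family d n) \<le> card (downward_family (enat (n - 1)) n)"
  using anchored_family_subset[of d n] card_downward_family_le_power2[of "n - 1" n]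
  by (auto intro: finite_subset card_mono)

lemma zero_in_hyperbolic_cross: "n \<ge> 1 \<Longrightarrow> (\<lambda>_. 0) \<in> hyperbolic_cross q n"
  by (simp add: hyperbolic_cross_def multi_indices_enat)

text \<open>Rounds the sharper count, with exponent n - 1, up to the shape in which its logarithm
  appears in the conditions.\<close>

lemma card_downward_family_le_power':
  assumes "n \<ge> 1" "n \<le> N" "k * n \<le> M" "1 \<le> M"
  shows "card (downward_family (enat k) n) \<le> M ^ N"
proof -
  obtain n' where n': "n = Suc n'" using assms by (cases n) auto
  have "card (downward_family (enat k) n) \<le> (k * n) ^ n'" unfolding n' by (rule card_downward_family_le_power)
  also have "\<dots> \<le> M ^ n'" using assms by (intro power_mono) auto
  also have "\<dots> \<le> M ^ N" using assms n' by (intro power_increasing) auto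
  finally show ?thesis .
qed

text \<open>An arbitrary rule for breaking ties is expressed by quantifying over all minimizers and
  over all selections that are a \<open>sample_estimator\<close>.\<close>

theorem theorem3:
  fixes d :: enat and \<theta>1 \<theta>2 \<tau> r s \<zeta> :: real and n m N :: nat
    and u :: "(nat \<Rightarrow> real) \<Rightarrow> real"
    and \<rho> :: "(nat \<Rightarrow> real) measure"
    and P :: "'w measure" and Y :: "nat \<Rightarrow> 'w \<Rightarrow> nat \<Rightarrow> real"
  assumes "d \<ge> 1"
    and "\<theta>1 > -1" and "\<theta>2 > -1"
    and "\<rho> = jacobi_prod d \<theta>1 \<theta>2"
    and "\<tau> \<ge> 0"
    and "u \<in> borel_measurable \<rho>"
    and "\<forall>y\<in>space \<rho>. \<bar>u y\<bar> \<le> \<tau>"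
    and "r > 0" and "n \<ge> 1" and "m \<ge> 2" and "N = 2 * n - 1"
    and "\<theta>1 = -1/2 \<and> \<theta>2 = -1/2 \<and> s = ln 3 / ln 2 \<or>
         \<theta>1 \<in> \<nat> \<and> \<theta>2 \<in> \<nat> \<and> s = 2 * max \<theta>1 \<theta>2 + 2"
    and "\<zeta> = (1 - ln 2) / 2"
    and "prob_space P"
    and "prob_space.indep_vars P (\<lambda>_. \<rho>) Y {1..m}"
    and "\<forall>i\<in>{1..m}. distr P \<rho> (Y i) = \<rho>"
  shows
    "(\<forall>k :: nat. d = enat k \<longrightarrow>
        (real m / ln (real m) \<ge> (1 + r) / \<zeta> * real (card (hyperbolic_cross k N)) powr s \<or>
         real m / ln (real m) \<ge> (1 + r + real N * real k * ln 2 / ln (real m)) * (real N powr s / \<zeta>) \<or>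
         real m / ln (real m) \<ge>
           (1 + r + real N * ln (real k * real N) / ln (real m)) * (real N powr s / \<zeta>)) \<longrightarrow>
        (\<forall>\<Lambda>opt un \<Lambda>m w.
           best_approximation (l2norm \<rho>) u (downward_family d n) \<Lambda>opt un \<longrightarrow>
           sample_estimator P \<rho> m Y u (downward_family d n) \<Lambda>m w \<longrightarrow>
           (LINT \<omega>|P. (l2norm \<rho> (\<lambda>y. u y - truncation \<tau> (w \<omega> y)))\<^sup>2)
             \<le> (9 + 4 * sqrt 2) * (l2norm \<rho> (\<lambda>y. u y - un y))\<^sup>2 + 8 * \<tau>\<^sup>2 * real m powr (- r)))
     \<and>
     ((real m / ln (real m) \<ge> (1 + r) / \<zeta> * real (card (hyperbolic_cross (N - 1) N)) powr s \<or>
       real m / ln (real m) \<ge> (1 + r + (real N)\<^sup>2 * ln 2 / ln (real m)) * (real N powr s / \<zeta>) \<or>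
       real m / ln (real m) \<ge>
         (1 + r + 2 * real N * ln (real N) / ln (real m)) * (real N powr s / \<zeta>)) \<longrightarrow>
        (\<forall>\<Lambda>opt un \<Lambda>m w.
           best_approximation (l2norm \<rho>) u (anchored_family d n) \<Lambda>opt un \<longrightarrow>
           sample_estimator P \<rho> m Y u (anchored_family d n) \<Lambda>m w \<longrightarrow>
           (LINT \<omega>|P. (l2norm \<rho> (\<lambda>y. u y - truncation \<tau> (w \<omega> y)))\<^sup>2)
             \<le> (9 + 4 * sqrt 2) * (l2norm \<rho> (\<lambda>y. u y - un y))\<^sup>2 + 8 * \<tau>\<^sup>2 * real m powr (- r)))"
proof -
  have "\<exists>L. christoffel_system (jacobi_measure \<theta>1 \<theta>2) L s"
    using assms(12)
  proof
    assume "\<theta>1 = -1/2 \<and> \<theta>2 = -1/2 \<and> s = ln 3 / ln 2"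
    then show ?thesis using christoffel_system_chebyshev by simp
  next
    assume *: "\<theta>1 \<in> \<nat> \<and> \<theta>2 \<in> \<nat> \<and> s = 2 * max \<theta>1 \<theta>2 + 2"
    then obtain a b where "\<theta>1 = real a" "\<theta>2 = real b" by (auto elim!: Nats_cases)
    then show ?thesis using * christoffel_system_jacobi_nat[of a b] by (simp add: of_nat_max)
  qed
  then obtain L where "christoffel_system (jacobi_measure \<theta>1 \<theta>2) L s" by blast
  then interpret C: christoffel_system "jacobi_measure \<theta>1 \<theta>2" L s .
  have \<rho>: "\<rho> = C.cube d" using assms(4) by (simp add: jacobi_prod_def)
  interpret P: prob_space P by (rule assms(14))
  interpret sampling "jacobi_measure \<theta>1 \<theta>2" L s P d Y m \<tau> u
    by unfold_locales (use assms(5-7,10,15,16) \<rho> in auto)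
  have \<zeta>: "(1 - ln 2) / 2 = \<zeta>" using assms(13) by simp
  have N1: "N \<ge> 1" "n \<le> N" using assms(9,11) by auto
  note bound = truncated_error_bound[OF assms(10,8), unfolded \<zeta>]
  \<comment> \<open>The cover consists of the unions with the deterministic optimal set, each of at
    most N elements. \<open>C\<close> is any bound for their number; ln C will be N k ln 2, N ln (k
    N), N^2 ln 2 or 2 N ln N.\<close>
  have union_bound: "risk w
      \<le> (9 + 4 * sqrt 2) * (err un)\<^sup>2 + 8 * \<tau>\<^sup>2 * real m powr (- r)"
    if sub: "\<F> \<subseteq> downward_family d n" and fin: "finite \<F>" and C: "real (card \<F>) \<le> C" "1 \<le> C"
      and cond: "real m / ln (real m) \<ge> (1 + r + ln C / ln (real m)) * (real N powr s / \<zeta>)"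
      and opt: "\<Lambda>opt \<in> \<F>" "un \<in> poly_space \<Lambda>opt" and est: "sample_estimator P R m Y u \<F> \<Lambda>m w"
    for \<F> C \<Lambda>opt un \<Lambda>m w
  proof (rule bound[where \<G> = "(\<lambda>\<Lambda>. \<Lambda> \<union> \<Lambda>opt) ` \<F>", OF N1(1) _ opt est _ _ C(2) _ _ cond])
    show "real (card ((\<lambda>\<Lambda>. \<Lambda> \<union> \<Lambda>opt) ` \<F>)) \<le> C"
      using C(1) card_image_le[OF fin, of "\<lambda>\<Lambda>. \<Lambda> \<union> \<Lambda>opt"] by linarith
    show "finite H \<and> downward_closed H \<and> H \<subseteq> multi_indices d \<and> card H \<le> N" if "H \<in> (\<lambda>\<Lambda>. \<Lambda> \<union> \<Lambda>opt) ` \<F>" for H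
      using that sub opt(1) Un_downward_family[OF _ _ assms(9), of _ d \<Lambda>opt] unfolding assms(11) by blast
  qed (use sub fin in \<open>auto simp: downward_family_def\<close>)
  \<comment> \<open>A single covering set, so C = 1 and the logarithm drops out; the price is the
    cardinality of the cross in place of N.\<close>
  have cross_bound: "risk w
      \<le> (9 + 4 * sqrt 2) * (err un)\<^sup>2 + 8 * \<tau>\<^sup>2 * real m powr (- r)"
    if sub: "\<F> \<subseteq> downward_family d n" and q: "\<And>\<Lambda>. \<Lambda> \<in> \<F> \<Longrightarrow> \<Lambda> \<subseteq> multi_indices (enat q)"
      and cond: "real m / ln (real m) \<ge> (1 + r) / \<zeta> * real (card (hyperbolic_cross q N)) powr s"
      and opt: "\<Lambda>opt \<in> \<F>" "un \<in> poly_space \<Lambda>opt" and est: "sample_estimator P R m Y u \<F> \<Lambda>m w"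
    for \<F> q \<Lambda>opt un \<Lambda>m w
  proof -
    txt \<open>For $q > d$ the cross uses coordinates that are not available in dimension $d$.\<close>
    let ?H = "hyperbolic_cross q N \<inter> multi_indices d"
    have in_H: "\<Lambda> \<subseteq> ?H" if "\<Lambda> \<in> \<F>" for \<Lambda>
    proof -
      have "\<Lambda> \<in> downward_family d n" using sub that by blast
      then show ?thesis
        using N1 q[OF that] downward_closed_subset_hyperbolic_cross[of \<Lambda> q N] by (auto simp: downward_family_def)
    qed
    show ?thesis
    proof (rule bound[where \<G> = "{?H}" and C = 1 and h = "card (hyperbolic_cross q N)", OF _ _ opt est])
      have "(\<lambda>_. 0) \<in> hyperbolic_cross q N" using N1(1) by (rule zero_in_hyperbolic_cross)
      then show "1 \<le> card (hyperbolic_cross q N)"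
        using finite_hyperbolic_cross by (auto simp: Suc_le_eq card_gt_0_iff)
      show "finite H \<and> downward_closed H \<and> H \<subseteq> multi_indices d \<and> card H \<le> card (hyperbolic_cross q N)" if "H \<in> {?H}" for H
        using that by (auto intro!: card_mono finite_hyperbolic_cross downward_closed_Int
            downward_closed_hyperbolic_cross downward_closed_multi_indices)
      show "real m / ln (real m) \<ge> (1 + r + ln 1 / ln (real m)) * (real (card (hyperbolic_cross q N)) powr s / \<zeta>)"
        using cond by simp
      show "finite \<Lambda> \<and> \<Lambda> \<subseteq> multi_indices d" if "\<Lambda> \<in> \<F>" for \<Lambda>
        using sub that by (auto simp: downward_family_def)
    qed (use in_H opt(1) in auto)
  qed
  show ?thesis unfolding \<rho>
  proof (intro conjI allI impI)
    fix k \<Lambda>opt un \<Lambda>m w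
    assume d: "d = enat k"
      and cond: "real m / ln (real m) \<ge> (1 + r) / \<zeta> * real (card (hyperbolic_cross k N)) powr s \<or>
         real m / ln (real m) \<ge> (1 + r + real N * real k * ln 2 / ln (real m)) * (real N powr s / \<zeta>) \<or>
         real m / ln (real m) \<ge>
           (1 + r + real N * ln (real k * real N) / ln (real m)) * (real N powr s / \<zeta>)"
        (is "?hyp \<or> ?pow2 \<or> ?pow")
      and best: "best_approximation (l2norm R) u (downward_family d n) \<Lambda>opt un"
      and est: "sample_estimator P R m Y u (downward_family d n) \<Lambda>m w"
    have opt: "\<Lambda>opt \<in> downward_family d n" "un \<in> poly_space \<Lambda>opt"
      using best by (auto simp: best_approximation_def is_arg_min_def)
    \<comment> \<open>A positive dimension makes k N at least 1, as needed for the logarithm of k N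
      and for C at least 1.\<close>
    have k1: "k \<ge> 1" using assms(1) d by (simp add: one_enat_def)
    have fin: "finite (downward_family d n)" and c2: "card (downward_family d n) \<le> 2 ^ (k * n)"
      unfolding d using card_downward_family_le_power2 by auto
    show "risk w
      \<le> (9 + 4 * sqrt 2) * (err un)\<^sup>2 + 8 * \<tau>\<^sup>2 * real m powr (- r)"
      using cond
    proof (elim disjE)
      assume ?hyp
      show ?thesis
      proof (rule cross_bound[OF subset_refl _ \<open>?hyp\<close> opt est])
        show "\<Lambda> \<subseteq> multi_indices (enat k)" if "\<Lambda> \<in> downward_family d n" for \<Lambda>
          using that by (simp add: downward_family_def d)
      qed
    next
      assume ?pow2
      show ?thesis
      proof (rule union_bound[of "downward_family d n" "2 ^ (N * k)", OF subset_refl fin _ _ _ opt est])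
        have "k * n \<le> N * k" using N1 by (simp add: mult.commute)
        then have "(2::nat) ^ (k * n) \<le> 2 ^ (N * k)" by (rule power_increasing) simp
        then have "card (downward_family d n) \<le> 2 ^ (N * k)" using c2 by (rule le_trans[rotated])
        then have "real (card (downward_family d n)) \<le> real (2 ^ (N * k))" by (rule of_nat_mono)
        then show "real (card (downward_family d n)) \<le> 2 ^ (N * k)" by simp
      qed (use \<open>?pow2\<close> in \<open>simp_all add: ln_realpow\<close>)
    next
      assume ?pow
      show ?thesis
      proof (rule union_bound[of "downward_family d n" "real ((k * N) ^ N)", OF subset_refl fin _ _ _ opt est])
        have kN: "k * N \<ge> 1" using k1 N1 by (simp add: Suc_le_eq)
        show "real (card (downward_family d n)) \<le> real ((k * N) ^ N)"
          unfolding d of_nat_le_iff using assms(9) N1 kN by (intro card_downward_family_le_power') auto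
        show "1 \<le> real ((k * N) ^ N)" using kN by (simp del: of_nat_power of_nat_mult)
        have "real (k * N) > 0" using kN by (simp del: of_nat_mult)
        then have "ln (real ((k * N) ^ N)) = real N * ln (real k * real N)"
          by (simp only: of_nat_power ln_realpow of_nat_mult)
        then show "real m / ln (real m) \<ge> (1 + r + ln (real ((k * N) ^ N)) / ln (real m)) * (real N powr s / \<zeta>)"
          using \<open>?pow\<close> by simp
      qed
    qed
  next
    fix \<Lambda>opt un \<Lambda>m w
    assume cond: "real m / ln (real m) \<ge> (1 + r) / \<zeta> * real (card (hyperbolic_cross (N - 1) N)) powr s \<or>
         real m / ln (real m) \<ge> (1 + r + (real N)\<^sup>2 * ln 2 / ln (real m)) * (real N powr s / \<zeta>) \<or>
         real m / ln (real m) \<ge>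
           (1 + r + 2 * real N * ln (real N) / ln (real m)) * (real N powr s / \<zeta>)"
        (is "?hyp \<or> ?pow2 \<or> ?pow")
      and best: "best_approximation (l2norm R) u (anchored_family d n) \<Lambda>opt un"
      and est: "sample_estimator P R m Y u (anchored_family d n) \<Lambda>m w"
    have opt: "\<Lambda>opt \<in> anchored_family d n" "un \<in> poly_space \<Lambda>opt"
      using best by (auto simp: best_approximation_def is_arg_min_def)
    note sub = anchored_family_subset_downward[of d n]
    note fin = card_anchored_family_le(1)[of d n] and cA = card_anchored_family_le(2)[of d n]
    \<comment> \<open>An anchored set involves at most n - 1 coordinates in any dimension, so n - 1
      takes the place of the dimension in the counts.\<close>
    have nN: "(n - 1) * n \<le> N * N" using N1 by (intro mult_le_mono) auto
    show "risk w
      \<le> (9 + 4 * sqrt 2) * (err un)\<^sup>2 + 8 * \<tau>\<^sup>2 * real m powr (- r)"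
      using cond
    proof (elim disjE)
      assume ?hyp
      show ?thesis
      proof (rule cross_bound[OF sub _ \<open>?hyp\<close> opt est])
        \<comment> \<open>Support in the first n - 1 coordinates, enlarged to N - 1 to match the
          cross in the condition.\<close>
        show "\<Lambda> \<subseteq> multi_indices (enat (N - 1))" if "\<Lambda> \<in> anchored_family d n" for \<Lambda>
          using subsetD[OF anchored_family_subset that] N1 by (auto simp: downward_family_enat multi_indices_enat)
      qed
    next
      assume ?pow2
      show ?thesis
      proof (rule union_bound[of "anchored_family d n" "2 ^ (N * N)", OF sub fin _ _ _ opt est])
        have "(2::nat) ^ ((n - 1) * n) \<le> 2 ^ (N * N)" using nN by (rule power_increasing) simp
        then have "card (anchored_family d n) \<le> 2 ^ (N * N)"
          using cA card_downward_family_le_power2[of "n - 1" n] by linarith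
        then have "real (card (anchored_family d n)) \<le> real (2 ^ (N * N))" by (rule of_nat_mono)
        then show "real (card (anchored_family d n)) \<le> 2 ^ (N * N)" by simp
      qed (use \<open>?pow2\<close> in \<open>simp_all add: ln_realpow power2_eq_square\<close>)
    next
      assume ?pow
      show ?thesis
      proof (rule union_bound[of "anchored_family d n" "real ((N * N) ^ N)", OF sub fin _ _ _ opt est])
        have NN: "1 \<le> N * N" using N1 by (simp add: Suc_le_eq)
        have "card (downward_family (enat (n - 1)) n) \<le> (N * N) ^ N"
          using assms(9) N1 nN NN by (intro card_downward_family_le_power') auto
        then show "real (card (anchored_family d n)) \<le> real ((N * N) ^ N)"
          using cA by (meson le_trans of_nat_le_iff)
        show "1 \<le> real ((N * N) ^ N)" using NN by (simp del: of_nat_power of_nat_mult)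
        have "ln (real ((N * N) ^ N)) = real N * (ln (real N) + ln (real N))"
          using N1 by (simp only: of_nat_power of_nat_mult) (simp add: ln_realpow ln_mult)
        then have "ln (real ((N * N) ^ N)) = 2 * real N * ln (real N)" by simp
        then show "real m / ln (real m) \<ge> (1 + r + ln (real ((N * N) ^ N)) / ln (real m)) * (real N powr s / \<zeta>)"
          using \<open>?pow\<close> by simp
      qed
    qed
  qed
qed

end
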